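(* Let $\kappa$ be a positive definite kernel on $X$, $\mathbf A=(A_i)_{i\in I}$ an $(I^+,I^-)$-condenser, and $\mathbf a$, $\mathbf g$ as in the context. Assume that $\kappa$ is continuous on $A^+\times A^-$, that $$\sup_{x\in K,\,y\in A^-}\kappa(x,y)<\infty\quad\text{for every compact }K\subset A^+,$$ and that $$\sup_{x\in K,\,y\in A^+}\kappa(x,y)<\infty\quad\text{for every compact }K\subset A^-.$$ Let moreover $f_i\in\Phi(X)$ for all $i\in I$, and let $\sum_{i\in I}a_i\,g_{i,\inf}^{-1}<\infty$. Then for every $\lambda\in\mathcal G_{\mathbf f}(\mathbf A,\mathbf a,\mathbf g)$ and every $i\in I$, $$a_i\,W_\lambda^i(x)\le\bigl\langle W_\lambda^i,\lambda^i\bigr\rangle\,g_i(x)\quad\text{for all }x\in S(\lambda^i),$$ and hence $$a_i\,W_\lambda^i(x)=\bigl\langle W_\lambda^i,\lambda^i\bigr\rangle\,g_i(x)\quad\text{n.e. in }S(\lambda^i).$$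
   Context: Let $X$ be a locally compact Hausdorff space and $\mathfrak M$ the space of real-valued (signed) Radon measures on $X$. For a locally compact space $Y$, $\Phi(Y)$ is the set of lower semicontinuous $\psi:Y\to(-\infty,\infty]$, with $\psi\ge0$ required unless $Y$ is compact. Write $\langle u,\nu\rangle:=\int u\,d\nu$; $S(\nu)$ is the support of $\nu$. A kernel is an element $\kappa\in\Phi(X\times X)$; $\kappa(\nu,\nu_1):=\int\kappa\,d(\nu\otimes\nu_1)$ and $\kappa(x,\nu):=\int\kappa(x,y)\,d\nu(y)$ whenever well defined. $\kappa$ is positive definite if it is symmetric and $\kappa(\nu,\nu)\ge0$ for every $\nu\in\mathfrak M$ for which it is defined. Then $\mathcal E:=\{\nu\in\mathfrak M:-\infty<\kappa(\nu,\nu)<\infty\}$ is a pre-Hilbert space with scalar product $\kappa(\nu,\nu_1)$ and seminorm $\|\nu\|:=\sqrt{\kappa(\nu,\nu)}$. $\mathfrak M^+(E)$ is the set of nonnegative measures supported by the closed set $E$; $\mathcal E^+:=\mathfrak M^+(X)\cap\mathcal E$. The interior capacity of $E\subset X$ is $C(E):=[\inf\|\nu\|^2]^{-1}$, the infimum over $\nu\in\mathcal E^+$ with $\nu(X)=1$ and compact support contained in $E$ ($\inf\varnothing=\infty$, $1/\infty=0$, $1/0=\infty$). A property holds nearly everywhere (n.e.) in $E$ if the set of $x\in E$ where it fails has interior capacity zero. $I^+$, $I^-$ are disjoint countable (finite or infinite) sets of indices in $\mathbb N$, $I^-$ possibly empty, $I=I^+\cup I^-$; $\alpha_i=+1$ for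 $i\in I^+$ and $\alpha_i=-1$ for $i\in I^-$. An $(I^+,I^-)$-condenser is a family $\mathbf A=(A_i)_{i\in I}$ of nonempty closed sets in $X$ such that every compact set meets at most finitely many $A_i$ and $A_i\cap A_j=\varnothing$ for $i\in I^+$, $j\in I^-$. $A^\pm:=\bigcup_{i\in I^\pm}A_i$. $\mathfrak M(\mathbf A):=\prod_{i\in I}\mathfrak M^+(A_i)$ consists of vector measures $\mu=(\mu^i)_{i\in I}$. Put $\kappa(\mu,\mu_1):=\sum_{i,j\in I}\alpha_i\alpha_j\kappa(\mu^i,\mu_1^j)$ and $\kappa_\mu=(\kappa^i_\mu)_{i\in I}$ with $\kappa_\mu^i(x):=\sum_{j\in I}\alpha_i\alpha_j\kappa(x,\mu^j)$. $\mathcal E(\mathbf A)$ is the set of $\mu\in\mathfrak M(\mathbf A)$ with $\kappa(\mu,\mu)$ finite (absolute convergence). $\mathbf f=(f_i)_{i\in I}$ is the external field. $\mathbf g=(g_i)_{i\in I}$ with $g_i:A_i\to(0,\infty)$ continuous; $\mathbf a=(a_i)_{i\in I}$ with $a_i>0$; $g_{i,\inf}:=\inf_{A_i}g_i$. $\langle\mathbf f,\mu\rangle:=\sum_{i\in I}\langle f_i,\mu^i\rangle$ (finite iff the series converges absolutely). $\mathbf W_\mu=(W^i_\mu)_{i\in I}:=\kappa_\mu+\mathbf f$ and $G_{\mathbf f}(\mu):=\kappa(\mu,\mu)+2\langle\mathbf f,\mu\rangle$. $\mathcal E_{\mathbf f}(\mathbf A,\mathbf a,\mathbf g)$ is the set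 of $\mu\in\mathcal E(\mathbf A)$ with $\langle g_i,\mu^i\rangle=a_i$ for all $i\in I$ and $\langle\mathbf f,\mu\rangle$ finite. $G_{\mathbf f}(\mathbf A,\mathbf a,\mathbf g):=\inf_{\mu\in\mathcal E_{\mathbf f}(\mathbf A,\mathbf a,\mathbf g)}G_{\mathbf f}(\mu)$ ($\inf\varnothing=+\infty$). $\mathcal G_{\mathbf f}(\mathbf A,\mathbf a,\mathbf g)$ is the set of $\lambda\in\mathcal E_{\mathbf f}(\mathbf A,\mathbf a,\mathbf g)$ with $G_{\mathbf f}(\lambda)=G_{\mathbf f}(\mathbf A,\mathbf a,\mathbf g)$ (equilibrium measures). *)

theory Defs
  imports "HOL-Analysis.Analysis"
begin

(* Integral of an extended real function, as the integral of the positive part minus that of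
   the negative part.  It is well defined iff these are not both infinite.  In ereal,
   \<infinity> - \<infinity> = \<infinity>, so a finite value of eint certifies absolute integrability.  With
   M = count_space J it is the sum over J, and a finite value certifies absolute convergence. *)
definition eint :: "'b measure \<Rightarrow> ('b \<Rightarrow> ereal) \<Rightarrow> ereal" where
  "eint M u = enn2ereal (\<integral>\<^sup>+x. e2ennreal (u x) \<partial>M) - enn2ereal (\<integral>\<^sup>+x. e2ennreal (- u x) \<partial>M)"

abbreviation esum :: "'b set \<Rightarrow> ('b \<Rightarrow> ereal) \<Rightarrow> ereal" where
  "esum J \<equiv> eint (count_space J)"

definition lower_semicontinuous :: "('b::topological_space \<Rightarrow> ereal) \<Rightarrow> bool" where
  "lower_semicontinuous \<psi> \<longleftrightarrow> (\<forall>c. open {x. c < \<psi> x})"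

definition Phi :: "('b::topological_space \<Rightarrow> ereal) set" where
  "Phi = {\<psi>. lower_semicontinuous \<psi> \<and> (\<forall>x. -\<infinity> < \<psi> x) \<and>
     (\<not> compact (UNIV :: 'b set) \<longrightarrow> (\<forall>x. 0 \<le> \<psi> x))}"

(* Nonnegative Radon measures.  On a locally compact Hausdorff space these Borel measures
   correspond bijectively to the positive linear functionals on the continuous functions with
   compact support; total masses may be infinite. *)
definition radon_measure :: "'b::topological_space measure \<Rightarrow> bool" where
  "radon_measure M \<longleftrightarrow> sets M = sets borel \<and>
     (\<forall>K. compact K \<longrightarrow> emeasure M K < \<infinity>) \<and>
     (\<forall>B\<in>sets borel. emeasure M B = (SUP K\<in>{K. compact K \<and> K \<subseteq> B}. emeasure M K))"

(* A signed Radon measure \<nu> is given by its Jordan decomposition \<nu> = P - N.  P and N may both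
   have infinite total mass, so P - N need not be a set function on all Borel sets, and mutual
   singularity (the infimum of P and N is 0) is expressed on compact sets. *)
definition signed_radon :: "'b::topological_space measure \<Rightarrow> 'b measure \<Rightarrow> bool" where
  "signed_radon P N \<longleftrightarrow> radon_measure P \<and> radon_measure N \<and>
     (\<forall>K. compact K \<longrightarrow> (\<exists>B\<in>sets borel. emeasure P (K \<inter> B) = 0 \<and> emeasure N (K - B) = 0))"

definition msupport :: "'b::topological_space measure \<Rightarrow> 'b set" where
  "msupport M = {x. \<forall>U. open U \<longrightarrow> x \<in> U \<longrightarrow> 0 < emeasure M U}"

definition radon_on :: "'b::topological_space set \<Rightarrow> 'b measure set" where
  "radon_on E = {M. radon_measure M \<and> msupport M \<subseteq> E}"

(* The Radon product measure, determined by its values on compact rectangles.  The library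
   product of measures lives on the product sigma-algebra, which is in general too small for
   semicontinuous kernels when the space is not second countable. *)
definition radon_prod ::
    "'b::topological_space measure \<Rightarrow> 'c::topological_space measure \<Rightarrow> ('b \<times> 'c) measure" where
  "radon_prod M N = (THE R. radon_measure R \<and>
     (\<forall>K L. compact K \<longrightarrow> compact L \<longrightarrow> emeasure R (K \<times> L) = emeasure M K * emeasure N L))"

definition mutual_energy :: "('a::topological_space \<times> 'a \<Rightarrow> ereal) \<Rightarrow> 'a measure \<Rightarrow> 'a measure \<Rightarrow> ereal" where
  "mutual_energy \<kappa> \<mu> \<nu> = eint (radon_prod \<mu> \<nu>) \<kappa>"

definition potential :: "('a::topological_space \<times> 'a \<Rightarrow> ereal) \<Rightarrow> 'a \<Rightarrow> 'a measure \<Rightarrow> ereal" where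
  "potential \<kappa> x \<nu> = eint \<nu> (\<lambda>y. \<kappa> (x, y))"

definition kernel :: "('a::topological_space \<times> 'a \<Rightarrow> ereal) \<Rightarrow> bool" where
  "kernel \<kappa> \<longleftrightarrow> \<kappa> \<in> Phi"

(* For \<nu> = P - N, the Jordan decomposition of \<nu> \<otimes> \<nu> has the positive part P \<otimes> P + N \<otimes> N and the
   negative part P \<otimes> N + N \<otimes> P. *)
definition signed_energy_defined ::
    "('a::topological_space \<times> 'a \<Rightarrow> ereal) \<Rightarrow> 'a measure \<Rightarrow> 'a measure \<Rightarrow> bool" where
  "signed_energy_defined \<kappa> P N \<longleftrightarrow>
     \<not> (mutual_energy \<kappa> P P + mutual_energy \<kappa> N N = \<infinity> \<and>
        mutual_energy \<kappa> P N + mutual_energy \<kappa> N P = \<infinity>)"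

definition signed_energy ::
    "('a::topological_space \<times> 'a \<Rightarrow> ereal) \<Rightarrow> 'a measure \<Rightarrow> 'a measure \<Rightarrow> ereal" where
  "signed_energy \<kappa> P N =
     (mutual_energy \<kappa> P P + mutual_energy \<kappa> N N) - (mutual_energy \<kappa> P N + mutual_energy \<kappa> N P)"

definition positive_definite :: "('a::topological_space \<times> 'a \<Rightarrow> ereal) \<Rightarrow> bool" where
  "positive_definite \<kappa> \<longleftrightarrow> (\<forall>x y. \<kappa> (x, y) = \<kappa> (y, x)) \<and>
     (\<forall>P N. signed_radon P N \<longrightarrow> signed_energy_defined \<kappa> P N \<longrightarrow> 0 \<le> signed_energy \<kappa> P N)"

definition finite_energy_pos :: "('a::topological_space \<times> 'a \<Rightarrow> ereal) \<Rightarrow> 'a measure set" where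
  "finite_energy_pos \<kappa> = {\<nu>. radon_measure \<nu> \<and> \<bar>mutual_energy \<kappa> \<nu> \<nu>\<bar> \<noteq> \<infinity>}"

definition capacity :: "('a::topological_space \<times> 'a \<Rightarrow> ereal) \<Rightarrow> 'a set \<Rightarrow> ereal" where
  "capacity \<kappa> E = inverse (INF \<nu>\<in>{\<nu>\<in>finite_energy_pos \<kappa>.
     emeasure \<nu> UNIV = 1 \<and> compact (msupport \<nu>) \<and> msupport \<nu> \<subseteq> E}. mutual_energy \<kappa> \<nu> \<nu>)"

definition nearly_everywhere ::
    "('a::topological_space \<times> 'a \<Rightarrow> ereal) \<Rightarrow> 'a set \<Rightarrow> ('a \<Rightarrow> bool) \<Rightarrow> bool" where
  "nearly_everywhere \<kappa> E Q \<longleftrightarrow> capacity \<kappa> {x\<in>E. \<not> Q x} = 0"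

definition condenser :: "nat set \<Rightarrow> nat set \<Rightarrow> (nat \<Rightarrow> 'a::topological_space set) \<Rightarrow> bool" where
  "condenser Iplus Iminus A \<longleftrightarrow> Iplus \<inter> Iminus = {} \<and> Iplus \<noteq> {} \<and>
     (\<forall>i\<in>Iplus \<union> Iminus. closed (A i) \<and> A i \<noteq> {}) \<and>
     (\<forall>K. compact K \<longrightarrow> finite {i\<in>Iplus \<union> Iminus. A i \<inter> K \<noteq> {}}) \<and>
     (\<forall>i\<in>Iplus. \<forall>j\<in>Iminus. A i \<inter> A j = {})"

definition idx_sign :: "nat set \<Rightarrow> nat \<Rightarrow> ereal" where
  "idx_sign Iplus i = (if i \<in> Iplus then 1 else - 1)"

(* Vector measures are families indexed by nat; only the components with index in Iplus \<union> Iminus matter. *)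
definition vector_measures ::
    "nat set \<Rightarrow> nat set \<Rightarrow> (nat \<Rightarrow> 'a::topological_space set) \<Rightarrow> (nat \<Rightarrow> 'a measure) set" where
  "vector_measures Iplus Iminus A = Pi (Iplus \<union> Iminus) (\<lambda>i. radon_on (A i))"

definition vector_mutual_energy :: "('a::topological_space \<times> 'a \<Rightarrow> ereal) \<Rightarrow> nat set \<Rightarrow> nat set \<Rightarrow>
    (nat \<Rightarrow> 'a measure) \<Rightarrow> (nat \<Rightarrow> 'a measure) \<Rightarrow> ereal" where
  "vector_mutual_energy \<kappa> Iplus Iminus \<mu> \<mu>1 = esum ((Iplus \<union> Iminus) \<times> (Iplus \<union> Iminus))
     (\<lambda>(i, j). idx_sign Iplus i * idx_sign Iplus j * mutual_energy \<kappa> (\<mu> i) (\<mu>1 j))"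

definition vector_potential :: "('a::topological_space \<times> 'a \<Rightarrow> ereal) \<Rightarrow> nat set \<Rightarrow> nat set \<Rightarrow>
    (nat \<Rightarrow> 'a measure) \<Rightarrow> nat \<Rightarrow> 'a \<Rightarrow> ereal" where
  "vector_potential \<kappa> Iplus Iminus \<mu> i x =
     esum (Iplus \<union> Iminus) (\<lambda>j. idx_sign Iplus i * idx_sign Iplus j * potential \<kappa> x (\<mu> j))"

definition vector_finite_energy :: "('a::topological_space \<times> 'a \<Rightarrow> ereal) \<Rightarrow> nat set \<Rightarrow> nat set \<Rightarrow>
    (nat \<Rightarrow> 'a set) \<Rightarrow> (nat \<Rightarrow> 'a measure) set" where
  "vector_finite_energy \<kappa> Iplus Iminus A =
     {\<mu>\<in>vector_measures Iplus Iminus A. \<bar>vector_mutual_energy \<kappa> Iplus Iminus \<mu> \<mu>\<bar> \<noteq> \<infinity>}"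

definition field_pairing :: "nat set \<Rightarrow> nat set \<Rightarrow> (nat \<Rightarrow> 'a \<Rightarrow> ereal) \<Rightarrow>
    (nat \<Rightarrow> 'a::topological_space measure) \<Rightarrow> ereal" where
  "field_pairing Iplus Iminus f \<mu> = esum (Iplus \<union> Iminus) (\<lambda>i. eint (\<mu> i) (f i))"

definition weighted_potential :: "('a::topological_space \<times> 'a \<Rightarrow> ereal) \<Rightarrow> nat set \<Rightarrow> nat set \<Rightarrow>
    (nat \<Rightarrow> 'a \<Rightarrow> ereal) \<Rightarrow> (nat \<Rightarrow> 'a measure) \<Rightarrow> nat \<Rightarrow> 'a \<Rightarrow> ereal" where
  "weighted_potential \<kappa> Iplus Iminus f \<mu> i x = vector_potential \<kappa> Iplus Iminus \<mu> i x + f i x"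

definition gauss_functional :: "('a::topological_space \<times> 'a \<Rightarrow> ereal) \<Rightarrow> nat set \<Rightarrow> nat set \<Rightarrow>
    (nat \<Rightarrow> 'a \<Rightarrow> ereal) \<Rightarrow> (nat \<Rightarrow> 'a measure) \<Rightarrow> ereal" where
  "gauss_functional \<kappa> Iplus Iminus f \<mu> =
     vector_mutual_energy \<kappa> Iplus Iminus \<mu> \<mu> + 2 * field_pairing Iplus Iminus f \<mu>"

(* g i is a function on A i, so it is integrated over A i; its values elsewhere are irrelevant. *)
definition admissible :: "('a::topological_space \<times> 'a \<Rightarrow> ereal) \<Rightarrow> nat set \<Rightarrow> nat set \<Rightarrow>
    (nat \<Rightarrow> 'a set) \<Rightarrow> (nat \<Rightarrow> real) \<Rightarrow> (nat \<Rightarrow> 'a \<Rightarrow> real) \<Rightarrow> (nat \<Rightarrow> 'a \<Rightarrow> ereal) \<Rightarrow>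
    (nat \<Rightarrow> 'a measure) set" where
  "admissible \<kappa> Iplus Iminus A a g f = {\<mu>\<in>vector_finite_energy \<kappa> Iplus Iminus A.
     (\<forall>i\<in>Iplus \<union> Iminus. (\<integral>\<^sup>+x\<in>A i. ennreal (g i x) \<partial>\<mu> i) = ennreal (a i)) \<and>
     \<bar>field_pairing Iplus Iminus f \<mu>\<bar> \<noteq> \<infinity>}"

definition gauss_infimum :: "('a::topological_space \<times> 'a \<Rightarrow> ereal) \<Rightarrow> nat set \<Rightarrow> nat set \<Rightarrow>
    (nat \<Rightarrow> 'a set) \<Rightarrow> (nat \<Rightarrow> real) \<Rightarrow> (nat \<Rightarrow> 'a \<Rightarrow> real) \<Rightarrow> (nat \<Rightarrow> 'a \<Rightarrow> ereal) \<Rightarrow> ereal" where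
  "gauss_infimum \<kappa> Iplus Iminus A a g f =
     (INF \<mu>\<in>admissible \<kappa> Iplus Iminus A a g f. gauss_functional \<kappa> Iplus Iminus f \<mu>)"

definition equilibrium_measures :: "('a::topological_space \<times> 'a \<Rightarrow> ereal) \<Rightarrow> nat set \<Rightarrow> nat set \<Rightarrow>
    (nat \<Rightarrow> 'a set) \<Rightarrow> (nat \<Rightarrow> real) \<Rightarrow> (nat \<Rightarrow> 'a \<Rightarrow> real) \<Rightarrow> (nat \<Rightarrow> 'a \<Rightarrow> ereal) \<Rightarrow>
    (nat \<Rightarrow> 'a measure) set" where
  "equilibrium_measures \<kappa> Iplus Iminus A a g f = {\<mu>\<in>admissible \<kappa> Iplus Iminus A a g f.
     gauss_functional \<kappa> Iplus Iminus f \<mu> = gauss_infimum \<kappa> Iplus Iminus A a g f}"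

end

theory Submission
  imports Defs
begin

text \<open>
  Fix a component \<open>i\<close> of the minimiser \<open>lam\<close>, write \<open>W\<close> for its weighted potential and \<open>c\<close> for
  the integral of \<open>W\<close> against \<open>lam i\<close>.  Replacing \<open>lam i\<close> by \<open>(1 - t) * lam i + t * \<nu>\<close>, where \<open>\<nu>\<close>
  lives on \<open>A i\<close> and has the same integral \<open>a i\<close> of \<open>g i\<close>, changes the Gauss functional by
  \<open>2 * t * (\<integral>W d\<nu> - c)\<close> plus a multiple of \<open>t\<^sup>2\<close>.  Minimality therefore forces \<open>c \<le> \<integral>W d\<nu>\<close>
  (\<open>variational_inequality\<close>).

  Now suppose that a measure of finite energy had compact support inside the set where
  \<open>a i * W < c * g i\<close>.  On that compact set \<open>W\<close> lies below a multiple of \<open>g i\<close>, hence is bounded above, and it is bounded below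
  because the kernel is bounded above against the components of the other sign; so, after scaling,
  the measure is an admissible competitor, and its integral of \<open>W\<close> is smaller than \<open>c\<close>, a
  contradiction (\<open>no_energy_on_sublevel\<close>).  This has two consequences.  The set has interior
  capacity zero; and, applied to the restrictions of \<open>lam i\<close> to compact sets, it shows that
  \<open>a i * W \<ge> c * g i\<close> almost everywhere for \<open>lam i\<close>.  Both sides have the same integral \<open>a i * c\<close>,
  so they agree almost everywhere (\<open>AE_equality\<close>).

  It remains to pass from almost every point to every point of the support.  The potentials of the
  components of the same sign as \<open>i\<close> are lower semicontinuous, and so is the external field.
  The potentials of the components of the other sign enter with a minus sign, but on compact
  subsets of \<open>A i\<close> the kernel is continuous and bounded against them, so that \<open>C - \<kappa>\<close> is again a
  nonnegative lower semicontinuous kernel and minus their sum is lower semicontinuous up to a finite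
  constant (\<open>minus_sum_complement\<close>).  Hence \<open>W\<close> is lower semicontinuous on \<open>A i\<close>, a point where
  \<open>a i * W > c * g i\<close> has a neighbourhood that meets \<open>A i\<close> only in such points, and this
  neighbourhood is null for \<open>lam i\<close>.

  The measure theory behind this has to work on spaces without a countable base, where the Borel
  sets of a product are not generated by measurable rectangles.  Since \<open>\<Sum>a i / inf g i\<close> is finite,
  the components of \<open>lam\<close> are finite measures, and so are the competitors; for finite Radon
  measures the product is constructed directly as \<open>B \<mapsto> \<integral>N (B\<^sub>x) dM(x)\<close>.  Compactness in the
  second factor (the tube lemma) makes sections of open sets lower semicontinuous in \<open>x\<close>, which
  gives measurability, inner regularity and, together with uniqueness, the interchange of the order
  of integration for all Borel functions.
\<close>

section \<open>Integrals of extended real functions and lower semicontinuity\<close>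

lemma eint_cong_AE:
  assumes "AE x in M. u x = v x" shows "eint M u = eint M v"
proof -
  have "(\<integral>\<^sup>+x. e2ennreal (u x) \<partial>M) = (\<integral>\<^sup>+x. e2ennreal (v x) \<partial>M)"
    by (rule nn_integral_cong_AE) (use assms in auto)
  moreover have "(\<integral>\<^sup>+x. e2ennreal (- u x) \<partial>M) = (\<integral>\<^sup>+x. e2ennreal (- v x) \<partial>M)"
    by (rule nn_integral_cong_AE) (use assms in auto)
  ultimately show ?thesis by (simp add: eint_def)
qed

text \<open>With \<open>u\<^sup>+\<close> and \<open>u\<^sup>-\<close> for the two parts that \<open>eint\<close> integrates, \<open>u\<^sup>+ + q = u\<^sup>- + p\<close> wherever \<open>q\<close> is
finite, and \<open>u\<^sup>- \<le> q\<close>, so integrating and subtracting is legitimate.  This is how every signed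
integral, sum or energy below is reduced to nonnegative ones.\<close>

lemma eint_eq_diff:
  assumes [measurable]: "p \<in> borel_measurable M" "q \<in> borel_measurable M"
    and u: "AE x in M. u x = enn2ereal (p x) - enn2ereal (q x)"
    and q: "(\<integral>\<^sup>+x. q x \<partial>M) < \<infinity>"
  shows "eint M u = enn2ereal (\<integral>\<^sup>+x. p x \<partial>M) - enn2ereal (\<integral>\<^sup>+x. q x \<partial>M)"
proof -
  let ?v = "\<lambda>x. enn2ereal (p x) - enn2ereal (q x)"
  let ?A = "\<integral>\<^sup>+x. e2ennreal (?v x) \<partial>M" and ?B = "\<integral>\<^sup>+x. e2ennreal (- ?v x) \<partial>M"
  have fin: "AE x in M. q x \<noteq> \<infinity>" using q by (intro nn_integral_PInf_AE) auto
  have pt: "e2ennreal (?v x) + q x = e2ennreal (- ?v x) + p x" "e2ennreal (- ?v x) \<le> q x"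
    if "q x \<noteq> \<infinity>" for x
  proof -
    obtain s where s: "q x = ennreal s" "0 \<le> s" using \<open>q x \<noteq> \<infinity>\<close> by (cases "q x") auto
    have "e2ennreal (?v x) + q x = e2ennreal (- ?v x) + p x \<and> e2ennreal (- ?v x) \<le> q x"
    proof (cases "p x")
      case (real r)
      then show ?thesis using s
        by (cases "r \<le> s") (auto simp: ennreal_neg simp flip: ennreal_plus intro!: ennreal_leI)
    next
      case top
      then show ?thesis using s by (simp add: e2ennreal_neg)
    qed
    then show "e2ennreal (?v x) + q x = e2ennreal (- ?v x) + p x" "e2ennreal (- ?v x) \<le> q x" by auto
  qed
  have "?A + (\<integral>\<^sup>+x. q x \<partial>M) = (\<integral>\<^sup>+x. e2ennreal (?v x) + q x \<partial>M)"
    by (rule nn_integral_add[symmetric]) measurable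
  also have "\<dots> = (\<integral>\<^sup>+x. e2ennreal (- ?v x) + p x \<partial>M)"
    by (rule nn_integral_cong_AE) (use fin pt(1) in auto)
  also have "\<dots> = ?B + (\<integral>\<^sup>+x. p x \<partial>M)"
    by (rule nn_integral_add) measurable
  finally have eq: "?A + (\<integral>\<^sup>+x. q x \<partial>M) = ?B + (\<integral>\<^sup>+x. p x \<partial>M)" .
  have B: "?B \<le> (\<integral>\<^sup>+x. q x \<partial>M)"
    by (rule nn_integral_mono_AE) (use fin pt(2) in auto)
  have "enn2ereal ?A - enn2ereal ?B = enn2ereal (\<integral>\<^sup>+x. p x \<partial>M) - enn2ereal (\<integral>\<^sup>+x. q x \<partial>M)"
  proof -
    have "enn2ereal a - enn2ereal b = enn2ereal P - enn2ereal Q"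
      if e: "a + Q = b + P" "b \<le> Q" "Q < \<infinity>" for a b P Q :: ennreal
    proof -
      obtain s where s: "Q = ennreal s" "0 \<le> s" using e(3) by (cases Q) auto
      obtain t where t: "b = ennreal t" "0 \<le> t" using e(2,3) by (cases b) auto
      show ?thesis
      proof (cases P)
        case (real r)
        then have "a + Q \<noteq> top" using e(1) t by simp
        then have "a \<noteq> top" by auto
        then obtain w where "a = ennreal w" "0 \<le> w" by (cases a) auto
        then show ?thesis using e(1) s t real by (simp flip: ennreal_plus)
      next
        case top
        then have "a = top" using e(1) s by (cases a) (auto simp flip: ennreal_plus)
        then show ?thesis using top s t by simp
      qed
    qed
    from this[OF eq B q] show ?thesis .
  qed
  moreover have "eint M u = eint M ?v" by (rule eint_cong_AE[OF u])
  ultimately show ?thesis by (simp add: eint_def)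
qed

lemma eint_integrable:
  assumes "integrable M r" "AE x in M. u x = ereal (r x)"
  shows "eint M u = ereal (\<integral>x. r x \<partial>M)"
proof -
  have "eint M u = eint M (\<lambda>x. ereal (r x))" by (rule eint_cong_AE) fact
  also have "\<dots> = ereal (\<integral>x. r x \<partial>M)"
  proof -
    have "(\<integral>\<^sup>+x. ennreal (r x) \<partial>M) \<noteq> \<infinity>" "(\<integral>\<^sup>+x. ennreal (- r x) \<partial>M) \<noteq> \<infinity>"
      using assms(1) real_integrable_def by blast+
    then show ?thesis unfolding eint_def real_lebesgue_integral_def[OF assms(1)]
      by (cases "\<integral>\<^sup>+x. ennreal (r x) \<partial>M"; cases "\<integral>\<^sup>+x. ennreal (- r x) \<partial>M") auto
  qed
  finally show ?thesis .
qed

lemma eint_finiteD: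
  assumes [measurable]: "u \<in> borel_measurable M" and fin: "\<bar>eint M u\<bar> \<noteq> \<infinity>"
  shows "(\<integral>\<^sup>+x. e2ennreal (u x) \<partial>M) < \<infinity>" "(\<integral>\<^sup>+x. e2ennreal (- u x) \<partial>M) < \<infinity>"
    and "AE x in M. u x = ereal (real_of_ereal (u x))" 
    and "integrable M (\<lambda>x. real_of_ereal (u x))"
proof -
  show 1: "(\<integral>\<^sup>+x. e2ennreal (u x) \<partial>M) < \<infinity>" and 2: "(\<integral>\<^sup>+x. e2ennreal (- u x) \<partial>M) < \<infinity>"
    using fin unfolding eint_def
    by (cases "\<integral>\<^sup>+x. e2ennreal (u x) \<partial>M"; cases "\<integral>\<^sup>+x. e2ennreal (- u x) \<partial>M"; simp)+
  have a: "AE x in M. e2ennreal (u x) \<noteq> \<infinity>" using 1 by (intro nn_integral_PInf_AE) auto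
  have b: "AE x in M. e2ennreal (- u x) \<noteq> \<infinity>" using 2 by (intro nn_integral_PInf_AE) auto
  from a b show ae: "AE x in M. u x = ereal (real_of_ereal (u x))"
  proof eventually_elim
    case (elim x) then show ?case by (cases "u x") auto
  qed
  have "(\<integral>\<^sup>+x. ennreal (real_of_ereal (u x)) \<partial>M) = (\<integral>\<^sup>+x. e2ennreal (u x) \<partial>M)"
    by (rule nn_integral_cong_AE) (use ae in \<open>auto elim!: eventually_mono simp flip: e2ennreal_ereal\<close>)
  moreover have "(\<integral>\<^sup>+x. ennreal (- real_of_ereal (u x)) \<partial>M) = (\<integral>\<^sup>+x. e2ennreal (- u x) \<partial>M)"
    by (rule nn_integral_cong_AE) (use ae in \<open>auto elim!: eventually_mono simp flip: e2ennreal_ereal uminus_ereal.simps\<close>)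
  ultimately show "integrable M (\<lambda>x. real_of_ereal (u x))"
    using 1 2 unfolding real_integrable_def by (simp add: less_top)
qed

definition lsc :: "('b::topological_space \<Rightarrow> ennreal) \<Rightarrow> bool" where
  "lsc u \<longleftrightarrow> (\<forall>s. open {x. s < u x})"

lemma lscI:
  assumes "\<And>s x. s < u x \<Longrightarrow> \<exists>U. open U \<and> x \<in> U \<and> (\<forall>y\<in>U. s < u y)"
  shows "lsc u"
  unfolding lsc_def
proof
  fix s show "open {x. s < u x}"
    unfolding open_subopen[of "{x. s < u x}"] using assms[of s] by (simp add: subset_eq)
qed

lemma lsc_borel: "lsc u \<Longrightarrow> u \<in> borel_measurable borel"
  unfolding lsc_def by (intro borel_measurableI_greater) auto

lemma lsc_const [simp]: "lsc (\<lambda>_. c)" by (simp add: lsc_def)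

text \<open>The two summands can be lowered strictly without losing \<open>s < t + T\<close>, unless a summand is zero and
cannot be lowered at all.  This drives the approximation of sums from below.\<close>

lemma ennreal_less_add_split:
  fixes t T s :: ennreal
  assumes "s < t + T"
  obtains p q where "p < t \<or> p = 0" "q < T \<or> q = 0" "s < p + q"
proof (cases "t = 0 \<or> T = 0 \<or> t = top \<or> T = top")
  case True
  have *: "\<exists>p q. (p < t \<or> p = 0) \<and> (q < T \<or> q = 0) \<and> s < p + q"
  proof -
    obtain r where r: "s < r" "r < t + T" using dense[OF assms] by blast
    consider "t = 0" | "T = 0" | "t = top" | "T = top" using True by blast
    then show ?thesis
    proof cases
      case 1 then show ?thesis using r by (intro exI[of _ 0] exI[of _ r]) auto
    next
      case 2 then show ?thesis using r by (intro exI[of _ r] exI[of _ 0]) auto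
    next
      case 3 then show ?thesis using r by (intro exI[of _ r] exI[of _ 0]) (auto simp: top.not_eq_extremum)
    next
      case 4 then show ?thesis using r by (intro exI[of _ 0] exI[of _ r]) (auto simp: top.not_eq_extremum)
    qed
  qed
  then show ?thesis using that by blast
next
  case False
  then obtain a b where ab: "t = ennreal a" "0 < a" "T = ennreal b" "0 < b"
    by (cases t; cases T) (auto simp: ennreal_eq_0_iff not_le le_less)
  have "s \<noteq> top" using assms by auto
  then obtain c where c: "s = ennreal c" "0 \<le> c" by (cases s) auto
  have "c < a + b" using assms ab c by (simp flip: ennreal_plus add: ennreal_less_iff)
  \<comment> \<open>Lowering both summands by at most a third of the gap leaves the sum above \<open>c\<close>.\<close>
  obtain d where d: "0 < d" "d \<le> a" "d \<le> b" "d \<le> (a + b - c) / 3"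
  proof
    show "0 < min a (min b ((a + b - c) / 3))" using ab \<open>c < a + b\<close> by simp
  qed (auto simp: min_def)
  have "s < ennreal ((a - d) + (b - d))"
    using c d ab \<open>c < a + b\<close> by (simp add: ennreal_less_iff)
  then have "s < ennreal (a - d) + ennreal (b - d)"
    using d by (subst ennreal_plus[symmetric]) auto
  moreover have "ennreal (a - d) < t" "ennreal (b - d) < T"
    using ab d by (auto simp: ennreal_less_iff)
  ultimately show ?thesis using that by blast
qed

lemma lsc_nbhd:
  assumes "lsc u" "s < u x \<or> s = 0"
  obtains U where "open U" "x \<in> U" "\<And>y. y \<in> U \<Longrightarrow> s \<le> u y"
proof (cases "s = 0")
  case True then show ?thesis using that[of UNIV] by auto
next
  case False then show ?thesis using that[of "{x. s < u x}"] assms by (auto simp: lsc_def)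
qed

lemma lsc_add:
  assumes "lsc u" "lsc v" shows "lsc (\<lambda>x. u x + v x)"
proof (rule lscI)
  fix s x assume "s < u x + v x"
  then obtain p q where pq: "p < u x \<or> p = 0" "q < v x \<or> q = 0" "s < p + q"
    by (rule ennreal_less_add_split)
  obtain U where U: "open U" "x \<in> U" "\<And>y. y \<in> U \<Longrightarrow> p \<le> u y" using lsc_nbhd[OF assms(1) pq(1)] by metis
  obtain V where V: "open V" "x \<in> V" "\<And>y. y \<in> V \<Longrightarrow> q \<le> v y" using lsc_nbhd[OF assms(2) pq(2)] by metis
  show "\<exists>U. open U \<and> x \<in> U \<and> (\<forall>y\<in>U. s < u y + v y)"
    using U V pq(3) by (intro exI[of _ "U \<inter> V"]) (auto intro: less_le_trans add_mono)
qed

lemma lsc_SUP: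
  assumes "\<And>i. i \<in> J \<Longrightarrow> lsc (u i)" shows "lsc (\<lambda>x. SUP i\<in>J. u i x)"
proof -
  have "{x. s < (SUP i\<in>J. u i x)} = (\<Union>i\<in>J. {x. s < u i x})" for s
    by (auto simp: less_SUP_iff)
  then show ?thesis using assms by (auto simp: lsc_def)
qed

lemma lsc_sum: "finite S \<Longrightarrow> (\<And>i. i \<in> S \<Longrightarrow> lsc (u i)) \<Longrightarrow> lsc (\<lambda>x. \<Sum>i\<in>S. u i x)"
  by (induction S rule: finite_induct) (auto intro: lsc_add)

text \<open>A countable sum of nonnegative terms is the supremum of its finite partial sums, and lower
semicontinuity survives finite sums and suprema.\<close>

lemma lsc_count_space_sum:
  fixes J :: "nat set"
  assumes "\<And>j. j \<in> J \<Longrightarrow> lsc (u j)"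
  shows "lsc (\<lambda>x. \<integral>\<^sup>+j. u j x \<partial>count_space J)"
proof -
  have "(\<integral>\<^sup>+j. u j x \<partial>count_space J) = (SUP n. \<Sum>j\<in>J \<inter> {..<n}. u j x)" for x
  proof -
    have "(\<integral>\<^sup>+j. u j x \<partial>count_space J) = (\<Sum>j. u j x * indicator J j)"
      by (simp add: nn_integral_count_space_indicator nn_integral_count_space_nat)
    also have "\<dots> = (SUP n. \<Sum>j<n. u j x * indicator J j)"
      by (rule suminf_eq_SUP)
    also have "(\<lambda>n. \<Sum>j<n. u j x * indicator J j) = (\<lambda>n. \<Sum>j\<in>J \<inter> {..<n}. u j x)"
      by (intro ext sum.mono_neutral_cong_right) (auto simp: indicator_def)
    finally show ?thesis .
  qed
  then show ?thesis
    by (simp, intro lsc_SUP lsc_sum) (use assms in auto)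
qed

lemma lsc_enn2ereal_nbhd:
  assumes "lsc u" "r < enn2ereal (u x)"
  obtains U where "open U" "x \<in> U" "\<And>y. y \<in> U \<Longrightarrow> r < enn2ereal (u y)"
proof (cases "r < 0")
  case True then show ?thesis using that[of UNIV] by (auto intro: less_le_trans[OF _ enn2ereal_nonneg])
next
  case False
  then have r: "enn2ereal (e2ennreal r) = r" by (simp add: enn2ereal_e2ennreal)
  then have *: "r < enn2ereal t \<longleftrightarrow> e2ennreal r < t" for t
    by (metis less_ennreal.rep_eq)
  show ?thesis
    using that[of "{y. e2ennreal r < u y}"] assms * by (auto simp: lsc_def)
qed

section \<open>Finite Radon measures\<close>

definition finite_radon :: "'b::topological_space measure \<Rightarrow> bool" where
  "finite_radon M \<longleftrightarrow> radon_measure M \<and> emeasure M UNIV < \<infinity>"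

lemma finite_radonD:
  assumes "finite_radon M"
  shows finite_radon_sets: "sets M = sets borel" and finite_radon_space: "space M = UNIV"
    and finite_radon_finite_measure: "finite_measure M"
    and finite_radon_radon: "radon_measure M"
proof -
  show *: "sets M = sets borel" and "radon_measure M" using assms by (auto simp: finite_radon_def radon_measure_def)
  show **: "space M = UNIV" using sets_eq_imp_space_eq[OF *] by simp
  show "finite_measure M" using assms by (intro finite_measureI) (auto simp: ** finite_radon_def)
qed

lemma finite_radon_emeasure_less_top: "finite_radon M \<Longrightarrow> emeasure M B < top"
  using finite_measure.emeasure_finite[OF finite_radon_finite_measure, of M B] by (simp add: less_top)

lemma radon_compact_approx:
  assumes "radon_measure M" "B \<in> sets borel" "s < emeasure M B"
  obtains K where "compact K" "K \<subseteq> B" "s < emeasure M K"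
proof -
  have "emeasure M B = (SUP K\<in>{K. compact K \<and> K \<subseteq> B}. emeasure M K)"
    using assms by (auto simp: radon_measure_def)
  then show ?thesis using assms(3) that by (auto simp: less_SUP_iff)
qed

lemma finite_radonI:
  fixes M :: "'b::t2_space measure"
  assumes sets: "sets M = sets borel" and fin: "emeasure M UNIV < \<infinity>"
    and reg: "\<And>B s. B \<in> sets borel \<Longrightarrow> s < emeasure M B \<Longrightarrow> \<exists>K. compact K \<and> K \<subseteq> B \<and> s \<le> emeasure M K"
  shows "finite_radon M"
proof -
  have "emeasure M B = (SUP K\<in>{K. compact K \<and> K \<subseteq> B}. emeasure M K)" if B: "B \<in> sets borel" for B
  proof (rule antisym)
    show "emeasure M B \<le> (SUP K\<in>{K. compact K \<and> K \<subseteq> B}. emeasure M K)"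
    proof (rule dense_le)
      fix s assume "s < emeasure M B"
      then obtain K where "compact K" "K \<subseteq> B" "s \<le> emeasure M K" using reg[OF B] by blast
      then show "s \<le> (SUP K\<in>{K. compact K \<and> K \<subseteq> B}. emeasure M K)"
        by (intro SUP_upper2[of K]) auto
    qed
    show "(SUP K\<in>{K. compact K \<and> K \<subseteq> B}. emeasure M K) \<le> emeasure M B"
      by (rule SUP_least) (use B sets in \<open>auto intro!: emeasure_mono\<close>)
  qed
  moreover have "emeasure M K < \<infinity>" for K
    using emeasure_space[of M K] fin sets_eq_imp_space_eq[OF sets] by (auto intro: le_less_trans)
  ultimately show ?thesis using sets fin by (auto simp: finite_radon_def radon_measure_def)
qed

lemma borel_compact_t2 [measurable]: "compact (K :: 'b::t2_space set) \<Longrightarrow> K \<in> sets borel"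
  by (simp add: compact_imp_closed)

text \<open>The sets that can be squeezed between a closed and an open set of almost the same measure form a
\<open>\<sigma>\<close>-algebra; if it contains the open sets, it contains all Borel sets.\<close>

lemma closed_open_sandwich:
  fixes M :: "'b::t2_space measure"
  assumes sets: "sets M = sets borel" and fin: "finite_measure M"
    and op: "\<And>B e. open B \<Longrightarrow> 0 < e \<Longrightarrow> \<exists>F. closed F \<and> F \<subseteq> B \<and> emeasure M (B - F) < ennreal e"
    and B: "B \<in> sets borel" and e: "0 < e"
  shows "\<exists>F U. closed F \<and> open U \<and> F \<subseteq> B \<and> B \<subseteq> U \<and> emeasure M (U - F) < ennreal e"
proof -
  interpret finite_measure M by fact
  have [measurable_cong]: "sets M = sets borel" by fact
  have "B \<in> sigma_sets UNIV {S. open S}" using B by (simp add: borel_def)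
  then have "\<forall>e>0. \<exists>F U. closed F \<and> open U \<and> F \<subseteq> B \<and> B \<subseteq> U \<and> emeasure M (U - F) < ennreal e"
  proof (induction rule: sigma_sets.induct)
    case (Basic a)
    then show ?case using op[of a] by (metis Basic mem_Collect_eq subset_refl)
  next
    case Empty
    show ?case by (auto intro!: exI[of _ "{}"])
  next
    case (Compl a)
    show ?case
    proof (intro allI impI)
      fix e :: real assume "0 < e"
      then obtain F U where "closed F" "open U" "F \<subseteq> a" "a \<subseteq> U" "emeasure M (U - F) < ennreal e"
        using Compl(2) by metis
      moreover have "- F - - U = U - F" by auto
      ultimately show "\<exists>F U. closed F \<and> open U \<and> F \<subseteq> UNIV - a \<and> UNIV - a \<subseteq> U \<and> emeasure M (U - F) < ennreal e"
        by (intro exI[of _ "- U"] exI[of _ "- F"]) auto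
    qed
  next
    case (Union a)
    show ?case
    proof (intro allI impI)
      fix e :: real assume e: "0 < e"
      \<comment> \<open>The errors add up to at most \<open>e / 2\<close>; the slack pays for
        keeping only finitely many of the closed sets, an infinite union of which need not be closed.\<close>
      have "\<exists>F U. closed F \<and> open U \<and> F \<subseteq> a i \<and> a i \<subseteq> U \<and> emeasure M (U - F) < ennreal (e / 2 * (1/2) ^ Suc i)" for i
        using Union(2)[of i] e by simp
      then obtain F U where FU: "\<And>i. closed (F i)" "\<And>i. open (U i)" "\<And>i. F i \<subseteq> a i" "\<And>i. a i \<subseteq> U i"
        "\<And>i. emeasure M (U i - F i) < ennreal (e / 2 * (1/2) ^ Suc i)" by metis
      have [measurable]: "U i \<in> sets M" "F i \<in> sets M" for i using FU sets by auto
      let ?U = "\<Union>i. U i"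
      have lim: "(\<lambda>n. emeasure M (?U - (\<Union>i<n. F i))) \<longlonglongrightarrow> emeasure M (\<Inter>n. ?U - (\<Union>i<n. F i))"
      proof (rule Lim_emeasure_decseq)
        show "decseq (\<lambda>n. ?U - (\<Union>i<n. F i))" unfolding decseq_def by fastforce
      qed auto
      have "emeasure M (\<Inter>n. ?U - (\<Union>i<n. F i)) \<le> emeasure M (\<Union>i. U i - F i)"
        by (rule emeasure_mono) auto
      also have "\<dots> \<le> (\<Sum>i. emeasure M (U i - F i))"
        by (rule emeasure_subadditive_countably) (rule image_subsetI, measurable)
      also have "\<dots> < ennreal e"
      proof -
        let ?b = "\<lambda>i. e / 2 * (1/2) ^ Suc i"
        have s: "?b sums (e / 2)" using sums_mult[OF power_half_series, of "e / 2"] by simp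
        have "(\<Sum>i. emeasure M (U i - F i)) \<le> (\<Sum>i. ennreal (?b i))"
          using FU(5) by (intro suminf_le summableI) (auto intro: less_imp_le)
        also have "\<dots> = ennreal (e / 2)"
        proof (subst suminf_ennreal2)
          show "0 \<le> ?b i" for i using e by simp
          show "summable ?b" by (rule sums_summable[OF s])
          show "ennreal (suminf ?b) = ennreal (e / 2)" by (subst sums_unique[OF s]) (rule refl)
        qed
        also have "\<dots> < ennreal e" using e by (simp add: ennreal_less_iff)
        finally show ?thesis .
      qed
      finally have "eventually (\<lambda>n. emeasure M (?U - (\<Union>i<n. F i)) < ennreal e) sequentially"
        using lim by (simp add: order_tendstoD)
      then obtain n where n: "emeasure M (?U - (\<Union>i<n. F i)) < ennreal e"
        by (auto simp: eventually_sequentially)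
      show "\<exists>F U. closed F \<and> open U \<and> F \<subseteq> \<Union> (range a) \<and> \<Union> (range a) \<subseteq> U \<and> emeasure M (U - F) < ennreal e"
      proof (rule exI[of _ "\<Union>i<n. F i"], rule exI[of _ ?U], intro conjI)
        show "(\<Union>i<n. F i) \<subseteq> \<Union> (range a)" using FU(3) by fast
        show "\<Union> (range a) \<subseteq> ?U" using FU(4) by fast
      qed (use FU n in auto)
    qed
  qed
  then show ?thesis using e by blast
qed

text \<open>Inner regularity need only be checked on open sets: a closed set inside \<open>B\<close> of almost the same
measure becomes compact, at little cost, when it is cut with a compact set that carries almost all
of the measure.\<close>

lemma finite_radonI_open:
  fixes M :: "'b::t2_space measure"
  assumes sets: "sets M = sets borel" and fin: "emeasure M UNIV < \<infinity>"
    and reg: "\<And>B s. open B \<Longrightarrow> s < emeasure M B \<Longrightarrow> \<exists>K. compact K \<and> K \<subseteq> B \<and> s \<le> emeasure M K"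
  shows "finite_radon M"
proof (rule finite_radonI[OF sets fin])
  have sp: "space M = UNIV" using sets_eq_imp_space_eq[OF sets] by simp
  interpret finite_measure M using fin by (intro finite_measureI) (auto simp: sp)
  have [measurable_cong]: "sets M = sets borel" by fact
  have cpt: "\<exists>K. compact K \<and> K \<subseteq> B \<and> emeasure M (B - K) < ennreal e" if "open B" "0 < e" for B e
  proof (cases "emeasure M B = 0")
    case True then show ?thesis using \<open>0 < e\<close> by (intro exI[of _ "{}"]) auto
  next
    case False
    then have "0 < measure M B" by (simp add: emeasure_eq_measure zero_less_measure_iff)
    then have "ennreal (measure M B - e / 2) < emeasure M B"
      using \<open>0 < e\<close> by (simp add: emeasure_eq_measure ennreal_less_iff ennreal_lessI)
    then obtain K where K: "compact K" "K \<subseteq> B" "ennreal (measure M B - e / 2) \<le> emeasure M K"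
      using reg[OF \<open>open B\<close>] by blast
    have "measure M B - e / 2 \<le> measure M K"
      using K(3) measure_nonneg[of M K] by (auto simp: emeasure_eq_measure ennreal_le_iff2)
    moreover have "measure M (B - K) = measure M B - measure M K"
      by (rule finite_measure_Diff) (use K \<open>open B\<close> sets in auto)
    ultimately have "measure M (B - K) < e" using \<open>0 < e\<close> by simp
    then show ?thesis using K \<open>0 < e\<close> by (intro exI[of _ K]) (auto simp: emeasure_eq_measure ennreal_less_iff)
  qed
  fix B :: "'b set" and s assume B: "B \<in> sets borel" "s < emeasure M B"
  then obtain t where t: "s < t" "t < emeasure M B" using dense by blast
  then obtain t' where t': "t = ennreal t'" "0 \<le> t'" by (cases t) auto
  \<comment> \<open>Half of the gap between \<open>t'\<close> and the measure of \<open>B\<close> is spent on the closed set, half on the compact set.\<close>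
  define e where "e = measure M B - t'"
  have e: "0 < e" using t t' by (simp add: e_def emeasure_eq_measure ennreal_less_iff)
  have "\<exists>F U. closed F \<and> open U \<and> F \<subseteq> B \<and> B \<subseteq> U \<and> emeasure M (U - F) < ennreal (e / 2)"
  proof (rule closed_open_sandwich[OF sets])
    show "finite_measure M" by unfold_locales
    show "\<exists>F. closed F \<and> F \<subseteq> B \<and> emeasure M (B - F) < ennreal e" if "open B" "0 < e" for B e
      using cpt[OF that] compact_imp_closed by blast
  qed (use e B in auto)
  then obtain F U where FU: "closed F" "open U" "F \<subseteq> B" "B \<subseteq> U" "emeasure M (U - F) < ennreal (e / 2)" by blast
  obtain K where K: "compact K" "emeasure M (UNIV - K) < ennreal (e / 2)" using cpt[of UNIV "e / 2"] e by auto
  have [measurable]: "F \<in> sets M" "U \<in> sets M" "K \<in> sets M" "B \<in> sets M"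
    using FU K B sets by (auto intro: borel_closed compact_imp_closed)
  have "emeasure M B \<le> emeasure M ((F \<inter> K) \<union> (U - F) \<union> (UNIV - K))"
  proof (rule emeasure_mono)
    show "(F \<inter> K) \<union> (U - F) \<union> (UNIV - K) \<in> sets M" unfolding sp[symmetric] by measurable
  qed (use FU in auto)
  also have "\<dots> \<le> emeasure M (F \<inter> K) + emeasure M (U - F) + emeasure M (UNIV - K)"
    by (rule order_trans[OF emeasure_subadditive add_right_mono[OF emeasure_subadditive]]) measurable
  finally have "measure M B \<le> measure M (F \<inter> K) + measure M (U - F) + measure M (UNIV - K)"
    by (simp add: emeasure_eq_measure flip: ennreal_plus)
  moreover have "measure M (U - F) < e / 2" "measure M (UNIV - K) < e / 2"
    using FU K e by (simp_all add: emeasure_eq_measure ennreal_less_iff)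
  ultimately have "t' \<le> measure M (F \<inter> K)" by (simp add: e_def field_simps)
  then have "s \<le> emeasure M (F \<inter> K)"
    using t t' by (simp add: emeasure_eq_measure) (metis ennreal_leI less_imp_le order_trans)
  then show "\<exists>K. compact K \<and> K \<subseteq> B \<and> s \<le> emeasure M K"
    using FU K by (intro exI[of _ "F \<inter> K"]) (auto intro: closed_Int_compact)
qed

lemma ennreal_less_sum_split:
  fixes t :: "'i \<Rightarrow> ennreal"
  assumes "finite S" "s < (\<Sum>v\<in>S. t v)"
  shows "\<exists>p. (\<forall>v\<in>S. p v < t v \<or> p v = 0) \<and> s < (\<Sum>v\<in>S. p v)"
  using assms
proof (induction S arbitrary: s rule: finite_induct)
  case empty then show ?case by simp
next
  case (insert v S)
  then have "s < t v + (\<Sum>v\<in>S. t v)" by simp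
  then obtain p q where pq: "p < t v \<or> p = 0" "q < (\<Sum>v\<in>S. t v) \<or> q = 0" "s < p + q"
    by (rule ennreal_less_add_split)
  have "\<exists>r. (\<forall>v\<in>S. r v < t v \<or> r v = 0) \<and> q \<le> (\<Sum>v\<in>S. r v)"
    using pq(2)
  proof
    assume "q < (\<Sum>v\<in>S. t v)" then show ?thesis using insert.IH[of q] by (auto intro: less_imp_le)
  qed (auto intro: exI[of _ "\<lambda>_. 0"])
  then obtain r where r: "\<forall>v\<in>S. r v < t v \<or> r v = 0" "q \<le> (\<Sum>v\<in>S. r v)" by blast
  have "(\<Sum>x\<in>S. (r(v := p)) x) = (\<Sum>x\<in>S. r x)" using insert by (intro sum.cong) auto
  then show ?case using insert pq r
    by (intro exI[of _ "r(v := p)"]) (auto intro: less_le_trans add_left_mono)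
qed

text \<open>A Lusin-type approximation from below: a simple function below \<open>h\<close> is supported on finitely many
disjoint level sets; each is replaced by a compact subset and each value is lowered strictly.  The
strict inequality \<open>c v < h x\<close> on a compact set is what the tube lemma can propagate to nearby points.\<close>

lemma nn_integral_compact_approx:
  fixes h :: "'a::t2_space \<Rightarrow> ennreal"
  assumes M: "finite_radon M" and s: "s < (\<integral>\<^sup>+x. h x \<partial>M)"
  obtains S :: "ennreal set" and K c where "finite S" "\<And>v. v \<in> S \<Longrightarrow> compact (K v)"
    "\<And>v x. v \<in> S \<Longrightarrow> x \<in> K v \<Longrightarrow> c v < h x" "disjoint_family_on K S"
    "s < (\<Sum>v\<in>S. c v * emeasure M (K v))"
proof -
  have sp[simp]: "space M = UNIV" by (rule finite_radon_space[OF M])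
  obtain g where g: "simple_function M g" "g \<le> h" "s < integral\<^sup>S M g"
    using s unfolding nn_integral_def by (auto simp: less_SUP_iff)
  let ?R = "range g" and ?B = "\<lambda>v. g -` {v}"
  have fin: "finite ?R" using g(1) by (simp add: simple_function_def)
  have B: "?B v \<in> sets borel" for v
    using simple_functionD(2)[OF g(1), of "{v}"] finite_radon_sets[OF M] by simp
  have "s < (\<Sum>v\<in>?R. v * emeasure M (?B v))" using g(3) by (simp add: simple_integral_def)
  then obtain p where p: "\<forall>v\<in>?R. p v < v * emeasure M (?B v) \<or> p v = 0" "s < (\<Sum>v\<in>?R. p v)"
    using ennreal_less_sum_split[OF fin] by blast
  \<comment> \<open>The other values contribute \<open>p v = 0\<close>.\<close>
  define S where "S = {v \<in> ?R. p v < v * emeasure M (?B v)}"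
  have "\<exists>K c. compact K \<and> K \<subseteq> ?B v \<and> c < v \<and> p v < c * emeasure M K" if "v \<in> S" for v
  proof -
    have "emeasure M (?B v) = (SUP K\<in>{K. compact K \<and> K \<subseteq> ?B v}. emeasure M K)"
      using M B by (auto simp: finite_radon_def radon_measure_def)
    then have "p v < (SUP K\<in>{K. compact K \<and> K \<subseteq> ?B v}. v * emeasure M K)"
      using that by (simp add: S_def SUP_mult_left_ennreal)
    then obtain K where K: "compact K" "K \<subseteq> ?B v" "p v < v * emeasure M K" by (auto simp: less_SUP_iff)
    have "v \<noteq> 0" using K by auto
    have "emeasure M K * (SUP c\<in>{..<v}. c) = (SUP c\<in>{..<v}. emeasure M K * c)"
      by (rule SUP_mult_left_ennreal)
    then have "p v < (SUP c\<in>{..<v}. emeasure M K * c)" using K by (simp add: mult.commute)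
    then obtain c where "c < v" "p v < emeasure M K * c" by (auto simp: less_SUP_iff)
    then show ?thesis using K by (auto simp: mult.commute)
  qed
  then obtain K c where Kc: "\<And>v. v \<in> S \<Longrightarrow> compact (K v)" "\<And>v. v \<in> S \<Longrightarrow> K v \<subseteq> ?B v" "\<And>v. v \<in> S \<Longrightarrow> c v < v"
    "\<And>v. v \<in> S \<Longrightarrow> p v < c v * emeasure M (K v)" by metis
  show ?thesis
  proof (rule that)
    show "finite S" using fin by (simp add: S_def)
    show "compact (K v)" if "v \<in> S" for v using Kc that by blast
    show "c v < h x" if "v \<in> S" "x \<in> K v" for v x
    proof -
      have "g x = v" using Kc(2)[OF that(1)] that(2) by auto
      then show ?thesis using Kc(3)[OF that(1)] g(2) by (auto simp: le_fun_def intro: less_le_trans)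
    qed
    show "disjoint_family_on K S"
      unfolding disjoint_family_on_def
    proof (intro ballI impI)
      fix v w assume vw: "v \<in> S" "w \<in> S" "v \<noteq> w"
      have "K v \<inter> K w \<subseteq> ?B v \<inter> ?B w" using Kc(2)[OF vw(1)] Kc(2)[OF vw(2)] by blast
      also have "\<dots> = {}" using vw(3) by auto
      finally show "K v \<inter> K w = {}" by simp
    qed
    have "s < (\<Sum>v\<in>S. p v)"
      using p by (subst sum.mono_neutral_left[of ?R S]) (use fin in \<open>auto simp: S_def\<close>)
    also have "\<dots> \<le> (\<Sum>v\<in>S. c v * emeasure M (K v))" using Kc(4) by (intro sum_mono) (auto intro: less_imp_le)
    finally show "s < (\<Sum>v\<in>S. c v * emeasure M (K v))" .
  qed
qed

lemma sum_indicator_disjoint_le: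
  fixes c :: "'i \<Rightarrow> ennreal"
  assumes "finite S" "disjoint_family_on K S" "\<And>v. v \<in> S \<Longrightarrow> y \<in> K v \<Longrightarrow> c v \<le> b"
  shows "(\<Sum>v\<in>S. c v * indicator (K v) y) \<le> b"
proof (cases "\<exists>v\<in>S. y \<in> K v")
  case True
  then obtain v where v: "v \<in> S" "y \<in> K v" by blast
  have "(\<Sum>w\<in>S. c w * indicator (K w) y) = (\<Sum>w\<in>{v}. c w * indicator (K w) y)"
    by (rule sum.mono_neutral_right)
       (use v assms in \<open>auto simp: indicator_def disjoint_family_on_def\<close>)
  then show ?thesis using v assms(3) by simp
next
  case False
  then have "(\<Sum>w\<in>S. c w * indicator (K w) y) = 0" by (intro sum.neutral) auto
  then show ?thesis by simp
qed

text \<open>Fatou's lemma is about sequences and gives only sequential lower semicontinuity in \<open>x\<close>.  Instead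
the integral at \<open>x0\<close> is approximated by finitely many compact sets on which \<open>k (x0, y)\<close> exceeds a
constant; by the tube lemma the same bounds hold for all \<open>x\<close> near \<open>x0\<close>.\<close>

lemma lsc_nn_integral:
  fixes k :: "'a::topological_space \<times> 'b::t2_space \<Rightarrow> ennreal"
  assumes k: "lsc k" and N: "finite_radon N"
  shows "lsc (\<lambda>x. \<integral>\<^sup>+y. k (x, y) \<partial>N)"
proof (rule lscI)
  fix s x0 assume "s < (\<integral>\<^sup>+y. k (x0, y) \<partial>N)"
  then obtain S :: "ennreal set" and K c where S: "finite S" "\<And>v. v \<in> S \<Longrightarrow> compact (K v)"
    "\<And>v y. v \<in> S \<Longrightarrow> y \<in> K v \<Longrightarrow> c v < k (x0, y)" "disjoint_family_on K S"
    "s < (\<Sum>v\<in>S. c v * emeasure N (K v))"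
    by (rule nn_integral_compact_approx[OF N]) blast
  have "\<exists>U. x0 \<in> U \<and> open U \<and> U \<times> K v \<subseteq> {z. c v < k z}" if "v \<in> S" for v
    by (rule Elementary_Topology.tube_lemma) (use S that k in \<open>auto simp: lsc_def\<close>)
  then obtain U where U: "\<And>v. v \<in> S \<Longrightarrow> x0 \<in> U v" "\<And>v. v \<in> S \<Longrightarrow> open (U v)"
    "\<And>v. v \<in> S \<Longrightarrow> U v \<times> K v \<subseteq> {z. c v < k z}" by metis
  have "s < (\<integral>\<^sup>+y. k (x, y) \<partial>N)" if x: "x \<in> (\<Inter>v\<in>S. U v)" for x
  proof -
    have "(\<Sum>v\<in>S. c v * emeasure N (K v)) = (\<integral>\<^sup>+y. (\<Sum>v\<in>S. c v * indicator (K v) y) \<partial>N)"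
      using S(2) finite_radon_sets[OF N] by (simp add: nn_integral_sum nn_integral_cmult borel_compact_t2)
    also have "\<dots> \<le> (\<integral>\<^sup>+y. k (x, y) \<partial>N)"
    proof (intro nn_integral_mono sum_indicator_disjoint_le S)
      show "c v \<le> k (x, y)" if "v \<in> S" "y \<in> K v" for v y
        using U(3)[OF that(1)] x that by (auto intro!: less_imp_le)
    qed
    finally show ?thesis using S(5) by simp
  qed
  moreover have "open (\<Inter>v\<in>S. U v)" using S U by (intro open_INT) auto
  ultimately show "\<exists>U. open U \<and> x0 \<in> U \<and> (\<forall>y\<in>U. s < (\<integral>\<^sup>+z. k (y, z) \<partial>N))"
    using U by blast
qed

lemma lsc_indicator: "open B \<Longrightarrow> lsc (indicator B)"
proof (rule lscI)
  fix s x assume "open B" "s < (indicator B x :: ennreal)"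
  then show "\<exists>U. open U \<and> x \<in> U \<and> (\<forall>y\<in>U. s < (indicator B y :: ennreal))"
    by (cases "x \<in> B") (auto intro!: exI[of _ B])
qed

section \<open>The Radon product of finite Radon measures: existence\<close>

lemma borel_measurable_sets_eq:
  "sets N = sets borel \<Longrightarrow> u \<in> borel_measurable borel \<Longrightarrow> u \<in> borel_measurable N"
  using measurable_cong_sets[of N borel borel borel] by simp

text \<open>Averages a family of Borel measures.  With \<open>K x\<close> the copy of \<open>N\<close> on the fibre over \<open>x\<close> this is the
product measure, and over a two-point space it is a linear combination, so one pair of lemmas on
values and integrals serves both.\<close>

definition mixture :: "'i measure \<Rightarrow> ('i \<Rightarrow> 'b::topological_space measure) \<Rightarrow> 'b measure" where
  "mixture M K = measure_of UNIV (sets borel) (\<lambda>B. \<integral>\<^sup>+i. emeasure (K i) B \<partial>M)"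

lemma sets_mixture [simp, measurable_cong]: "sets (mixture M K) = sets borel"
  using sets.sigma_sets_eq[of borel] by (simp add: mixture_def)

lemma space_mixture [simp]: "space (mixture M K) = UNIV"
  by (simp add: mixture_def)

lemma emeasure_mixture:
  assumes sets: "\<And>i. sets (K i) = sets borel"
    and meas: "\<And>B. B \<in> sets borel \<Longrightarrow> (\<lambda>i. emeasure (K i) B) \<in> borel_measurable M"
    and B: "B \<in> sets borel"
  shows "emeasure (mixture M K) B = (\<integral>\<^sup>+i. emeasure (K i) B \<partial>M)"
proof (rule emeasure_measure_of[OF mixture_def])
  show "sets borel \<subseteq> Pow UNIV" by simp
  show "B \<in> sets (mixture M K)" using B by simp
  show "positive (sets (mixture M K)) (\<lambda>B. \<integral>\<^sup>+i. emeasure (K i) B \<partial>M)"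
    by (simp add: positive_def)
  show "countably_additive (sets (mixture M K)) (\<lambda>B. \<integral>\<^sup>+i. emeasure (K i) B \<partial>M)"
    unfolding countably_additive_def
  proof (intro allI impI)
    fix C :: "nat \<Rightarrow> 'b set"
    assume C: "range C \<subseteq> sets (mixture M K)" "disjoint_family C" "\<Union> (range C) \<in> sets (mixture M K)"
    have "(\<Sum>n. \<integral>\<^sup>+i. emeasure (K i) (C n) \<partial>M) = (\<integral>\<^sup>+i. (\<Sum>n. emeasure (K i) (C n)) \<partial>M)"
      by (rule nn_integral_suminf[symmetric]) (use C meas in auto)
    also have "\<dots> = (\<integral>\<^sup>+i. emeasure (K i) (\<Union> (range C)) \<partial>M)"
      by (intro nn_integral_cong suminf_emeasure) (use C sets in auto)
    finally show "(\<Sum>n. \<integral>\<^sup>+i. emeasure (K i) (C n) \<partial>M) = (\<integral>\<^sup>+i. emeasure (K i) (\<Union> (range C)) \<partial>M)" .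
  qed
qed

lemma nn_integral_mixture:
  assumes sets: "\<And>i. sets (K i) = sets borel"
    and meas: "\<And>B. B \<in> sets borel \<Longrightarrow> (\<lambda>i. emeasure (K i) B) \<in> borel_measurable M"
    and u: "u \<in> borel_measurable borel"
  shows "(\<lambda>i. \<integral>\<^sup>+x. u x \<partial>K i) \<in> borel_measurable M \<and>
    (\<integral>\<^sup>+x. u x \<partial>mixture M K) = (\<integral>\<^sup>+i. \<integral>\<^sup>+x. u x \<partial>K i \<partial>M)"
  using u
proof (induction rule: borel_measurable_induct)
  case (cong f g)
  then have "f = g" by (simp add: fun_eq_iff)
  then show ?case using cong by simp
next
  case (set B)
  then show ?case using meas emeasure_mixture[OF sets meas] sets by simp
next
  case (mult u c)
  have *: "(\<integral>\<^sup>+x. c * u x \<partial>N) = c * (\<integral>\<^sup>+x. u x \<partial>N)" if "sets N = sets borel" for N :: "'b measure"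
    by (intro nn_integral_cmult borel_measurable_sets_eq[OF that] mult)
  show ?case using mult(3,4) by (auto simp: * sets nn_integral_cmult)
next
  case (add u v)
  have *: "(\<integral>\<^sup>+x. v x + u x \<partial>N) = (\<integral>\<^sup>+x. v x \<partial>N) + (\<integral>\<^sup>+x. u x \<partial>N)" if "sets N = sets borel" for N :: "'b measure"
    by (intro nn_integral_add borel_measurable_sets_eq[OF that] add)
  show ?case using add by (auto simp: * sets nn_integral_add)
next
  case (seq U)
  have sup: "(SUP f\<in>range U. f x) = (SUP n. U n x)" for x by (simp add: image_image)
  have *: "(\<integral>\<^sup>+x. (SUP f\<in>range U. f x) \<partial>N) = (SUP n. \<integral>\<^sup>+x. U n x \<partial>N)"
    if "sets N = sets borel" for N :: "'b measure"
    unfolding sup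
    by (intro nn_integral_monotone_convergence_SUP borel_measurable_sets_eq[OF that] seq)
  have inc: "incseq (\<lambda>n i. \<integral>\<^sup>+x. U n x \<partial>K i)"
    using seq(3) by (auto simp: incseq_def le_fun_def intro!: nn_integral_mono)
  have "(\<integral>\<^sup>+i. (SUP n. \<integral>\<^sup>+x. U n x \<partial>K i) \<partial>M) = (SUP n. \<integral>\<^sup>+i. \<integral>\<^sup>+x. U n x \<partial>K i \<partial>M)"
    using seq by (intro nn_integral_monotone_convergence_SUP inc) auto
  moreover have "(\<lambda>i. SUP n. \<integral>\<^sup>+x. U n x \<partial>K i) \<in> borel_measurable M"
    using seq by (intro borel_measurable_SUP) auto
  ultimately show ?case using seq by (auto simp: * sets)
qed

definition section_product :: "'a::topological_space measure \<Rightarrow> 'b::topological_space measure \<Rightarrow> ('a \<times> 'b) measure" where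
  "section_product M N = mixture M (\<lambda>x. distr N borel (Pair x))"

lemma Pair_borel [measurable]: "Pair x \<in> borel_measurable (borel :: 'b::topological_space measure)"
  by (intro borel_measurable_continuous_onI continuous_intros)

lemma vimage_Pair_borel:
  fixes B :: "('a::topological_space \<times> 'b::topological_space) set"
  shows "B \<in> sets borel \<Longrightarrow> Pair x -` B \<in> sets borel"
  using measurable_sets[OF Pair_borel, of B x] by simp

lemma emeasure_distr_Pair:
  assumes "finite_radon N" "B \<in> sets borel"
  shows "emeasure (distr N borel (Pair x)) B = emeasure N (Pair x -` B)"
  using assms finite_radon_sets[OF assms(1)] finite_radon_space[OF assms(1)]
  by (subst emeasure_distr) (auto cong: measurable_cong_sets)

lemma lsc_section:
  fixes B :: "('a::topological_space \<times> 'b::t2_space) set"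
  assumes "finite_radon N" "open B"
  shows "lsc (\<lambda>x. emeasure N (Pair x -` B))"
proof -
  have "emeasure N (Pair x -` B) = (\<integral>\<^sup>+y. indicator B (x, y) \<partial>N)" for x
  proof -
    have "(\<integral>\<^sup>+y. indicator B (x, y) \<partial>N) = (\<integral>\<^sup>+y. indicator (Pair x -` B) y \<partial>N)"
      by (simp add: indicator_def vimage_def)
    also have "\<dots> = emeasure N (Pair x -` B)"
      using vimage_Pair_borel[of B x] assms finite_radon_sets[OF assms(1)]
      by (intro nn_integral_indicator) (auto simp: borel_open)
    finally show ?thesis by simp
  qed
  then show ?thesis using lsc_nn_integral[OF lsc_indicator[OF assms(2)] assms(1)] by simp
qed

text \<open>For open sets the section function is lower semicontinuous; the general case follows from Dynkin's
\<open>\<pi>\<close>-\<open>\<lambda>\<close> theorem, the open sets being closed under finite intersections and generating all Borel sets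
of the product, also when these exceed the product \<open>\<sigma>\<close>-algebra.\<close>

lemma section_measurable:
  fixes B :: "('a::topological_space \<times> 'b::t2_space) set"
  assumes N: "finite_radon N" and B: "B \<in> sets borel"
  shows "(\<lambda>x. emeasure N (Pair x -` B)) \<in> borel_measurable borel"
proof -
  interpret N: finite_measure N by (rule finite_radon_finite_measure[OF N])
  note [simp] = finite_radon_sets[OF N] finite_radon_space[OF N]
  have int: "Int_stable {S :: ('a \<times> 'b) set. open S}" by (auto simp: Int_stable_def)
  have sub: "{S :: ('a \<times> 'b) set. open S} \<subseteq> Pow UNIV" by simp
  have gen: "B \<in> sigma_sets UNIV {S. open S}" using B by (simp add: borel_def)
  from int sub gen show ?thesis
  proof (induction rule: sigma_sets_induct_disjoint)
    case (basic A) then show ?case using lsc_borel[OF lsc_section[OF N]] by simp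
  next
    case empty show ?case by simp
  next
    case (compl A)
    have A: "A \<in> sets borel" using compl by (simp add: borel_def)
    have "emeasure N (Pair x -` (UNIV - A)) = emeasure N UNIV - emeasure N (Pair x -` A)" for x
      using emeasure_compl[of "Pair x -` A" N] vimage_Pair_borel[OF A] by (simp add: vimage_Diff)
    then show ?case using compl by simp
  next
    case (union A)
    have A: "A i \<in> sets borel" for i using union(2) by (auto simp: borel_def)
    have "emeasure N (Pair x -` (\<Union>i. A i)) = (\<Sum>i. emeasure N (Pair x -` A i))" for x
    proof -
      have "disjoint_family (\<lambda>i. Pair x -` A i)"
        using union(1) by (auto simp: disjoint_family_on_def)
      moreover have "range (\<lambda>i. Pair x -` A i) \<subseteq> sets N" using vimage_Pair_borel[OF A] by auto
      ultimately show ?thesis by (simp add: suminf_emeasure vimage_UN)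
    qed
    then show ?case using union(3) by simp
  qed
qed

lemma
  fixes M :: "'a::topological_space measure" and N :: "'b::t2_space measure"
  assumes M: "finite_radon M" and N: "finite_radon N"
  shows emeasure_section_product: "B \<in> sets borel \<Longrightarrow> emeasure (section_product M N) B = (\<integral>\<^sup>+x. emeasure N (Pair x -` B) \<partial>M)"
    and nn_integral_section_product: "u \<in> borel_measurable borel \<Longrightarrow>
      (\<integral>\<^sup>+z. u z \<partial>section_product M N) = (\<integral>\<^sup>+x. \<integral>\<^sup>+y. u (x, y) \<partial>N \<partial>M)"
proof -
  have cM: "f \<in> borel_measurable M" if "f \<in> borel_measurable borel" for f :: "'a \<Rightarrow> ennreal"
    by (rule borel_measurable_sets_eq[OF finite_radon_sets[OF M] that])
  have P: "Pair x \<in> N \<rightarrow>\<^sub>M borel" for x :: 'a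
    by (rule borel_measurable_sets_eq[OF finite_radon_sets[OF N] Pair_borel])
  have meas: "(\<lambda>x. emeasure (distr N borel (Pair x)) B) \<in> borel_measurable M"
    if "B \<in> sets borel" for B :: "('a \<times> 'b) set"
    using cM[OF section_measurable[OF N that]] that by (simp add: emeasure_distr_Pair[OF N])
  show "emeasure (section_product M N) B = (\<integral>\<^sup>+x. emeasure N (Pair x -` B) \<partial>M)" if "B \<in> sets borel"
    unfolding section_product_def using that
    by (subst emeasure_mixture[OF _ meas]) (auto simp: emeasure_distr_Pair[OF N])
  assume u: "u \<in> borel_measurable borel"
  then have "(\<integral>\<^sup>+z. u z \<partial>section_product M N) = (\<integral>\<^sup>+x. \<integral>\<^sup>+z. u z \<partial>distr N borel (Pair x) \<partial>M)"
    unfolding section_product_def using nn_integral_mixture[OF _ meas u] by simp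
  also have "\<dots> = (\<integral>\<^sup>+x. \<integral>\<^sup>+y. u (x, y) \<partial>N \<partial>M)"
    by (intro nn_integral_cong nn_integral_distr P) (simp add: u)
  finally show "(\<integral>\<^sup>+z. u z \<partial>section_product M N) = (\<integral>\<^sup>+x. \<integral>\<^sup>+y. u (x, y) \<partial>N \<partial>M)" .
qed

text \<open>A compact Hausdorff space is regular: \<open>x\<close> can be separated from the compact set \<open>K - U\<close>, and removing
a neighbourhood of \<open>K - U\<close> from \<open>K\<close> leaves a compact neighbourhood of \<open>x\<close> relative to \<open>K\<close>.\<close>

lemma compact_shrink:
  fixes x :: "'a::t2_space"
  assumes K: "compact K" and "x \<in> K" "open U" "x \<in> U"
  obtains V C where "open V" "x \<in> V" "compact C" "V \<inter> K \<subseteq> C" "C \<subseteq> U"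
proof -
  have c: "compact (K - U)" using assms by (simp add: compact_diff)
  have t2: "Hausdorff_space (euclidean :: 'a topology)"
    unfolding Hausdorff_space_def disjnt_def using hausdorff by auto
  have "compactin euclidean {x}" "compactin euclidean (K - U)" "disjnt {x} (K - U)"
    using c assms by auto
  then have "\<exists>V W. open V \<and> open W \<and> {x} \<subseteq> V \<and> K - U \<subseteq> W \<and> V \<inter> W = {}"
    by (rule Hausdorff_space_compact_separation[OF t2]) (auto simp: disjnt_def)
  then obtain V W where VW: "open V" "open W" "{x} \<subseteq> V" "K - U \<subseteq> W" "V \<inter> W = {}"
    by blast
  show ?thesis
    by (rule that[of V "K - W"]) (use VW K in \<open>auto simp: compact_diff\<close>)
qed

text \<open>A compact subset of the section over \<open>x\<close> fits into \<open>B\<close> over a whole neighbourhood of \<open>x\<close>; finitely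
many of these neighbourhoods, shrunk to compact sets, cover \<open>K\<close>.  So one compact set \<open>C\<close> serves all
points of \<open>K\<close>.\<close>

lemma section_compact_approx:
  fixes B :: "('a::t2_space \<times> 'b::t2_space) set"
  assumes N: "finite_radon N" and B: "open B" and K: "compact K"
    and lt: "\<And>x. x \<in> K \<Longrightarrow> c < emeasure N (Pair x -` B)"
  obtains C where "compact C" "C \<subseteq> B" "\<And>x. x \<in> K \<Longrightarrow> c \<le> emeasure N (Pair x -` C)"
proof -
  define P where "P x V C L \<longleftrightarrow> open V \<and> x \<in> V \<and> compact C \<and> V \<inter> K \<subseteq> C \<and>
    compact L \<and> C \<times> L \<subseteq> B \<and> c < emeasure N L" for x V C L
  have "\<exists>V C L. P x V C L" if x: "x \<in> K" for x
  proof -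
    obtain L where L: "compact L" "L \<subseteq> Pair x -` B" "c < emeasure N L"
      by (rule radon_compact_approx[OF finite_radon_radon[OF N] vimage_Pair_borel lt[OF x]])
         (use B in \<open>auto simp: borel_open\<close>)
    have "\<exists>U. x \<in> U \<and> open U \<and> U \<times> L \<subseteq> B"
      by (rule Elementary_Topology.tube_lemma) (use L B in auto)
    then obtain U where U: "x \<in> U" "open U" "U \<times> L \<subseteq> B" by blast
    obtain V C where "open V" "x \<in> V" "compact C" "V \<inter> K \<subseteq> C" "C \<subseteq> U"
      by (rule compact_shrink[OF K x U(2,1)]) blast
    then show ?thesis using L U unfolding P_def by (intro exI[of _ V] exI[of _ C] exI[of _ L]) auto
  qed
  then obtain V C L where "\<And>x. x \<in> K \<Longrightarrow> P x (V x) (C x) (L x)" by metis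
  then have VCL: "\<And>x. x \<in> K \<Longrightarrow> open (V x)" "\<And>x. x \<in> K \<Longrightarrow> x \<in> V x" "\<And>x. x \<in> K \<Longrightarrow> compact (C x)"
    "\<And>x. x \<in> K \<Longrightarrow> V x \<inter> K \<subseteq> C x" "\<And>x. x \<in> K \<Longrightarrow> compact (L x)" "\<And>x. x \<in> K \<Longrightarrow> C x \<times> L x \<subseteq> B"
    "\<And>x. x \<in> K \<Longrightarrow> c < emeasure N (L x)" by (simp_all add: P_def)
  obtain F where F: "F \<subseteq> K" "finite F" "K \<subseteq> (\<Union>x\<in>F. V x)"
    by (rule compactE_image[OF K, of K V]) (use VCL in auto)
  show ?thesis
  proof (rule that[of "\<Union>x\<in>F. C x \<times> L x"])
    show cp: "compact (\<Union>x\<in>F. C x \<times> L x)"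
      using F VCL by (intro compact_UN compact_Times) auto
    show "(\<Union>x\<in>F. C x \<times> L x) \<subseteq> B" using F VCL by blast
    fix x assume "x \<in> K"
    then obtain z where z: "z \<in> F" "x \<in> V z" using F by blast
    then have "x \<in> C z" using VCL(4)[of z] F \<open>x \<in> K\<close> by blast
    then have "L z \<subseteq> Pair x -` (\<Union>x\<in>F. C x \<times> L x)" using z by blast
    then have "emeasure N (L z) \<le> emeasure N (Pair x -` (\<Union>x\<in>F. C x \<times> L x))"
      using vimage_Pair_borel[OF borel_compact_t2[OF cp]] finite_radon_sets[OF N]
      by (intro emeasure_mono) auto
    then show "c \<le> emeasure N (Pair x -` (\<Union>x\<in>F. C x \<times> L x))"
      using VCL(7)[of z] F z by (meson less_imp_le order_trans subsetD)
  qed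
qed

text \<open>Only open sets \<open>B\<close> have to be approximated.  The function \<open>x \<mapsto> N (B\<^sub>x)\<close> is bounded below by constants
on disjoint compact sets that almost exhaust its integral, and over each of them \<open>B\<close> contains a
compact set whose sections have at least that measure.\<close>

lemma finite_radon_section_product:
  fixes M :: "'a::t2_space measure" and N :: "'b::t2_space measure"
  assumes M: "finite_radon M" and N: "finite_radon N"
  shows "finite_radon (section_product M N)"
proof (rule finite_radonI_open)
  show sets: "sets (section_product M N) = sets borel" by (simp add: section_product_def)
  have "emeasure (section_product M N) UNIV = emeasure N UNIV * emeasure M UNIV"
    using emeasure_section_product[OF M N, of UNIV] finite_radon_space[OF M] by simp
  then show "emeasure (section_product M N) UNIV < \<infinity>"
    using finite_radon_emeasure_less_top[OF M] finite_radon_emeasure_less_top[OF N] by (simp add: ennreal_mult_less_top)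
  fix B :: "('a \<times> 'b) set" and s assume B: "open B" and s: "s < emeasure (section_product M N) B"
  have "s < (\<integral>\<^sup>+x. emeasure N (Pair x -` B) \<partial>M)"
    using s B by (simp add: emeasure_section_product[OF M N] borel_open)
  then obtain S :: "ennreal set" and K c where S: "finite S" "\<And>v. v \<in> S \<Longrightarrow> compact (K v)"
    "\<And>v x. v \<in> S \<Longrightarrow> x \<in> K v \<Longrightarrow> c v < emeasure N (Pair x -` B)" "disjoint_family_on K S"
    "s < (\<Sum>v\<in>S. c v * emeasure M (K v))"
    by (rule nn_integral_compact_approx[OF M]) blast
  have "\<exists>C. compact C \<and> C \<subseteq> B \<and> (\<forall>x\<in>K v. c v \<le> emeasure N (Pair x -` C))" if "v \<in> S" for v
    by (rule section_compact_approx[OF N B S(2)[OF that], of "c v"]) (use S(3) that in auto)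
  then obtain C where C: "\<And>v. v \<in> S \<Longrightarrow> compact (C v)" "\<And>v. v \<in> S \<Longrightarrow> C v \<subseteq> B"
    "\<And>v x. v \<in> S \<Longrightarrow> x \<in> K v \<Longrightarrow> c v \<le> emeasure N (Pair x -` C v)" by metis
  let ?C = "\<Union>v\<in>S. C v"
  have cp: "compact ?C" using S C by (intro compact_UN) auto
  have "(\<Sum>v\<in>S. c v * emeasure M (K v)) = (\<integral>\<^sup>+x. (\<Sum>v\<in>S. c v * indicator (K v) x) \<partial>M)"
    using S(2) finite_radon_sets[OF M] by (simp add: nn_integral_sum nn_integral_cmult borel_compact_t2)
  also have "\<dots> \<le> (\<integral>\<^sup>+x. emeasure N (Pair x -` ?C) \<partial>M)"
  proof (intro nn_integral_mono sum_indicator_disjoint_le S)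
    fix x v assume v: "v \<in> S" "x \<in> K v"
    have "emeasure N (Pair x -` C v) \<le> emeasure N (Pair x -` ?C)"
      using vimage_Pair_borel[OF borel_compact_t2[OF cp]] finite_radon_sets[OF N] v
      by (intro emeasure_mono) auto
    then show "c v \<le> emeasure N (Pair x -` ?C)" using C(3)[OF v] by simp
  qed
  also have "\<dots> = emeasure (section_product M N) ?C"
    using borel_compact_t2[OF cp] by (simp add: emeasure_section_product[OF M N])
  finally show "\<exists>K. compact K \<and> K \<subseteq> B \<and> s \<le> emeasure (section_product M N) K"
    using S(5) cp C(2) by (intro exI[of _ ?C]) auto
qed

lemma emeasure_section_product_Times:
  fixes M :: "'a::t2_space measure" and N :: "'b::t2_space measure"
  assumes M: "finite_radon M" and N: "finite_radon N" and "compact K" "compact L"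
  shows "emeasure (section_product M N) (K \<times> L) = emeasure M K * emeasure N L"
proof -
  have "emeasure (section_product M N) (K \<times> L) = (\<integral>\<^sup>+x. emeasure N (Pair x -` (K \<times> L)) \<partial>M)"
    using compact_Times[OF assms(3,4)] by (intro emeasure_section_product[OF M N] borel_compact_t2)
  also have "\<dots> = (\<integral>\<^sup>+x. emeasure N L * indicator K x \<partial>M)"
    by (intro nn_integral_cong) (auto simp: indicator_def)
  also have "\<dots> = emeasure N L * emeasure M K"
    using finite_radon_sets[OF M] assms by (intro nn_integral_cmult_indicator) (auto simp: borel_compact_t2)
  finally show ?thesis by (simp add: mult.commute)
qed

section \<open>The Radon product: uniqueness, and the order of integration\<close>

definition rectangles :: "('a set \<times> 'b set) list \<Rightarrow> ('a \<times> 'b) set" where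
  "rectangles ps = (\<Union>(K, L)\<in>set ps. K \<times> L)"

lemma compact_rectangles:
  "(\<And>K L. (K, L) \<in> set ps \<Longrightarrow> compact K \<and> compact L) \<Longrightarrow> compact (rectangles ps)"
  unfolding rectangles_def by (intro compact_UN) (auto intro!: compact_Times)

text \<open>Inclusion-exclusion: the intersection of a rectangle with a finite union of rectangles is a union of
fewer rectangles than the whole, so induction on the number of rectangles applies.\<close>

lemma emeasure_rectangles_eq:
  fixes R1 R2 :: "('a::t2_space \<times> 'b::t2_space) measure"
  assumes R: "finite_radon R1" "finite_radon R2"
    and eq: "\<And>K L. compact K \<Longrightarrow> compact L \<Longrightarrow> emeasure R1 (K \<times> L) = emeasure R2 (K \<times> L)"
    and ps: "\<And>K L. (K, L) \<in> set ps \<Longrightarrow> compact K \<and> compact L"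
  shows "emeasure R1 (rectangles ps) = emeasure R2 (rectangles ps)"
  using ps
proof (induction "length ps" arbitrary: ps)
  case 0 then show ?case by (simp add: rectangles_def)
next
  case (Suc n)
  then obtain K L qs where ps: "ps = (K, L) # qs" "length qs = n" by (cases ps) auto
  have KL: "compact K" "compact L" using Suc.prems ps by auto
  \<comment> \<open>The rectangles that make up the intersection of the first rectangle with the union of the others.\<close>
  define rs where "rs = map (\<lambda>(K', L'). (K \<inter> K', L \<inter> L')) qs"
  have qs: "\<And>K L. (K, L) \<in> set qs \<Longrightarrow> compact K \<and> compact L" using Suc.prems ps by auto
  have rs: "\<And>K L. (K, L) \<in> set rs \<Longrightarrow> compact K \<and> compact L"
    using qs KL by (auto simp: rs_def intro!: compact_Int)
  have un: "rectangles ps = (K \<times> L) \<union> rectangles qs" by (auto simp: rectangles_def ps)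
  have int: "(K \<times> L) \<inter> rectangles qs = rectangles rs" by (auto simp: rectangles_def rs_def)
  have "emeasure R (rectangles ps) + emeasure R (rectangles rs) = emeasure R (K \<times> L) + emeasure R (rectangles qs)"
    if "finite_radon R" for R
    unfolding un int[symmetric]
    by (rule emeasure_Un_Int[symmetric])
       (use finite_radon_sets[OF that] compact_rectangles[OF qs] compact_Times[OF KL] in \<open>auto intro: borel_compact_t2\<close>)
  then have "emeasure R1 (rectangles ps) + emeasure R1 (rectangles rs) = emeasure R2 (rectangles ps) + emeasure R2 (rectangles rs)"
    using R eq[OF KL] Suc.hyps(1)[OF ps(2)[symmetric] qs] by simp
  moreover have "n = length rs" using ps by (simp add: rs_def)
  then have "emeasure R1 (rectangles rs) = emeasure R2 (rectangles rs)"
    by (rule Suc.hyps(1)[OF _ rs])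
  ultimately show ?case
    using finite_radon_emeasure_less_top[OF R(2), of "rectangles rs"] by auto
qed

text \<open>Every point of \<open>C\<close> has an open rectangle around it inside \<open>B\<close>.  Shrinking its sides within the
compact projections of \<open>C\<close> makes them compact, and finitely many of the results cover \<open>C\<close>.\<close>

lemma compact_open_rectangles:
  fixes C :: "('a::t2_space \<times> 'b::t2_space) set"
  assumes C: "compact C" "C \<subseteq> B" and B: "open B"
  obtains ps where "\<And>K L. (K, L) \<in> set ps \<Longrightarrow> compact K \<and> compact L" "C \<subseteq> rectangles ps" "rectangles ps \<subseteq> B"
proof -
  have cf: "compact (fst ` C)" "compact (snd ` C)"
    using C by (auto intro!: compact_continuous_image continuous_intros)
  define P where "P z V K L \<longleftrightarrow> open V \<and> z \<in> V \<and> compact K \<and> compact L \<and> V \<inter> C \<subseteq> K \<times> L \<and> K \<times> L \<subseteq> B"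
    for z V K L
  have "\<exists>V K L. P z V K L" if z: "z \<in> C" for z
  proof -
    obtain U1 U2 where U: "open U1" "open U2" "z \<in> U1 \<times> U2" "U1 \<times> U2 \<subseteq> B"
      using open_prod_elim[OF B, of z] z C by blast
    have z': "fst z \<in> fst ` C" "fst z \<in> U1" "snd z \<in> snd ` C" "snd z \<in> U2" using z U by auto
    obtain V1 K where V1: "open V1" "fst z \<in> V1" "compact K" "V1 \<inter> fst ` C \<subseteq> K" "K \<subseteq> U1"
      by (rule compact_shrink[OF cf(1) z'(1) U(1) z'(2)]) blast
    obtain V2 L where V2: "open V2" "snd z \<in> V2" "compact L" "V2 \<inter> snd ` C \<subseteq> L" "L \<subseteq> U2"
      by (rule compact_shrink[OF cf(2) z'(3) U(2) z'(4)]) blast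
    have "(V1 \<times> V2) \<inter> C \<subseteq> K \<times> L"
    proof
      fix w assume w: "w \<in> (V1 \<times> V2) \<inter> C"
      then have "fst w \<in> V1 \<inter> fst ` C" "snd w \<in> V2 \<inter> snd ` C" by auto
      then show "w \<in> K \<times> L" using V1(4) V2(4) by (auto simp: mem_Times_iff)
    qed
    moreover have "K \<times> L \<subseteq> B" using U(4) V1(5) V2(5) by blast
    ultimately have "P z (V1 \<times> V2) K L"
      unfolding P_def using V1 V2 by (auto simp: mem_Times_iff open_Times)
    then show ?thesis by blast
  qed
  then obtain V K L where "\<And>z. z \<in> C \<Longrightarrow> P z (V z) (K z) (L z)" by metis
  then have VKL: "\<And>z. z \<in> C \<Longrightarrow> open (V z)" "\<And>z. z \<in> C \<Longrightarrow> z \<in> V z" "\<And>z. z \<in> C \<Longrightarrow> compact (K z) \<and> compact (L z)"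
    "\<And>z. z \<in> C \<Longrightarrow> V z \<inter> C \<subseteq> K z \<times> L z" "\<And>z. z \<in> C \<Longrightarrow> K z \<times> L z \<subseteq> B"
    by (simp_all add: P_def)
  obtain F where F: "F \<subseteq> C" "finite F" "C \<subseteq> (\<Union>z\<in>F. V z)"
    by (rule compactE_image[OF C(1), of C V]) (use VKL in auto)
  obtain zs where zs: "set zs = F" using finite_list[OF F(2)] by blast
  show ?thesis
  proof (rule that[of "map (\<lambda>z. (K z, L z)) zs"])
    show "compact K' \<and> compact L'" if "(K', L') \<in> set (map (\<lambda>z. (K z, L z)) zs)" for K' L'
      using that F zs VKL(3) by auto
    show "C \<subseteq> rectangles (map (\<lambda>z. (K z, L z)) zs)"
    proof
      fix w assume w: "w \<in> C"
      then obtain z where z: "z \<in> F" "w \<in> V z" using F by blast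
      then have "w \<in> K z \<times> L z" using VKL(4)[of z] F w by blast
      then show "w \<in> rectangles (map (\<lambda>z. (K z, L z)) zs)" using z zs by (auto simp: rectangles_def)
    qed
    show "rectangles (map (\<lambda>z. (K z, L z)) zs) \<subseteq> B"
      using VKL(5) F zs by (fastforce simp: rectangles_def)
  qed
qed

text \<open>Between a compact set and an open set that contains it there is a finite union of compact rectangles.
Hence the values on compact rectangles determine those on open sets, and these determine the
measure.\<close>

lemma finite_radon_eqI:
  fixes R1 R2 :: "('a::t2_space \<times> 'b::t2_space) measure"
  assumes R: "finite_radon R1" "finite_radon R2"
    and eq: "\<And>K L. compact K \<Longrightarrow> compact L \<Longrightarrow> emeasure R1 (K \<times> L) = emeasure R2 (K \<times> L)"
  shows "R1 = R2"
proof -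
  have le: "emeasure R B \<le> emeasure R' B" if R: "finite_radon R" "finite_radon R'" and B: "open B"
    and eq: "\<And>K L. compact K \<Longrightarrow> compact L \<Longrightarrow> emeasure R (K \<times> L) = emeasure R' (K \<times> L)"
    for R R' :: "('a \<times> 'b) measure" and B
  proof (rule dense_le)
    fix s assume "s < emeasure R B"
    then obtain C where C: "compact C" "C \<subseteq> B" "s < emeasure R C"
      by (rule radon_compact_approx[OF finite_radon_radon[OF R(1)], rotated]) (use B in auto)
    obtain ps where ps: "\<And>K L. (K, L) \<in> set ps \<Longrightarrow> compact K \<and> compact L" "C \<subseteq> rectangles ps" "rectangles ps \<subseteq> B"
      by (rule compact_open_rectangles[OF C(1,2) B]) blast
    have "emeasure R C \<le> emeasure R (rectangles ps)"
      using finite_radon_sets[OF R(1)] borel_compact_t2[OF compact_rectangles[OF ps(1)]] ps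
      by (intro emeasure_mono) auto
    also have "\<dots> = emeasure R' (rectangles ps)" by (rule emeasure_rectangles_eq[OF R eq ps(1)])
    also have "\<dots> \<le> emeasure R' B"
      using finite_radon_sets[OF R(2)] B ps by (intro emeasure_mono) auto
    finally show "s \<le> emeasure R' B" using C by simp
  qed
  show ?thesis
  proof (rule measure_eqI_generator_eq[of "{S. open S}" UNIV R1 R2 "\<lambda>_. UNIV"])
    show "emeasure R1 B = emeasure R2 B" if "B \<in> {S. open S}" for B
      using le[of R1 R2 B] le[of R2 R1 B] R eq that by (intro antisym) auto
    show "sets R1 = sigma_sets UNIV {S. open S}" "sets R2 = sigma_sets UNIV {S. open S}"
      using finite_radon_sets[OF R(1)] finite_radon_sets[OF R(2)] by (simp_all add: borel_def)
    show "emeasure R1 UNIV \<noteq> \<infinity>" for i :: nat using R by (auto simp: finite_radon_def)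
  qed (auto simp: Int_stable_def)
qed

text \<open>A competing Radon measure with the same values on compact rectangles is itself finite, because every
compact set lies in the product of its projections.\<close>

lemma radon_prod_eq_section_product:
  fixes M :: "'a::t2_space measure" and N :: "'b::t2_space measure"
  assumes M: "finite_radon M" and N: "finite_radon N"
  shows "radon_prod M N = section_product M N"
  unfolding radon_prod_def
proof (rule the_equality, intro conjI allI impI)
  show "radon_measure (section_product M N)" by (rule finite_radon_radon[OF finite_radon_section_product[OF M N]])
  show "emeasure (section_product M N) (K \<times> L) = emeasure M K * emeasure N L" if "compact K" "compact L" for K L
    by (rule emeasure_section_product_Times[OF M N that])
  fix R :: "('a \<times> 'b) measure"
  assume R: "radon_measure R \<and> (\<forall>K L. compact K \<longrightarrow> compact L \<longrightarrow> emeasure R (K \<times> L) = emeasure M K * emeasure N L)"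
  have "emeasure R UNIV \<le> emeasure M UNIV * emeasure N UNIV"
  proof (rule dense_le)
    fix s assume "s < emeasure R UNIV"
    then obtain C where C: "compact C" "s < emeasure R C"
      using radon_compact_approx[of R UNIV s] R by auto
    have cf: "compact (fst ` C)" "compact (snd ` C)"
      using C by (auto intro!: compact_continuous_image continuous_intros)
    have "C \<subseteq> fst ` C \<times> snd ` C" by (auto simp: image_iff) force+
    moreover have "sets R = sets borel" using R by (simp add: radon_measure_def)
    ultimately have "emeasure R C \<le> emeasure R (fst ` C \<times> snd ` C)"
      using borel_compact_t2[OF compact_Times[OF cf]] by (intro emeasure_mono) auto
    also have "\<dots> = emeasure M (fst ` C) * emeasure N (snd ` C)" using R cf by blast
    also have "\<dots> \<le> emeasure M UNIV * emeasure N UNIV"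
      using emeasure_space[of M] emeasure_space[of N] finite_radon_space[OF M] finite_radon_space[OF N]
      by (intro mult_mono) auto
    finally show "s \<le> emeasure M UNIV * emeasure N UNIV" using C by simp
  qed
  then have "finite_radon R"
    using R finite_radon_emeasure_less_top[OF M] finite_radon_emeasure_less_top[OF N]
    by (auto simp: finite_radon_def ennreal_mult_less_top intro: le_less_trans)
  then show "R = section_product M N"
    using R emeasure_section_product_Times[OF M N] by (intro finite_radon_eqI finite_radon_section_product M N) auto
qed

lemma section_product_swap:
  fixes M :: "'a::t2_space measure" and N :: "'b::t2_space measure"
  assumes M: "finite_radon M" and N: "finite_radon N"
  shows "section_product M N = distr (section_product N M) borel prod.swap"
proof (rule finite_radon_eqI)
  note fin = finite_radon_section_product[OF N M]
  have sw: "prod.swap \<in> borel_measurable (borel :: ('b \<times> 'a) measure)"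
    unfolding prod.swap_def by (intro borel_measurable_continuous_onI continuous_intros)
  have swm: "prod.swap \<in> measurable (section_product N M) borel"
    by (rule borel_measurable_sets_eq[OF finite_radon_sets[OF fin] sw])
  have swc: "compact (prod.swap ` C)" if "compact C" for C :: "('c::t2_space \<times> 'd::t2_space) set"
    unfolding prod.swap_def by (intro compact_continuous_image that continuous_intros)
  have em: "emeasure (distr (section_product N M) borel prod.swap) B = emeasure (section_product N M) (prod.swap -` B)"
    if "B \<in> sets borel" for B
    using emeasure_distr[OF swm that] finite_radon_space[OF fin] by simp
  show "finite_radon (section_product M N)" by (rule finite_radon_section_product[OF M N])
  show "finite_radon (distr (section_product N M) borel prod.swap)"
  proof (rule finite_radonI)
    show "emeasure (distr (section_product N M) borel prod.swap) UNIV < \<infinity>"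
      using em[of UNIV] finite_radon_emeasure_less_top[OF fin] by simp
    fix B :: "('a \<times> 'b) set" and s
    assume B: "B \<in> sets borel" and s: "s < emeasure (distr (section_product N M) borel prod.swap) B"
    have "prod.swap -` B \<in> sets borel" using measurable_sets[OF sw B] by simp
    moreover have "s < emeasure (section_product N M) (prod.swap -` B)" using s em[OF B] by simp
    ultimately obtain C where C: "compact C" "C \<subseteq> prod.swap -` B" "s < emeasure (section_product N M) C"
      by (rule radon_compact_approx[OF finite_radon_radon[OF fin]])
    have "prod.swap -` (prod.swap ` C) = C" by (auto simp: image_iff)
    then have "emeasure (distr (section_product N M) borel prod.swap) (prod.swap ` C) = emeasure (section_product N M) C"
      using em[OF borel_compact_t2[OF swc[OF C(1)]]] by simp
    then show "\<exists>K. compact K \<and> K \<subseteq> B \<and> s \<le> emeasure (distr (section_product N M) borel prod.swap) K"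
      using C swc[OF C(1)] by (intro exI[of _ "prod.swap ` C"]) auto
  qed simp
  fix K :: "'a set" and L :: "'b set" assume KL: "compact K" "compact L"
  have "prod.swap -` (K \<times> L) = L \<times> K" by auto
  then show "emeasure (section_product M N) (K \<times> L) = emeasure (distr (section_product N M) borel prod.swap) (K \<times> L)"
    using em[OF borel_compact_t2[OF compact_Times[OF KL]]] emeasure_section_product_Times[OF M N KL]
      emeasure_section_product_Times[OF N M KL(2,1)] by (simp add: mult.commute)
qed

text \<open>Both orders of integration compute the integral against a finite Radon measure with the same values
on compact rectangles, and there is only one such measure.\<close>

lemma nn_integral_section_product_swap:
  fixes M :: "'a::t2_space measure" and N :: "'b::t2_space measure"
  assumes M: "finite_radon M" and N: "finite_radon N" and u: "u \<in> borel_measurable borel"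
  shows "(\<integral>\<^sup>+x. \<integral>\<^sup>+y. u (x, y) \<partial>N \<partial>M) = (\<integral>\<^sup>+y. \<integral>\<^sup>+x. u (x, y) \<partial>M \<partial>N)"
proof -
  note fin = finite_radon_section_product[OF N M]
  have sw: "prod.swap \<in> borel_measurable (borel :: ('b \<times> 'a) measure)"
    unfolding prod.swap_def by (intro borel_measurable_continuous_onI continuous_intros)
  have "(\<integral>\<^sup>+x. \<integral>\<^sup>+y. u (x, y) \<partial>N \<partial>M) = (\<integral>\<^sup>+z. u z \<partial>section_product M N)"
    by (rule nn_integral_section_product[OF M N u, symmetric])
  also have "\<dots> = (\<integral>\<^sup>+z. u (prod.swap z) \<partial>section_product N M)"
    unfolding section_product_swap[OF M N]
    by (rule nn_integral_distr[OF borel_measurable_sets_eq[OF finite_radon_sets[OF fin] sw]]) (simp add: u)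
  also have "\<dots> = (\<integral>\<^sup>+y. \<integral>\<^sup>+x. u (x, y) \<partial>M \<partial>N)"
    using nn_integral_section_product[OF N M measurable_compose[OF sw u]] by simp
  finally show ?thesis .
qed

definition lincomb :: "real \<Rightarrow> 'b::topological_space measure \<Rightarrow> real \<Rightarrow> 'b measure \<Rightarrow> 'b measure" where
  "lincomb a M b N = mixture (point_measure UNIV (\<lambda>t. ennreal (if t then a else b))) (\<lambda>t. if t then M else N)"

lemma sets_lincomb [simp]: "sets (lincomb a M b N) = sets borel"
  by (simp add: lincomb_def)

lemma
  assumes M: "sets M = sets borel" and N: "sets N = sets borel"
  shows emeasure_lincomb: "B \<in> sets borel \<Longrightarrow>
      emeasure (lincomb a M b N) B = ennreal a * emeasure M B + ennreal b * emeasure N B"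
    and nn_integral_lincomb: "u \<in> borel_measurable borel \<Longrightarrow>
      (\<integral>\<^sup>+x. u x \<partial>lincomb a M b N) = ennreal a * (\<integral>\<^sup>+x. u x \<partial>M) + ennreal b * (\<integral>\<^sup>+x. u x \<partial>N)"
proof -
  have I: "(\<integral>\<^sup>+t. f t \<partial>point_measure UNIV (\<lambda>t. ennreal (if t then a else b))) = ennreal a * f True + ennreal b * f False"
    for f by (subst nn_integral_point_measure_finite) (auto simp: UNIV_bool mult.commute add.commute)
  show "emeasure (lincomb a M b N) B = ennreal a * emeasure M B + ennreal b * emeasure N B"
    if "B \<in> sets borel"
    unfolding lincomb_def by (subst emeasure_mixture) (use that M N in \<open>auto simp: I measurable_point_measure_eq1\<close>)
  show "(\<integral>\<^sup>+x. u x \<partial>lincomb a M b N) = ennreal a * (\<integral>\<^sup>+x. u x \<partial>M) + ennreal b * (\<integral>\<^sup>+x. u x \<partial>N)"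
    if "u \<in> borel_measurable borel"
    unfolding lincomb_def
    by (subst nn_integral_mixture[THEN conjunct2]) (use that M N in \<open>auto simp: I measurable_point_measure_eq1\<close>)
qed

lemma finite_radon_lincomb:
  fixes M N :: "'b::t2_space measure"
  assumes M: "finite_radon M" and N: "finite_radon N"
  shows "finite_radon (lincomb a M b N)"
proof (rule finite_radonI)
  note em = emeasure_lincomb[OF finite_radon_sets[OF M] finite_radon_sets[OF N]]
  show "emeasure (lincomb a M b N) UNIV < \<infinity>"
    using finite_radon_emeasure_less_top[OF M] finite_radon_emeasure_less_top[OF N]
    by (simp add: em ennreal_mult_less_top)
  have ap: "\<exists>K. compact K \<and> K \<subseteq> B \<and> p \<le> ennreal c * emeasure L K"
    if L: "finite_radon L" and B: "B \<in> sets borel" and p: "p < ennreal c * emeasure L B \<or> p = 0"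
    for L :: "'b measure" and B p c
    using p
  proof
    assume "p < ennreal c * emeasure L B"
    moreover have "emeasure L B = (SUP K\<in>{K. compact K \<and> K \<subseteq> B}. emeasure L K)"
      using L B by (auto simp: finite_radon_def radon_measure_def)
    ultimately have "p < (SUP K\<in>{K. compact K \<and> K \<subseteq> B}. ennreal c * emeasure L K)"
      by (simp add: SUP_mult_left_ennreal)
    then show ?thesis by (auto simp: less_SUP_iff intro: less_imp_le)
  qed (auto intro!: exI[of _ "{}"])
  fix B :: "'b set" and s assume B: "B \<in> sets borel" and "s < emeasure (lincomb a M b N) B"
  then have "s < ennreal a * emeasure M B + ennreal b * emeasure N B" by (simp add: em)
  then obtain p q where pq: "p < ennreal a * emeasure M B \<or> p = 0" "q < ennreal b * emeasure N B \<or> q = 0" "s < p + q"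
    by (rule ennreal_less_add_split)
  obtain K L where K: "compact K" "K \<subseteq> B" "p \<le> ennreal a * emeasure M K"
    and L: "compact L" "L \<subseteq> B" "q \<le> ennreal b * emeasure N L"
    using ap[OF M B pq(1)] ap[OF N B pq(2)] by blast
  have KL: "K \<union> L \<in> sets borel" "K \<in> sets borel" "L \<in> sets borel" using K L by (auto intro!: borel_compact_t2)
  have "s \<le> ennreal a * emeasure M K + ennreal b * emeasure N L"
    using pq(3) add_mono[OF K(3) L(3)] by simp
  also have "\<dots> \<le> ennreal a * emeasure M (K \<union> L) + ennreal b * emeasure N (K \<union> L)"
    using KL finite_radon_sets[OF M] finite_radon_sets[OF N]
    by (intro add_mono mult_left_mono emeasure_mono) auto
  also have "\<dots> = emeasure (lincomb a M b N) (K \<union> L)" using KL by (simp add: em)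
  finally show "\<exists>K. compact K \<and> K \<subseteq> B \<and> s \<le> emeasure (lincomb a M b N) K"
    using K L by (intro exI[of _ "K \<union> L"]) auto
qed simp

lemma finite_radon_restrict:
  fixes M :: "'b::t2_space measure"
  assumes M: "finite_radon M" and D: "compact D"
  shows "finite_radon (density M (indicator D))"
proof (rule finite_radonI)
  have D': "D \<in> sets M" using D finite_radon_sets[OF M] by (simp add: borel_compact_t2)
  show "sets (density M (indicator D)) = sets borel" using finite_radon_sets[OF M] by simp
  have em: "emeasure (density M (indicator D)) B = emeasure M (D \<inter> B)" if "B \<in> sets borel" for B
    using that D' finite_radon_sets[OF M] by (intro emeasure_restricted) auto
  show "emeasure (density M (indicator D)) UNIV < \<infinity>"
    using em[of UNIV] finite_radon_emeasure_less_top[OF M] by simp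
  fix B :: "'b set" and s assume B: "B \<in> sets borel" and s: "s < emeasure (density M (indicator D)) B"
  then have "s < emeasure M (D \<inter> B)" "D \<inter> B \<in> sets borel" using D by (auto simp: em borel_compact_t2)
  then obtain K where K: "compact K" "K \<subseteq> D \<inter> B" "s < emeasure M K"
    by (metis radon_compact_approx[OF finite_radon_radon[OF M]])
  moreover have "D \<inter> K = K" using K by auto
  ultimately show "\<exists>K. compact K \<and> K \<subseteq> B \<and> s \<le> emeasure (density M (indicator D)) K"
    by (intro exI[of _ K]) (auto simp: em borel_compact_t2)
qed

lemma closed_msupport: "closed (msupport M)"
proof -
  have "- msupport M = \<Union> {U. open U \<and> emeasure M U = 0}"
    by (auto simp: msupport_def zero_less_iff_neq_zero)
  then have "open (- msupport M)" by auto
  then show ?thesis by (simp add: closed_def)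
qed

text \<open>The complement of the support is a union of possibly uncountably many open null sets.  A compact
subset of it is covered by finitely many of them, and compact subsets determine the measure.\<close>

lemma emeasure_compl_msupport:
  fixes M :: "'b::t2_space measure"
  assumes M: "radon_measure M"
  shows "emeasure M (- msupport M) = 0"
proof (rule ccontr)
  assume "emeasure M (- msupport M) \<noteq> 0"
  then have "0 < emeasure M (- msupport M)" by (simp add: zero_less_iff_neq_zero)
  moreover have "- msupport M \<in> sets borel" using closed_msupport[of M] by auto
  ultimately obtain K where K: "compact K" "K \<subseteq> - msupport M" "0 < emeasure M K"
    by (metis radon_compact_approx[OF M])
  have "\<exists>U. open U \<and> x \<in> U \<and> emeasure M U = 0" if "x \<in> K" for x
    using K(2) that by (auto simp: msupport_def zero_less_iff_neq_zero)
  then obtain U where U: "\<And>x. x \<in> K \<Longrightarrow> open (U x)" "\<And>x. x \<in> K \<Longrightarrow> x \<in> U x" "\<And>x. x \<in> K \<Longrightarrow> emeasure M (U x) = 0"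
    by metis
  obtain F where F: "F \<subseteq> K" "finite F" "K \<subseteq> (\<Union>x\<in>F. U x)"
    by (rule compactE_image[OF K(1), of K U]) (use U in auto)
  have [simp]: "sets M = sets borel" using M by (simp add: radon_measure_def)
  have "emeasure M K \<le> emeasure M (\<Union>x\<in>F. U x)"
    using F U by (intro emeasure_mono) (auto intro!: borel_open)
  also have "\<dots> \<le> (\<Sum>x\<in>F. emeasure M (U x))"
    using F U by (intro emeasure_subadditive_finite) auto
  also have "\<dots> = 0" using F U by (intro sum.neutral) auto
  finally show False using K by simp
qed

lemma msupport_subset_iff:
  fixes M :: "'b::t2_space measure"
  assumes M: "radon_measure M" and A: "closed A"
  shows "msupport M \<subseteq> A \<longleftrightarrow> emeasure M (- A) = 0"
proof
  have s: "sets M = sets borel" using M by (simp add: radon_measure_def)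
  show "emeasure M (- A) = 0" if "msupport M \<subseteq> A"
  proof -
    have "emeasure M (- A) \<le> emeasure M (- msupport M)"
      using that closed_msupport[of M] s by (intro emeasure_mono) auto
    then show ?thesis using emeasure_compl_msupport[OF M] by simp
  qed
  show "msupport M \<subseteq> A" if "emeasure M (- A) = 0"
    using that A by (auto simp: msupport_def open_Compl dest!: spec[of _ "- A"])
qed

section \<open>Kernels bounded below and their energies\<close>

text \<open>A lower semicontinuous function on a compact space that avoids \<open>-\<infinity>\<close> is bounded below, so the
two cases in the definition of \<open>Phi\<close> are both covered by a nonnegative function minus a real
constant.\<close>

lemma Phi_shift:
  fixes \<psi> :: "'b::topological_space \<Rightarrow> ereal"
  assumes "\<psi> \<in> Phi"
  obtains c :: real and u where "0 \<le> c" "lsc u" "\<And>x. \<psi> x = enn2ereal (u x) - ereal c"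
proof -
  have lsc: "open {x. r < \<psi> x}" for r using assms by (auto simp: Phi_def lower_semicontinuous_def)
  have ninf: "-\<infinity> < \<psi> x" for x using assms by (auto simp: Phi_def)
  have "\<exists>c\<ge>0. \<forall>x. - ereal c \<le> \<psi> x"
  proof (cases "compact (UNIV :: 'b set)")
    case False
    then show ?thesis using assms by (intro exI[of _ 0]) (auto simp: Phi_def zero_ereal_def)
  next
    case True
    have "\<exists>n::nat. x \<in> {x. - ereal (real n) < \<psi> x}" for x
    proof -
      obtain n :: nat where "- \<psi> x < ereal (real n)"
        using ninf[of x] reals_Archimedean2[of "real_of_ereal (- \<psi> x)"] by (cases "\<psi> x") auto
      then have "- ereal (real n) < \<psi> x" by (cases "\<psi> x") auto
      then show ?thesis by blast
    qed
    then have cover: "UNIV \<subseteq> (\<Union>n::nat\<in>UNIV. {x. - ereal (real n) < \<psi> x})" by blast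
    have op: "open {x. - ereal (real n) < \<psi> x}" if "n \<in> UNIV" for n :: nat by (rule lsc)
    obtain F where F: "F \<subseteq> UNIV" "finite (F :: nat set)" "UNIV \<subseteq> (\<Union>n\<in>F. {x. - ereal (real n) < \<psi> x})"
      by (rule compactE_image[OF True op cover])
    have "- ereal (real (Max F)) \<le> \<psi> x" for x
    proof -
      obtain n where n: "n \<in> F" "- ereal (real n) < \<psi> x" using F(3) by blast
      have "n \<le> Max F" using F(2) n(1) by simp
      then have "- ereal (real (Max F)) \<le> - ereal (real n)" by simp
      then show ?thesis using order.strict_implies_order[OF n(2)] by (rule order_trans)
    qed
    then show ?thesis by (intro exI[of _ "real (Max F)"]) auto
  qed
  then obtain c where c: "0 \<le> c" "\<And>x. - ereal c \<le> \<psi> x" by blast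
  define u where "u x = e2ennreal (\<psi> x + ereal c)" for x
  have u: "enn2ereal (u x) = \<psi> x + ereal c" for x
    unfolding u_def using c(2)[of x] by (subst enn2ereal_e2ennreal) (cases "\<psi> x"; auto)+
  show ?thesis
  proof (rule that[OF c(1)])
    have "s < u x \<longleftrightarrow> enn2ereal s - ereal c < \<psi> x" for s x
      unfolding less_ennreal.rep_eq u by (cases "\<psi> x"; cases "enn2ereal s") auto
    then show "lsc u" using lsc by (simp add: lsc_def)
    show "\<psi> x = enn2ereal (u x) - ereal c" for x
      unfolding u by (cases "\<psi> x") auto
  qed
qed

text \<open>The infix notation stands for two notions of summability; integrability with respect to the counting
measure is the one that matches \<open>esum\<close>.\<close>

abbreviation abs_summable :: "('i \<Rightarrow> real) \<Rightarrow> 'i set \<Rightarrow> bool" where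
  "abs_summable r J \<equiv> Infinite_Set_Sum.abs_summable_on r J"

lemma esum_real:
  assumes "abs_summable r (J)" "\<And>j. j \<in> J \<Longrightarrow> u j = ereal (r j)"
  shows "esum J u = ereal (infsetsum r J)"
  using eint_integrable[of "count_space J" r u] assms
  by (simp add: Infinite_Set_Sum.abs_summable_on_def Infinite_Set_Sum.infsetsum_def AE_count_space)

lemma esum_finiteD:
  assumes "\<bar>esum J u\<bar> \<noteq> \<infinity>"
  shows "abs_summable (\<lambda>j. real_of_ereal (u j)) (J)"
    and "j \<in> J \<Longrightarrow> u j = ereal (real_of_ereal (u j))"
    and "esum J u = ereal (infsetsum (\<lambda>j. real_of_ereal (u j)) J)"
proof -
  have m: "u \<in> borel_measurable (count_space J)" by simp
  show 1: "abs_summable (\<lambda>j. real_of_ereal (u j)) (J)"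
    using eint_finiteD(4)[OF m assms] by (simp add: Infinite_Set_Sum.abs_summable_on_def)
  show 2: "u j = ereal (real_of_ereal (u j))" if "j \<in> J" for j
    using eint_finiteD(3)[OF m assms] that by (simp add: AE_count_space)
  show "esum J u = ereal (infsetsum (\<lambda>j. real_of_ereal (u j)) J)"
    by (rule esum_real[OF 1 2])
qed

lemma infsetsum_row:
  fixes u :: "'i \<Rightarrow> real"
  assumes u: "abs_summable u (I)" and i: "i \<in> I"
  shows "abs_summable (\<lambda>(p, q). if p = i then u q else 0) (I \<times> I)"
    and "infsetsum (\<lambda>(p, q). if p = i then u q else 0) (I \<times> I) = infsetsum u I"
proof -
  let ?f = "\<lambda>(p, q). if p = i then u q else 0"
  have inj: "inj_on (Pair i) I" by (simp add: inj_on_def)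
  have "abs_summable ?f (Pair i ` I)"
    by (subst Infinite_Set_Sum.abs_summable_on_reindex_iff[OF inj, symmetric]) (simp add: u)
  then show "abs_summable ?f (I \<times> I)"
    by (subst Infinite_Set_Sum.abs_summable_on_cong_neutral[of _ "Pair i ` I" _ ?f]) (use i in auto)
  have "infsetsum ?f (I \<times> I) = infsetsum ?f (Pair i ` I)"
    by (rule infsetsum_cong_neutral) (use i in auto)
  also have "\<dots> = infsetsum u I" by (subst infsetsum_reindex[OF inj]) simp
  finally show "infsetsum ?f (I \<times> I) = infsetsum u I" .
qed

lemma infsetsum_column:
  fixes u :: "'i \<Rightarrow> real"
  assumes u: "abs_summable u (I)" and i: "i \<in> I"
  shows "abs_summable (\<lambda>(p, q). if q = i then u p else 0) (I \<times> I)"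
    and "infsetsum (\<lambda>(p, q). if q = i then u p else 0) (I \<times> I) = infsetsum u I"
proof -
  let ?f = "\<lambda>(p, q). if q = i then u p else 0" and ?g = "\<lambda>p. (p, i)"
  have inj: "inj_on ?g I" by (simp add: inj_on_def)
  have "abs_summable ?f (?g ` I)"
    by (subst Infinite_Set_Sum.abs_summable_on_reindex_iff[OF inj, symmetric]) (simp add: u)
  then show "abs_summable ?f (I \<times> I)"
    by (subst Infinite_Set_Sum.abs_summable_on_cong_neutral[of _ "?g ` I" _ ?f]) (use i in auto)
  have "infsetsum ?f (I \<times> I) = infsetsum ?f (?g ` I)"
    by (rule infsetsum_cong_neutral) (use i in auto)
  also have "\<dots> = infsetsum u I" by (subst infsetsum_reindex[OF inj]) simp
  finally show "infsetsum ?f (I \<times> I) = infsetsum u I" .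
qed

lemma infsetsum_single:
  fixes d :: real
  assumes i: "i \<in> I"
  shows "abs_summable (\<lambda>q. if q = i then d else 0) (I)"
    and "infsetsum (\<lambda>q. if q = i then d else 0) I = d"
proof -
  show "abs_summable (\<lambda>q. if q = i then d else 0) (I)"
    by (subst Infinite_Set_Sum.abs_summable_on_cong_neutral[of _ "{i}" _ "\<lambda>_. d"]) (use i in auto)
  have "infsetsum (\<lambda>q. if q = i then d else 0) I = infsetsum (\<lambda>_. d) {i}"
    by (rule infsetsum_cong_neutral) (use i in auto)
  then show "infsetsum (\<lambda>q. if q = i then d else 0) I = d" by simp
qed

text \<open>The effect on a double sum of changing one index: row \<open>i\<close> and column \<open>i\<close> each receive \<open>t * u\<close>, and
the diagonal entry an additional \<open>d\<close>.\<close>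

lemma infsetsum_bordered:
  fixes E :: "'i \<Rightarrow> 'i \<Rightarrow> real" and t d :: real
  assumes E: "abs_summable (\<lambda>(p, q). E p q) (I \<times> I)" and u: "abs_summable u (I)" and i: "i \<in> I"
  defines "E' \<equiv> \<lambda>(p, q). E p q + t * (if p = i then u q else 0) + t * (if q = i then u p else 0)
    + (if p = i then if q = i then d else 0 else 0)"
  shows "abs_summable E' (I \<times> I)"
    and "infsetsum E' (I \<times> I) = infsetsum (\<lambda>(p, q). E p q) (I \<times> I) + 2 * t * infsetsum u I + d"
proof -
  let ?a = "\<lambda>(p, q). if p = i then u q else 0" and ?b = "\<lambda>(p, q). if q = i then u p else 0"
  let ?d = "\<lambda>(p, q). if p = i then if q = i then d else 0 else 0"
  note a = infsetsum_row[OF u i] and b = infsetsum_column[OF u i]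
  note d = infsetsum_row[OF infsetsum_single(1)[OF i, of d] i] infsetsum_single(2)[OF i, of d]
  have eq: "E' = (\<lambda>z. (case z of (p, q) \<Rightarrow> E p q) + t * ?a z + t * ?b z + ?d z)"
    by (auto simp: E'_def fun_eq_iff)
  show "abs_summable E' (I \<times> I)"
    unfolding eq by (intro Infinite_Set_Sum.abs_summable_on_add Infinite_Set_Sum.abs_summable_on_cmult_right E a b d)
  have "infsetsum E' (I \<times> I) = infsetsum (\<lambda>(p, q). E p q) (I \<times> I) + t * infsetsum ?a (I \<times> I)
      + t * infsetsum ?b (I \<times> I) + infsetsum ?d (I \<times> I)"
    unfolding eq
    by (simp add: infsetsum_add infsetsum_cmult_right Infinite_Set_Sum.abs_summable_on_add Infinite_Set_Sum.abs_summable_on_cmult_right E a(1) b(1) d(1))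
  then show "infsetsum E' (I \<times> I) = infsetsum (\<lambda>(p, q). E p q) (I \<times> I) + 2 * t * infsetsum u I + d"
    using a(2) b(2) d(2,3) by simp
qed

lemma emeasure_eq_measure_radon: "finite_radon M \<Longrightarrow> emeasure M B = ennreal (measure M B)"
  by (rule finite_measure.emeasure_eq_measure[OF finite_radon_finite_measure])

lemma measure_lincomb:
  fixes M N :: "'b::t2_space measure"
  assumes "finite_radon M" "finite_radon N" "0 \<le> a" "0 \<le> b" "B \<in> sets borel"
  shows "measure (lincomb a M b N) B = a * measure M B + b * measure N B"
proof -
  have "emeasure (lincomb a M b N) B = ennreal (a * measure M B + b * measure N B)"
    using assms by (simp add: emeasure_lincomb finite_radon_sets emeasure_eq_measure_radon ennreal_mult)
  then show ?thesis using assms by (simp add: measure_def del: ennreal_plus)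
qed

lemma eint_shifted:
  assumes M: "finite_radon M" and u: "u \<in> borel_measurable borel" and c: "0 \<le> c"
    and eq: "\<And>x. \<psi> x = enn2ereal (u x) - ereal c"
  shows "eint M \<psi> = enn2ereal (\<integral>\<^sup>+x. u x \<partial>M) - ereal (c * measure M UNIV)"
proof -
  have q: "(\<integral>\<^sup>+x. ennreal c \<partial>M) = ennreal (c * measure M UNIV)"
    using emeasure_eq_measure_radon[OF M, of UNIV] finite_radon_space[OF M] c by (simp add: ennreal_mult)
  have "eint M \<psi> = enn2ereal (\<integral>\<^sup>+x. u x \<partial>M) - enn2ereal (\<integral>\<^sup>+x. ennreal c \<partial>M)"
  proof (rule eint_eq_diff)
    show "u \<in> borel_measurable M" by (rule borel_measurable_sets_eq[OF finite_radon_sets[OF M] u])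
    show "AE x in M. \<psi> x = enn2ereal (u x) - enn2ereal (ennreal c)" using c by (simp add: eq)
    show "(\<integral>\<^sup>+x. ennreal c \<partial>M) < \<infinity>" using q by simp
  qed simp
  then show ?thesis unfolding q using c by simp
qed

lemma eint_lincomb:
  fixes M N :: "'b::t2_space measure"
  assumes M: "finite_radon M" and N: "finite_radon N" and u: "u \<in> borel_measurable borel" and c: "0 \<le> c"
    and eq: "\<And>x. \<psi> x = enn2ereal (u x) - ereal c"
    and ab: "0 \<le> a" "0 \<le> b"
    and fin: "\<bar>eint M \<psi>\<bar> \<noteq> \<infinity>" "\<bar>eint N \<psi>\<bar> \<noteq> \<infinity>"
  shows "eint (lincomb a M b N) \<psi> = ereal (a * real_of_ereal (eint M \<psi>) + b * real_of_ereal (eint N \<psi>))"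
proof -
  let ?I = "\<integral>\<^sup>+x. u x \<partial>M" and ?J = "\<integral>\<^sup>+x. u x \<partial>N"
  have e: "eint M \<psi> = enn2ereal ?I - ereal (c * measure M UNIV)" "eint N \<psi> = enn2ereal ?J - ereal (c * measure N UNIV)"
    using eint_shifted[OF M u c eq] eint_shifted[OF N u c eq] by auto
  have "?I \<noteq> \<infinity>" "?J \<noteq> \<infinity>" using fin by (auto simp: e)
  then obtain v w where vw: "?I = ennreal v" "0 \<le> v" "?J = ennreal w" "0 \<le> w"
    by (cases ?I; cases ?J) auto
  have "(\<integral>\<^sup>+x. u x \<partial>lincomb a M b N) = ennreal (a * v + b * w)"
    using nn_integral_lincomb[OF finite_radon_sets[OF M] finite_radon_sets[OF N] u, of a b] vw ab
    by (simp add: ennreal_mult)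
  then show ?thesis
    unfolding e eint_shifted[OF finite_radon_lincomb[OF M N] u c eq]
    using vw ab measure_lincomb[OF M N ab, of UNIV] by (simp add: algebra_simps del: ennreal_plus)
qed

text \<open>The kernel is bounded below, so it is represented as a nonnegative kernel \<open>k\<close> minus a constant.
Against finite measures the constant contributes finite amounts only, and all questions of
finiteness are questions about \<open>k\<close>.\<close>

locale shifted_kernel =
  fixes \<kappa> :: "'a::t2_space \<times> 'a \<Rightarrow> ereal" and k :: "'a \<times> 'a \<Rightarrow> ennreal" and c :: real
  assumes kernel_eq: "\<And>z. \<kappa> z = enn2ereal (k z) - ereal c"
    and shift_nonneg: "0 \<le> c"
    and kernel_lsc: "lsc k"
    and kernel_sym: "\<And>x y. \<kappa> (x, y) = \<kappa> (y, x)"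
begin

lemma k_borel: "k \<in> borel_measurable borel"
  by (rule lsc_borel[OF kernel_lsc])

lemma k_sym: "k (x, y) = k (y, x)"
proof -
  have "e2ennreal (\<kappa> z + ereal c) = k z" for z
    by (cases "k z") (auto simp: kernel_eq)
  then show ?thesis using kernel_sym by metis
qed

definition energy :: "'a measure \<Rightarrow> 'a measure \<Rightarrow> ennreal" where
  "energy M N = (\<integral>\<^sup>+x. \<integral>\<^sup>+y. k (x, y) \<partial>N \<partial>M)"

lemma lsc_pot: "finite_radon N \<Longrightarrow> lsc (\<lambda>x. \<integral>\<^sup>+y. k (x, y) \<partial>N)"
  by (rule lsc_nn_integral[OF kernel_lsc])

lemma energy_sym: "finite_radon M \<Longrightarrow> finite_radon N \<Longrightarrow> energy M N = energy N M"
  unfolding energy_def by (subst nn_integral_section_product_swap[OF _ _ k_borel]) (simp_all add: k_sym)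

lemma k_section_borel: "(\<lambda>y. k (x, y)) \<in> borel_measurable borel"
  using measurable_compose[OF Pair_borel k_borel] by simp

lemma potential_eq:
  assumes N: "finite_radon N"
  shows "potential \<kappa> x N = enn2ereal (\<integral>\<^sup>+y. k (x, y) \<partial>N) - ereal (c * measure N UNIV)"
  unfolding potential_def
  by (rule eint_shifted[OF N k_section_borel shift_nonneg]) (simp add: kernel_eq)

lemma mutual_energy_eq:
  assumes M: "finite_radon M" and N: "finite_radon N"
  shows "mutual_energy \<kappa> M N = enn2ereal (energy M N) - ereal (c * (measure M UNIV * measure N UNIV))"
proof -
  have "emeasure (section_product M N) UNIV = emeasure N UNIV * emeasure M UNIV"
    using emeasure_section_product[OF M N, of UNIV] finite_radon_space[OF M] by simp
  then have "measure (section_product M N) UNIV = measure M UNIV * measure N UNIV"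
    by (simp add: measure_def enn2real_mult)
  then show ?thesis
    unfolding mutual_energy_def radon_prod_eq_section_product[OF M N]
      eint_shifted[OF finite_radon_section_product[OF M N] k_borel shift_nonneg kernel_eq]
    by (simp add: nn_integral_section_product[OF M N k_borel] energy_def)
qed

lemma mutual_energy_sym:
  "finite_radon M \<Longrightarrow> finite_radon N \<Longrightarrow> mutual_energy \<kappa> M N = mutual_energy \<kappa> N M"
  by (simp add: mutual_energy_eq energy_sym mult.commute)

lemma energy_finite_iff:
  "finite_radon M \<Longrightarrow> finite_radon N \<Longrightarrow> \<bar>mutual_energy \<kappa> M N\<bar> \<noteq> \<infinity> \<longleftrightarrow> energy M N < \<infinity>"
  by (cases "energy M N") (auto simp: mutual_energy_eq)

lemma energy_lincomb:
  assumes M: "finite_radon M" and N: "finite_radon N" and L: "finite_radon L"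
  shows "energy (lincomb a M b N) L = ennreal a * energy M L + ennreal b * energy N L"
  unfolding energy_def
  by (rule nn_integral_lincomb[OF finite_radon_sets[OF M] finite_radon_sets[OF N] lsc_borel[OF lsc_pot[OF L]]])

lemma mutual_energy_lincomb:
  assumes M: "finite_radon M" and N: "finite_radon N" and L: "finite_radon L" and ab: "0 \<le> a" "0 \<le> b"
    and fin: "\<bar>mutual_energy \<kappa> M L\<bar> \<noteq> \<infinity>" "\<bar>mutual_energy \<kappa> N L\<bar> \<noteq> \<infinity>"
  shows "mutual_energy \<kappa> (lincomb a M b N) L =
    ereal (a * real_of_ereal (mutual_energy \<kappa> M L) + b * real_of_ereal (mutual_energy \<kappa> N L))"
proof -
  have "energy M L < \<infinity>" "energy N L < \<infinity>" using fin energy_finite_iff[OF M L] energy_finite_iff[OF N L] by simp_all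
  then obtain v w where vw: "energy M L = ennreal v" "0 \<le> v" "energy N L = ennreal w" "0 \<le> w"
    by (cases "energy M L"; cases "energy N L") auto
  have "energy (lincomb a M b N) L = ennreal (a * v + b * w)"
    using energy_lincomb[OF M N L, of a b] vw ab by (simp add: ennreal_mult)
  then show ?thesis
    unfolding mutual_energy_eq[OF M L] mutual_energy_eq[OF N L] mutual_energy_eq[OF finite_radon_lincomb[OF M N] L]
    using vw ab measure_lincomb[OF M N ab, of UNIV] by (simp add: algebra_simps del: ennreal_plus)
qed

end

section \<open>The first variation of the Gauss functional\<close>

text \<open>Finiteness of the components is what makes their products available; it will come from the
summability of \<open>a i / inf g i\<close>.\<close>

locale equilibrium = shifted_kernel \<kappa> k c
  for \<kappa> :: "'a::t2_space \<times> 'a \<Rightarrow> ereal" and k c +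
  fixes Iplus Iminus :: "nat set" and A :: "nat \<Rightarrow> 'a set" and a :: "nat \<Rightarrow> real"
    and g :: "nat \<Rightarrow> 'a \<Rightarrow> real" and f :: "nat \<Rightarrow> 'a \<Rightarrow> ereal" and lam :: "nat \<Rightarrow> 'a measure"
  assumes equi: "lam \<in> equilibrium_measures \<kappa> Iplus Iminus A a g f"
    and finite_lam: "\<And>j. j \<in> Iplus \<union> Iminus \<Longrightarrow> finite_radon (lam j)"
    and field: "\<And>j. j \<in> Iplus \<union> Iminus \<Longrightarrow> f j \<in> Phi"
    and closed_A: "\<And>j. j \<in> Iplus \<union> Iminus \<Longrightarrow> closed (A j)"
    and cont_g: "\<And>j. j \<in> Iplus \<union> Iminus \<Longrightarrow> continuous_on (A j) (g j)"
    and pos_g: "\<And>j x. j \<in> Iplus \<union> Iminus \<Longrightarrow> x \<in> A j \<Longrightarrow> 0 < g j x"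
    and pos_a: "\<And>j. j \<in> Iplus \<union> Iminus \<Longrightarrow> 0 < a j"
begin

abbreviation I :: "nat set" where "I \<equiv> Iplus \<union> Iminus"

definition real_sign :: "nat \<Rightarrow> real" where "real_sign p = (if p \<in> Iplus then 1 else - 1)"

lemma idx_sign_eq: "idx_sign Iplus p = ereal (real_sign p)"
  by (simp add: idx_sign_def real_sign_def one_ereal_def)

lemma real_sign_square: "real_sign p * real_sign p = 1"
  by (simp add: real_sign_def)

text \<open>The mutual energy of \<open>lam\<close> with the vector measure whose only nonzero component is \<open>\<nu>\<close>, at index \<open>i\<close>.\<close>

definition cross :: "nat \<Rightarrow> 'a measure \<Rightarrow> ereal" where
  "cross i \<nu> = esum I (\<lambda>j. idx_sign Iplus i * idx_sign Iplus j * mutual_energy \<kappa> \<nu> (lam j))"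

lemma lam_admissible: "lam \<in> admissible \<kappa> Iplus Iminus A a g f"
  using equi by (simp add: equilibrium_measures_def)

lemma lam_energy_finite: "\<bar>vector_mutual_energy \<kappa> Iplus Iminus lam lam\<bar> \<noteq> \<infinity>"
  and lam_field_finite: "\<bar>field_pairing Iplus Iminus f lam\<bar> \<noteq> \<infinity>"
  and lam_mass: "i \<in> I \<Longrightarrow> (\<integral>\<^sup>+x\<in>A i. ennreal (g i x) \<partial>lam i) = ennreal (a i)"
  and lam_radon_on: "i \<in> I \<Longrightarrow> lam i \<in> radon_on (A i)"
  using lam_admissible by (auto simp: admissible_def vector_finite_energy_def vector_measures_def)

lemma sign_mult_finite: "\<bar>idx_sign Iplus i * idx_sign Iplus j * e\<bar> \<noteq> \<infinity> \<longleftrightarrow> \<bar>e\<bar> \<noteq> \<infinity>"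
  by (cases e) (auto simp: idx_sign_def)

definition lam_energy :: "nat \<Rightarrow> nat \<Rightarrow> real" where
  "lam_energy p q = real_of_ereal (mutual_energy \<kappa> (lam p) (lam q))"

lemma mutual_lam: assumes "p \<in> I" "q \<in> I" shows "mutual_energy \<kappa> (lam p) (lam q) = ereal (lam_energy p q)"
proof -
  have "\<bar>idx_sign Iplus p * idx_sign Iplus q * mutual_energy \<kappa> (lam p) (lam q)\<bar> \<noteq> \<infinity>"
    using esum_finiteD(2)[OF lam_energy_finite[unfolded vector_mutual_energy_def], of "(p, q)"] assms
    by (metis (no_types, lifting) MInfty_neq_ereal(1) PInfty_neq_ereal(1) SigmaI abs_ereal.simps(1) case_prod_conv)
  then have "\<bar>mutual_energy \<kappa> (lam p) (lam q)\<bar> \<noteq> \<infinity>" by (simp only: sign_mult_finite simp_thms)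
  then show ?thesis by (auto simp: lam_energy_def)
qed

definition pair_energy :: "nat \<Rightarrow> nat \<Rightarrow> real" where "pair_energy p q = real_sign p * real_sign q * lam_energy p q"

lemma pair_energy_summable: "abs_summable (\<lambda>(p, q). pair_energy p q) (I \<times> I)"
  and vector_energy_lam: "vector_mutual_energy \<kappa> Iplus Iminus lam lam = ereal (infsetsum (\<lambda>(p, q). pair_energy p q) (I \<times> I))"
proof -
  have eq: "real_of_ereal (case z of (p, q) \<Rightarrow> idx_sign Iplus p * idx_sign Iplus q * mutual_energy \<kappa> (lam p) (lam q))
      = (case z of (p, q) \<Rightarrow> pair_energy p q)" if "z \<in> I \<times> I" for z
    using that mutual_lam by (auto simp: idx_sign_eq pair_energy_def)
  note fin = esum_finiteD[OF lam_energy_finite[unfolded vector_mutual_energy_def]]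
  show "abs_summable (\<lambda>(p, q). pair_energy p q) (I \<times> I)"
    using fin(1) by (subst Infinite_Set_Sum.abs_summable_on_cong[OF eq[symmetric] refl]) auto
  show "vector_mutual_energy \<kappa> Iplus Iminus lam lam = ereal (infsetsum (\<lambda>(p, q). pair_energy p q) (I \<times> I))"
    unfolding vector_mutual_energy_def using fin(3) by (simp add: infsetsum_cong[OF eq refl])
qed

lemma row_summable: "i \<in> I \<Longrightarrow> abs_summable (\<lambda>q. pair_energy i q) I"
  using Infinite_Set_Sum.abs_summable_on_Sigma_project2[OF pair_energy_summable] by simp

lemma cross_lam: assumes "i \<in> I" shows "cross i (lam i) = ereal (infsetsum (\<lambda>q. pair_energy i q) I)"
  unfolding cross_def
  by (rule esum_real[OF row_summable[OF assms]]) (use mutual_lam assms in \<open>auto simp: idx_sign_eq pair_energy_def\<close>)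

lemma field_lam: "i \<in> I \<Longrightarrow> \<bar>eint (lam i) (f i)\<bar> \<noteq> \<infinity>"
  using esum_finiteD(2)[OF lam_field_finite[unfolded field_pairing_def], of i]
  by (metis MInfty_neq_ereal(1) PInfty_neq_ereal(1) abs_ereal.simps(1))

definition field_term :: "nat \<Rightarrow> real" where "field_term j = real_of_ereal (eint (lam j) (f j))"

lemma field_term_summable: "abs_summable field_term I"
  and field_pairing_lam: "field_pairing Iplus Iminus f lam = ereal (infsetsum field_term I)"
  using esum_finiteD(1,3)[OF lam_field_finite[unfolded field_pairing_def]]
  unfolding field_term_def field_pairing_def by auto

lemma field_term_eq: "i \<in> I \<Longrightarrow> eint (lam i) (f i) = ereal (field_term i)"
  using field_lam[of i] unfolding field_term_def by (cases "eint (lam i) (f i)") auto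

lemma gauss_lam: "gauss_functional \<kappa> Iplus Iminus f lam =
    ereal (infsetsum (\<lambda>(p, q). pair_energy p q) (I \<times> I) + 2 * infsetsum field_term I)"
  by (simp add: gauss_functional_def vector_energy_lam field_pairing_lam)

lemma gauss_least: "\<mu> \<in> admissible \<kappa> Iplus Iminus A a g f \<Longrightarrow>
    gauss_functional \<kappa> Iplus Iminus f lam \<le> gauss_functional \<kappa> Iplus Iminus f \<mu>"
  using equi by (auto simp: equilibrium_measures_def gauss_infimum_def intro: INF_lower)

lemma g_borel:
  assumes "i \<in> I" shows "(\<lambda>x. ennreal (g i x) * indicator (A i) x) \<in> borel_measurable borel"
proof -
  have "(\<lambda>x. indicator (A i) x *\<^sub>R g i x) \<in> borel_measurable borel"
    using closed_A[OF assms] cont_g[OF assms] by (intro borel_measurable_continuous_on_indicator) auto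
  then have "(\<lambda>x. ennreal (indicator (A i) x *\<^sub>R g i x)) \<in> borel_measurable borel" by simp
  also have "(\<lambda>x. ennreal (indicator (A i) x *\<^sub>R g i x)) = (\<lambda>x. ennreal (g i x) * indicator (A i) x)"
    by (auto simp: indicator_def fun_eq_iff)
  finally show ?thesis .
qed

text \<open>Moving \<open>lam i\<close> towards \<open>\<nu>\<close> stays admissible.  The Gauss functional is then a quadratic polynomial in
the step \<open>t\<close>, its linear coefficient is twice the difference of the two sides, and this cannot be
negative since the polynomial is minimal at \<open>t = 0\<close> on the interval from \<open>0\<close> to \<open>1\<close>.\<close>

lemma variational_inequality:
  assumes i: "i \<in> I" and \<nu>: "finite_radon \<nu>" and supp: "msupport \<nu> \<subseteq> A i"
    and mass: "(\<integral>\<^sup>+x\<in>A i. ennreal (g i x) \<partial>\<nu>) = ennreal (a i)"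
    and en: "\<bar>mutual_energy \<kappa> \<nu> \<nu>\<bar> \<noteq> \<infinity>" and cr: "\<bar>cross i \<nu>\<bar> \<noteq> \<infinity>" and fi: "\<bar>eint \<nu> (f i)\<bar> \<noteq> \<infinity>"
  shows "cross i (lam i) + eint (lam i) (f i) \<le> cross i \<nu> + eint \<nu> (f i)"
proof -
  define s where "s q = real_of_ereal (mutual_energy \<kappa> \<nu> (lam q))" for q
  have s: "mutual_energy \<kappa> \<nu> (lam q) = ereal (s q)" if "q \<in> I" for q
  proof -
    have "\<bar>idx_sign Iplus i * idx_sign Iplus q * mutual_energy \<kappa> \<nu> (lam q)\<bar> \<noteq> \<infinity>"
      using esum_finiteD(2)[OF cr[unfolded cross_def] that]
      by (metis MInfty_neq_ereal(1) PInfty_neq_ereal(1) abs_ereal.simps(1))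
    then have "\<bar>mutual_energy \<kappa> \<nu> (lam q)\<bar> \<noteq> \<infinity>" by (simp only: sign_mult_finite simp_thms)
    then show ?thesis by (auto simp: s_def)
  qed
  define S where "S q = real_sign i * real_sign q * s q" for q
  have Seq: "real_of_ereal (idx_sign Iplus i * idx_sign Iplus q * mutual_energy \<kappa> \<nu> (lam q)) = S q"
    if "q \<in> I" for q using s[OF that] by (simp add: idx_sign_eq S_def)
  have S: "abs_summable S I"
    using esum_finiteD(1)[OF cr[unfolded cross_def]]
    by (subst Infinite_Set_Sum.abs_summable_on_cong[OF Seq[symmetric] refl]) auto
  have cross_\<nu>: "cross i \<nu> = ereal (infsetsum S I)"
    unfolding cross_def by (rule esum_real[OF S]) (simp add: s idx_sign_eq S_def)
  define n where "n = real_of_ereal (mutual_energy \<kappa> \<nu> \<nu>)"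
  have n: "mutual_energy \<kappa> \<nu> \<nu> = ereal n" using en unfolding n_def by (cases "mutual_energy \<kappa> \<nu> \<nu>") auto
  define h where "h = real_of_ereal (eint \<nu> (f i))"
  have h: "eint \<nu> (f i) = ereal h" using fi unfolding h_def by (cases "eint \<nu> (f i)") auto
  define u where "u q = S q - pair_energy i q" for q
  have u: "abs_summable u I"
    unfolding u_def by (intro Infinite_Set_Sum.abs_summable_on_diff S row_summable i)
  have infu: "infsetsum u I = infsetsum S I - infsetsum (\<lambda>q. pair_energy i q) I"
    unfolding u_def by (rule infsetsum_diff[OF S row_summable[OF i]])
  \<comment> \<open>The coefficient of \<open>t\<^sup>2\<close>: the energy of \<open>\<nu> - lam i\<close>.\<close>
  define d where "d = n - 2 * s i + lam_energy i i"
  have key: "0 \<le> 2 * t * (infsetsum u I + (h - field_term i)) + t^2 * d" if t: "0 < t" "t \<le> 1" for t :: real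
  proof -
    define m where "m = lincomb (1 - t) (lam i) t \<nu>"
    define \<mu> where "\<mu> = lam(i := m)"
    have t01: "0 \<le> 1 - t" "0 \<le> t" using t by auto
    have m: "finite_radon m" unfolding m_def by (rule finite_radon_lincomb[OF finite_lam[OF i] \<nu>])
    have mL: "mutual_energy \<kappa> m (lam q) = ereal ((1 - t) * lam_energy i q + t * s q)" if "q \<in> I" for q
      unfolding m_def
      using mutual_energy_lincomb[OF finite_lam[OF i] \<nu> finite_lam[OF that] t01] mutual_lam[OF i that] s[OF that]
      by simp
    have m\<nu>: "mutual_energy \<kappa> m \<nu> = ereal ((1 - t) * s i + t * n)"
      using mutual_energy_lincomb[OF finite_lam[OF i] \<nu> \<nu> t01] s[OF i] n mutual_energy_sym[OF finite_lam[OF i] \<nu>]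
      unfolding m_def by simp
    have mm: "mutual_energy \<kappa> m m = ereal ((1 - t) * ((1 - t) * lam_energy i i + t * s i) + t * ((1 - t) * s i + t * n))"
      using mutual_energy_lincomb[OF finite_lam[OF i] \<nu> m t01] mL[OF i] m\<nu>
        mutual_energy_sym[OF finite_lam[OF i] m] mutual_energy_sym[OF \<nu> m]
      unfolding m_def[symmetric] by simp
    define pair_energy' where "pair_energy' = (\<lambda>(p, q). pair_energy p q + t * (if p = i then u q else 0) + t * (if q = i then u p else 0)
      + (if p = i then if q = i then t^2 * d else 0 else 0))"
    note bord = infsetsum_bordered[OF pair_energy_summable u i, of t "t^2 * d", folded pair_energy'_def]
    have entry: "idx_sign Iplus p * idx_sign Iplus q * mutual_energy \<kappa> (\<mu> p) (\<mu> q) = ereal (pair_energy' (p, q))"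
      if pq: "p \<in> I" "q \<in> I" for p q
    proof -
      consider "p = i" "q = i" | "p = i" "q \<noteq> i" | "p \<noteq> i" "q = i" | "p \<noteq> i" "q \<noteq> i" by blast
      then show ?thesis
      proof cases
        case 1
        have "real_sign i * real_sign i * ((1 - t) * ((1 - t) * lam_energy i i + t * s i) + t * ((1 - t) * s i + t * n)) =
            real_sign i * real_sign i * lam_energy i i + 2 * t * (real_sign i * real_sign i * s i - real_sign i * real_sign i * lam_energy i i) + t^2 * d"
          unfolding real_sign_square d_def by (simp add: algebra_simps power2_eq_square)
        then show ?thesis using 1 by (simp add: \<mu>_def mm idx_sign_eq pair_energy'_def u_def S_def pair_energy_def)
      next
        case 2
        then show ?thesis using pq
          by (simp add: \<mu>_def mL idx_sign_eq pair_energy'_def u_def S_def pair_energy_def algebra_simps)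
      next
        case 3
        have "mutual_energy \<kappa> (lam p) m = ereal ((1 - t) * lam_energy i p + t * s p)"
          using mL[OF pq(1)] mutual_energy_sym[OF finite_lam[OF pq(1)] m] by simp
        moreover have "lam_energy p i = lam_energy i p" using mutual_energy_sym[OF finite_lam finite_lam, OF i pq(1)] by (simp add: lam_energy_def)
        ultimately show ?thesis using 3 pq
          by (simp add: \<mu>_def idx_sign_eq pair_energy'_def u_def S_def pair_energy_def algebra_simps)
      next
        case 4
        then show ?thesis using pq by (simp add: \<mu>_def mutual_lam idx_sign_eq pair_energy'_def pair_energy_def)
      qed
    qed
    have energy_\<mu>: "vector_mutual_energy \<kappa> Iplus Iminus \<mu> \<mu> =
        ereal (infsetsum (\<lambda>(p, q). pair_energy p q) (I \<times> I) + 2 * t * infsetsum u I + t^2 * d)"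
      unfolding vector_mutual_energy_def bord(2)[symmetric]
      by (rule esum_real[OF bord(1)]) (use entry in auto)
    obtain b v where bv: "0 \<le> b" "lsc v" "\<And>x. f i x = enn2ereal (v x) - ereal b"
      using Phi_shift[OF field[OF i]] by blast
    have "eint m (f i) = ereal ((1 - t) * field_term i + t * h)"
      unfolding m_def
      using eint_lincomb[OF finite_lam[OF i] \<nu> lsc_borel[OF bv(2)] bv(1,3) t01 field_lam[OF i] fi] h field_term_eq[OF i]
      by simp
    then have fterm: "eint (\<mu> j) (f j) = ereal (field_term j + (if j = i then t * (h - field_term i) else 0))" if "j \<in> I" for j
      using field_term_eq[OF that] by (simp add: \<mu>_def algebra_simps)
    have field_\<mu>: "field_pairing Iplus Iminus f \<mu> = ereal (infsetsum field_term I + t * (h - field_term i))"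
    proof -
      note sng = infsetsum_single[OF i, of "t * (h - field_term i)"]
      have "field_pairing Iplus Iminus f \<mu> = ereal (infsetsum (\<lambda>j. field_term j + (if j = i then t * (h - field_term i) else 0)) I)"
        unfolding field_pairing_def
        by (rule esum_real[OF Infinite_Set_Sum.abs_summable_on_add[OF field_term_summable sng(1)] fterm])
      then show ?thesis by (simp add: infsetsum_add[OF field_term_summable sng(1)] sng(2))
    qed
    have "\<mu> \<in> admissible \<kappa> Iplus Iminus A a g f"
    proof -
      have "m \<in> radon_on (A i)"
      proof -
        have "emeasure (lam i) (- A i) = 0" "emeasure \<nu> (- A i) = 0"
          using lam_radon_on[OF i] supp msupport_subset_iff[OF _ closed_A[OF i]] finite_radon_radon[OF \<nu>]
          by (auto simp: radon_on_def)
        then have "emeasure m (- A i) = 0"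
          unfolding m_def using closed_A[OF i]
          by (subst emeasure_lincomb[OF finite_radon_sets[OF finite_lam[OF i]] finite_radon_sets[OF \<nu>]]) auto
        then show ?thesis
          using msupport_subset_iff[OF finite_radon_radon[OF m] closed_A[OF i]] finite_radon_radon[OF m]
          by (simp add: radon_on_def)
      qed
      then have "\<mu> \<in> vector_measures Iplus Iminus A"
        using lam_radon_on by (auto simp: vector_measures_def \<mu>_def)
      moreover have "(\<integral>\<^sup>+x\<in>A j. ennreal (g j x) \<partial>\<mu> j) = ennreal (a j)" if "j \<in> I" for j
      proof (cases "j = i")
        case True
        have "(\<integral>\<^sup>+x\<in>A i. ennreal (g i x) \<partial>m) = ennreal (1 - t) * ennreal (a i) + ennreal t * ennreal (a i)"
          unfolding m_def
          by (subst nn_integral_lincomb[OF finite_radon_sets[OF finite_lam[OF i]] finite_radon_sets[OF \<nu>] g_borel[OF i]])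
             (simp add: mass lam_mass[OF i])
        also have "\<dots> = ennreal ((1 - t) * a i + t * a i)"
          using t01 pos_a[OF i] by (simp add: ennreal_mult)
        also have "(1 - t) * a i + t * a i = a i" by (simp add: algebra_simps)
        finally show ?thesis using True by (simp add: \<mu>_def)
      qed (use lam_mass that in \<open>simp add: \<mu>_def\<close>)
      ultimately show ?thesis
        using energy_\<mu> field_\<mu> by (simp add: admissible_def vector_finite_energy_def)
    qed
    then have "gauss_functional \<kappa> Iplus Iminus f lam \<le> gauss_functional \<kappa> Iplus Iminus f \<mu>"
      by (rule gauss_least)
    then show ?thesis
      unfolding gauss_lam unfolding gauss_functional_def energy_\<mu> field_\<mu> by (simp add: algebra_simps)
  qed
  have "0 \<le> infsetsum u I + (h - field_term i)"
  proof (rule ccontr)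
    assume neg: "\<not> 0 \<le> infsetsum u I + (h - field_term i)"
    define w where "w = - (infsetsum u I + (h - field_term i))"
    have w: "0 < w" using neg by (simp add: w_def)
    \<comment> \<open>For so small a step the quadratic term is dominated by the linear one.\<close>
    define t where "t = min 1 (w / (1 + \<bar>d\<bar>))"
    have t: "0 < t" "t \<le> 1" using w by (auto simp: t_def)
    have "t \<le> w / (1 + \<bar>d\<bar>)" by (simp add: t_def)
    then have tw: "t * (1 + \<bar>d\<bar>) \<le> w" by (subst (asm) pos_le_divide_eq) auto
    have "t * d \<le> t * \<bar>d\<bar>" using t by (intro mult_left_mono) auto
    moreover have "t + t * \<bar>d\<bar> \<le> w" using tw by (simp add: algebra_simps)
    ultimately have "t * d < 2 * w" using t w by linarith
    then have "t * (t * d) < t * (2 * w)" using t(1) by (rule mult_strict_left_mono)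
    then show False using key[OF t(1,2)] by (simp add: w_def power2_eq_square algebra_simps)
  qed
  then show ?thesis
    by (simp add: cross_\<nu> cross_lam[OF i] field_term_eq[OF i] h infu)
qed

end

section \<open>The weighted potential of one component\<close>

lemma nn_integral_sum_swap:
  fixes J :: "nat set" and u :: "nat \<Rightarrow> 'b \<Rightarrow> ennreal"
  assumes "\<And>j. j \<in> J \<Longrightarrow> u j \<in> borel_measurable M"
  shows "(\<integral>\<^sup>+x. \<integral>\<^sup>+j. u j x \<partial>count_space J \<partial>M) = (\<integral>\<^sup>+j. \<integral>\<^sup>+x. u j x \<partial>M \<partial>count_space J)"
proof -
  have s: "(\<integral>\<^sup>+j. w j \<partial>count_space J) = (\<Sum>j. w j * indicator J j)" for w :: "nat \<Rightarrow> ennreal"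
    by (simp add: nn_integral_count_space_indicator nn_integral_count_space_nat)
  have mass: "(\<lambda>x. u j x * indicator J j) \<in> borel_measurable M" for j
    by (cases "j \<in> J") (auto simp: assms)
  have "(\<integral>\<^sup>+x. \<integral>\<^sup>+j. u j x \<partial>count_space J \<partial>M) = (\<Sum>j. \<integral>\<^sup>+x. u j x * indicator J j \<partial>M)"
    unfolding s by (rule nn_integral_suminf) (rule mass)
  also have "\<dots> = (\<Sum>j. (\<integral>\<^sup>+x. u j x \<partial>M) * indicator J j)"
    by (intro suminf_cong) (auto simp: indicator_def)
  finally show ?thesis unfolding s .
qed

text \<open>The value \<open>\<infinity>\<close> outside a closed set does no harm to lower semicontinuity.  Thus a kernel that is
continuous and bounded above on a closed set only gives a lower semicontinuous kernel \<open>C - \<phi>\<close> on the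
whole space, to which \<open>lsc_nn_integral\<close> applies.\<close>

lemma lsc_extend_top:
  fixes \<phi> :: "'b::topological_space \<Rightarrow> ereal"
  assumes F: "closed F" and \<phi>: "continuous_on F \<phi>" and C: "\<And>z. z \<in> F \<Longrightarrow> \<phi> z \<le> ereal C"
  shows "lsc (\<lambda>z. if z \<in> F then e2ennreal (ereal C - \<phi> z) else top)"
  unfolding lsc_def
proof
  fix s :: ennreal
  show "open {z. s < (if z \<in> F then e2ennreal (ereal C - \<phi> z) else top)}"
  proof (cases "s = top")
    case False
    then obtain b where b: "s = ennreal b" "0 \<le> b" by (cases s) auto
    have "closed (\<phi> -` {ereal (C - b)..} \<inter> F)"
      by (rule continuous_on_closed_vimage[OF F, THEN iffD1, OF \<phi>, rule_format, OF closed_atLeast])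
    moreover have "s < e2ennreal (ereal C - \<phi> z) \<longleftrightarrow> \<not> ereal (C - b) \<le> \<phi> z" if "z \<in> F" for z
      using C[OF that] b by (cases "\<phi> z") (auto simp: ennreal_less_iff)
    then have "{z. s < (if z \<in> F then e2ennreal (ereal C - \<phi> z) else top)} = - (\<phi> -` {ereal (C - b)..} \<inter> F)"
      using False by (auto simp: top.not_eq_extremum)
    ultimately show ?thesis by (metis open_Compl)
  qed auto
qed

text \<open>One component \<open>i\<close> is singled out.  The index \<open>j\<close> has the sign of \<open>i\<close> iff \<open>i \<in> Iplus\<close> and \<open>j \<in> Iplus\<close>
are equivalent; stated in this way, the hypotheses on the kernel are symmetric in the two signs.\<close>

locale potential_setup = equilibrium \<kappa> k c Iplus Iminus A a g f lam
  for \<kappa> :: "'a::t2_space \<times> 'a \<Rightarrow> ereal" and k c Iplus Iminus A a g f lam +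
  fixes i :: nat and F :: "'a \<Rightarrow> ennreal" and d :: real
  assumes mass_summable: "(\<integral>\<^sup>+j. emeasure (lam j) UNIV \<partial>count_space (Iplus \<union> Iminus)) < \<infinity>"
    and i: "i \<in> Iplus \<union> Iminus"
    and F: "lsc F" and d: "0 \<le> d" and f_eq: "\<And>x. f i x = enn2ereal (F x) - ereal d"
    and opp_cont: "\<And>j. j \<in> Iplus \<union> Iminus \<Longrightarrow> (i \<in> Iplus) \<noteq> (j \<in> Iplus) \<Longrightarrow> continuous_on (A i \<times> A j) \<kappa>"
    and opp_bound: "\<And>D. compact D \<Longrightarrow> D \<subseteq> A i \<Longrightarrow> \<exists>C\<ge>0. \<forall>j\<in>Iplus \<union> Iminus. (i \<in> Iplus) \<noteq> (j \<in> Iplus) \<longrightarrow>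
      (\<forall>x\<in>D. \<forall>y\<in>A j. \<kappa> (x, y) \<le> ereal C)"
    and loc_compact: "\<And>x :: 'a. \<exists>V K. open V \<and> x \<in> V \<and> compact K \<and> V \<subseteq> K"
begin

abbreviation same :: "nat \<Rightarrow> bool" where "same j \<equiv> (i \<in> Iplus) = (j \<in> Iplus)"

definition mass :: "nat \<Rightarrow> real" where "mass j = measure (lam j) UNIV"

lemma mass_nonneg: "0 \<le> mass j" by (simp add: mass_def)

lemma emeasure_lam: "j \<in> I \<Longrightarrow> emeasure (lam j) UNIV = ennreal (mass j)"
  using emeasure_eq_measure_radon[OF finite_lam] by (simp add: mass_def)

definition pot :: "nat \<Rightarrow> 'a \<Rightarrow> ennreal" where "pot j x = (\<integral>\<^sup>+y. k (x, y) \<partial>lam j)"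

text \<open>The summand of index \<open>j\<close> in the potential is \<open>plus_term j - minus_term j\<close>, a difference of nonnegative
lower semicontinuous functions: for an index of the other sign the shift \<open>c\<close> of the kernel changes
sides.\<close>

definition plus_term :: "nat \<Rightarrow> 'a \<Rightarrow> ennreal" where "plus_term j x = (if same j then pot j x else ennreal (c * mass j))"
definition minus_term :: "nat \<Rightarrow> 'a \<Rightarrow> ennreal" where "minus_term j x = (if same j then ennreal (c * mass j) else pot j x)"

definition plus_sum :: "'a \<Rightarrow> ennreal" where "plus_sum x = (\<integral>\<^sup>+j. plus_term j x \<partial>count_space I)"
definition minus_sum :: "'a \<Rightarrow> ennreal" where "minus_sum x = (\<integral>\<^sup>+j. minus_term j x \<partial>count_space I)"

lemma lsc_pot': "j \<in> I \<Longrightarrow> lsc (pot j)"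
  using lsc_pot[OF finite_lam] unfolding pot_def by blast

lemma lsc_plus_term: "j \<in> I \<Longrightarrow> lsc (plus_term j)" and lsc_minus_term: "j \<in> I \<Longrightarrow> lsc (minus_term j)"
  using lsc_pot' by (cases "same j"; simp add: plus_term_def[abs_def] minus_term_def[abs_def])+

lemma lsc_plus_sum: "lsc plus_sum" and lsc_minus_sum: "lsc minus_sum"
  unfolding plus_sum_def[abs_def] minus_sum_def[abs_def]
  by (intro lsc_count_space_sum lsc_plus_term lsc_minus_term; assumption)+

lemma sum_const_mass:
  assumes "0 \<le> b" shows "(\<integral>\<^sup>+j. ennreal (b * mass j) \<partial>count_space I) < \<infinity>"
proof -
  have "(\<integral>\<^sup>+j. ennreal (b * mass j) \<partial>count_space I) = (\<integral>\<^sup>+j. ennreal b * emeasure (lam j) UNIV \<partial>count_space I)"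
    by (rule nn_integral_cong) (simp add: emeasure_lam ennreal_mult assms mass_nonneg)
  also have "\<dots> = ennreal b * (\<integral>\<^sup>+j. emeasure (lam j) UNIV \<partial>count_space I)"
    by (rule nn_integral_cmult) simp
  also have "\<dots> < \<infinity>" using mass_summable by (simp add: ennreal_mult_less_top)
  finally show ?thesis .
qed

lemma sign_mult:
  "idx_sign Iplus i * idx_sign Iplus j * e = (if same j then e else - e)"
  by (auto simp: idx_sign_def)

lemma potential_term:
  assumes j: "j \<in> I"
  shows "idx_sign Iplus i * idx_sign Iplus j * potential \<kappa> x (lam j) = enn2ereal (plus_term j x) - enn2ereal (minus_term j x)"
  unfolding sign_mult potential_eq[OF finite_lam[OF j]] plus_term_def minus_term_def pot_def mass_def
  using shift_nonneg by (cases "\<integral>\<^sup>+y. k (x, y) \<partial>lam j") (auto simp: mult_nonneg_nonneg)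

lemma vector_potential_eq:
  assumes "minus_sum x < \<infinity>"
  shows "vector_potential \<kappa> Iplus Iminus lam i x = enn2ereal (plus_sum x) - enn2ereal (minus_sum x)"
  unfolding vector_potential_def plus_sum_def minus_sum_def
  by (rule eint_eq_diff) (use assms in \<open>auto simp: AE_count_space potential_term minus_sum_def\<close>)

text \<open>On a compact part \<open>D\<close> of \<open>A i\<close> the kernel is at most a constant \<open>C\<close> against the components of the
other sign.  There \<open>(C - \<kappa>) + k = C + c\<close>, so the potentials of \<open>C - \<kappa>\<close>, which are lower
semicontinuous because \<open>\<kappa>\<close> is continuous on \<open>D \<times> A j\<close>, complement the subtracted part of \<open>W\<close> to a
finite constant.  In particular this part is bounded on \<open>D\<close>, and minus it is lower semicontinuous
there.\<close>

lemma minus_sum_complement: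
  assumes D: "compact D" "D \<subseteq> A i"
  obtains h T where "lsc h" "T < top" "\<And>x. x \<in> D \<Longrightarrow> h x + minus_sum x = T"
proof -
  obtain C where C: "0 \<le> C" "\<And>j x y. j \<in> I \<Longrightarrow> \<not> same j \<Longrightarrow> x \<in> D \<Longrightarrow> y \<in> A j \<Longrightarrow> \<kappa> (x, y) \<le> ereal C"
    using opp_bound[OF D] by blast
  define k' where "k' j z = (if z \<in> D \<times> A j then e2ennreal (ereal C - \<kappa> z) else top)" for j z
  have k': "lsc (k' j)" if j: "j \<in> I" "\<not> same j" for j
    unfolding k'_def[abs_def]
  proof (rule lsc_extend_top)
    show "closed (D \<times> A j)" using D closed_A[OF j(1)] by (simp add: closed_Times compact_imp_closed)
    show "continuous_on (D \<times> A j) \<kappa>"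
      by (rule continuous_on_subset[OF opp_cont[OF j]]) (use D in auto)
  qed (use C(2) j in auto)
  define hh where "hh j x = (if same j then 0 else \<integral>\<^sup>+y. k' j (x, y) \<partial>lam j)" for j x
  have hh: "lsc (hh j)" if j: "j \<in> I" for j
    using lsc_nn_integral[OF k' finite_lam[OF j]] j by (cases "same j") (auto simp: hh_def[abs_def])
  define tt where "tt j = (if same j then ennreal (c * mass j) else ennreal ((C + c) * mass j))" for j
  show ?thesis
  proof (rule that)
    show "lsc (\<lambda>x. \<integral>\<^sup>+j. hh j x \<partial>count_space I)" by (rule lsc_count_space_sum[OF hh])
    have "(\<integral>\<^sup>+j. tt j \<partial>count_space I) \<le> (\<integral>\<^sup>+j. ennreal ((C + c) * mass j) \<partial>count_space I)"
      using C(1) shift_nonneg mass_nonneg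
      by (intro nn_integral_mono) (auto simp: tt_def intro!: ennreal_leI mult_right_mono)
    then show "(\<integral>\<^sup>+j. tt j \<partial>count_space I) < top"
      using sum_const_mass[of "C + c"] C(1) shift_nonneg by (auto intro: le_less_trans)
    fix x assume x: "x \<in> D"
    have "hh j x + minus_term j x = tt j" if j: "j \<in> I" for j
    proof (cases "same j")
      case False
      have sets: "sets (lam j) = sets borel" by (rule finite_radon_sets[OF finite_lam[OF j]])
      have "pot j x + (\<integral>\<^sup>+y. k' j (x, y) \<partial>lam j) = (\<integral>\<^sup>+y. k (x, y) + k' j (x, y) \<partial>lam j)"
        unfolding pot_def
        using measurable_compose[OF Pair_borel lsc_borel[OF k'[OF j False]]]
        by (intro nn_integral_add[symmetric] borel_measurable_sets_eq[OF sets] k_section_borel) auto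
      also have "\<dots> = (\<integral>\<^sup>+y. ennreal (C + c) \<partial>lam j)"
      proof (rule nn_integral_cong_AE)
        have "emeasure (lam j) (- A j) = 0"
          using lam_radon_on[OF j] msupport_subset_iff[OF _ closed_A[OF j]] by (auto simp: radon_on_def)
        then have "AE y in lam j. y \<in> A j"
          using closed_A[OF j] finite_radon_space[OF finite_lam[OF j]] sets
          by (intro AE_I[of _ _ "- A j"]) auto
        then show "AE y in lam j. k (x, y) + k' j (x, y) = ennreal (C + c)"
        proof eventually_elim
          case (elim y)
          have "\<kappa> (x, y) \<le> ereal C" using C(2)[OF j False x elim] .
          then show ?case using x elim C(1) shift_nonneg
            by (cases "k (x, y)") (auto simp: k'_def kernel_eq ennreal_plus[symmetric] simp del: ennreal_plus)
        qed
      qed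
      also have "\<dots> = ennreal ((C + c) * mass j)"
        using emeasure_lam[OF j] finite_radon_space[OF finite_lam[OF j]] C(1) shift_nonneg mass_nonneg
        by (simp add: ennreal_mult)
      finally show ?thesis using False by (simp add: hh_def minus_term_def tt_def add.commute)
    qed (simp add: hh_def minus_term_def tt_def)
    then have "(\<integral>\<^sup>+j. tt j \<partial>count_space I) = (\<integral>\<^sup>+j. hh j x + minus_term j x \<partial>count_space I)"
      by (intro nn_integral_cong) simp
    also have "\<dots> = (\<integral>\<^sup>+j. hh j x \<partial>count_space I) + minus_sum x"
      unfolding minus_sum_def by (rule nn_integral_add) auto
    finally show "(\<integral>\<^sup>+j. hh j x \<partial>count_space I) + minus_sum x = (\<integral>\<^sup>+j. tt j \<partial>count_space I)" by simp
  qed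
qed

definition W_plus :: "'a \<Rightarrow> ennreal" where "W_plus x = plus_sum x + F x"
definition W_minus :: "'a \<Rightarrow> ennreal" where "W_minus x = minus_sum x + ennreal d"

abbreviation W :: "'a \<Rightarrow> ereal" where "W \<equiv> weighted_potential \<kappa> Iplus Iminus f lam i"

lemma lsc_W_plus: "lsc W_plus" and lsc_W_minus: "lsc W_minus"
  unfolding W_plus_def[abs_def] W_minus_def[abs_def] by (intro lsc_add lsc_plus_sum lsc_minus_sum F lsc_const)+

lemma W_minus_finite: assumes "x \<in> A i" shows "W_minus x < top"
proof -
  have D: "compact {x}" "{x} \<subseteq> A i" using assms by auto
  obtain h T where hT: "T < top" "\<And>y. y \<in> {x} \<Longrightarrow> h y + minus_sum y = T"
    by (rule minus_sum_complement[OF D]) blast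
  have "minus_sum x \<le> h x + minus_sum x" by simp
  also have "\<dots> < top" using hT by simp
  finally have "minus_sum x < top" .
  then show ?thesis by (simp add: W_minus_def)
qed

lemma W_eq: assumes "x \<in> A i" shows "W x = enn2ereal (W_plus x) - enn2ereal (W_minus x)"
proof -
  have "minus_sum x < top" using W_minus_finite[OF assms] by (simp add: W_minus_def)
  then obtain q where q: "minus_sum x = ennreal q" "0 \<le> q" by (cases "minus_sum x") auto
  have "W x = enn2ereal (plus_sum x) - enn2ereal (minus_sum x) + (enn2ereal (F x) - ereal d)"
    unfolding weighted_potential_def using vector_potential_eq[of x] \<open>minus_sum x < top\<close> f_eq by simp
  also have "\<dots> = enn2ereal (W_plus x) - enn2ereal (W_minus x)"
    using q d by (cases "plus_sum x"; cases "F x") (auto simp: W_plus_def W_minus_def ennreal_plus[symmetric] simp del: ennreal_plus)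
  finally show ?thesis .
qed

text \<open>On a compact neighbourhood \<open>W = W_plus + h - (T + d)\<close> with \<open>h\<close> and \<open>T\<close> from \<open>minus_sum_complement\<close>: a
lower semicontinuous function minus a finite constant.\<close>

lemma W_lsc:
  assumes x0: "x0 \<in> A i" and t: "ereal t < W x0"
  obtains U where "open U" "x0 \<in> U" "\<And>x. x \<in> U \<Longrightarrow> x \<in> A i \<Longrightarrow> ereal t < W x"
proof -
  obtain V K where VK: "open V" "x0 \<in> V" "compact K" "V \<subseteq> K" using loc_compact by blast
  have D: "compact (K \<inter> A i)" "K \<inter> A i \<subseteq> A i" using VK closed_A[OF i] by (auto intro: compact_Int_closed)
  obtain h T where hT: "lsc h" "T < top" "\<And>x. x \<in> K \<inter> A i \<Longrightarrow> h x + minus_sum x = T"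
    by (rule minus_sum_complement[OF D]) blast
  obtain T' where T': "T = ennreal T'" "0 \<le> T'" using hT(2) by (cases T) auto
  have eq: "ereal t < W x \<longleftrightarrow> ereal (t + T' + d) < enn2ereal (W_plus x + h x)" if x: "x \<in> K \<inter> A i" for x
  proof -
    have s: "h x + minus_sum x = ennreal T'" using hT(3)[OF x] T' by simp
    then obtain v w where vw: "h x = ennreal v" "0 \<le> v" "minus_sum x = ennreal w" "0 \<le> w"
      by (cases "h x"; cases "minus_sum x") auto
    have "v + w = T'" using s vw T' by (simp add: ennreal_plus[symmetric] del: ennreal_plus)
    moreover have "W_minus x = ennreal (w + d)" using vw d by (simp add: W_minus_def)
    ultimately show ?thesis
      using x vw d by (cases "W_plus x") (auto simp: W_eq ennreal_plus[symmetric] simp del: ennreal_plus)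
  qed
  have el: "lsc (\<lambda>x. W_plus x + h x)" by (rule lsc_add[OF lsc_W_plus hT(1)])
  have "ereal (t + T' + d) < enn2ereal (W_plus x0 + h x0)" using eq[of x0] t x0 VK by auto
  then obtain U where U: "open U" "x0 \<in> U" "\<And>y. y \<in> U \<Longrightarrow> ereal (t + T' + d) < enn2ereal (W_plus y + h y)"
    by (rule lsc_enn2ereal_nbhd[OF el]) blast
  show ?thesis
  proof (rule that[of "U \<inter> V"])
    fix x assume x: "x \<in> U \<inter> V" "x \<in> A i"
    then have "x \<in> K \<inter> A i" using VK by auto
    then show "ereal t < W x" using eq U(3) x by blast
  qed (use U VK in auto)
qed

lemma cross_term:
  assumes \<nu>: "finite_radon \<nu>" and j: "j \<in> I"
  shows "idx_sign Iplus i * idx_sign Iplus j * mutual_energy \<kappa> \<nu> (lam j) =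
    enn2ereal (\<integral>\<^sup>+x. plus_term j x \<partial>\<nu>) - enn2ereal (\<integral>\<^sup>+x. minus_term j x \<partial>\<nu>)"
proof -
  have "(\<integral>\<^sup>+x. ennreal (c * mass j) \<partial>\<nu>) = ennreal (c * (measure \<nu> UNIV * mass j))"
    using emeasure_eq_measure_radon[OF \<nu>, of UNIV] finite_radon_space[OF \<nu>] shift_nonneg mass_nonneg[of j]
    by (simp add: ennreal_mult[symmetric] mult_ac)
  moreover have "(\<integral>\<^sup>+x. pot j x \<partial>\<nu>) = energy \<nu> (lam j)" by (simp add: energy_def pot_def)
  ultimately show ?thesis
    unfolding sign_mult mutual_energy_eq[OF \<nu> finite_lam[OF j]] mass_def[symmetric]
    using shift_nonneg mass_nonneg[of j] by (cases "energy \<nu> (lam j)") (auto simp: plus_term_def minus_term_def mult_nonneg_nonneg)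
qed

lemma integral_plus_minus_sum:
  assumes \<nu>: "finite_radon \<nu>"
  shows "(\<integral>\<^sup>+x. plus_sum x \<partial>\<nu>) = (\<integral>\<^sup>+j. \<integral>\<^sup>+x. plus_term j x \<partial>\<nu> \<partial>count_space I)"
    and "(\<integral>\<^sup>+x. minus_sum x \<partial>\<nu>) = (\<integral>\<^sup>+j. \<integral>\<^sup>+x. minus_term j x \<partial>\<nu> \<partial>count_space I)"
  unfolding plus_sum_def minus_sum_def
  by (intro nn_integral_sum_swap borel_measurable_sets_eq[OF finite_radon_sets[OF \<nu>]] lsc_borel lsc_plus_term lsc_minus_term; assumption)+

lemma integral_W_plus_minus:
  assumes \<nu>: "finite_radon \<nu>"
  shows "(\<integral>\<^sup>+x. W_plus x \<partial>\<nu>) = (\<integral>\<^sup>+x. plus_sum x \<partial>\<nu>) + (\<integral>\<^sup>+x. F x \<partial>\<nu>)"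
    and "(\<integral>\<^sup>+x. W_minus x \<partial>\<nu>) = (\<integral>\<^sup>+x. minus_sum x \<partial>\<nu>) + ennreal (d * measure \<nu> UNIV)"
proof -
  note bm = borel_measurable_sets_eq[OF finite_radon_sets[OF \<nu>]]
  show "(\<integral>\<^sup>+x. W_plus x \<partial>\<nu>) = (\<integral>\<^sup>+x. plus_sum x \<partial>\<nu>) + (\<integral>\<^sup>+x. F x \<partial>\<nu>)"
    unfolding W_plus_def by (intro nn_integral_add bm lsc_borel lsc_plus_sum F)
  have "(\<integral>\<^sup>+x. W_minus x \<partial>\<nu>) = (\<integral>\<^sup>+x. minus_sum x \<partial>\<nu>) + (\<integral>\<^sup>+x. ennreal d \<partial>\<nu>)"
    unfolding W_minus_def by (intro nn_integral_add bm lsc_borel lsc_minus_sum lsc_const)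
  then show "(\<integral>\<^sup>+x. W_minus x \<partial>\<nu>) = (\<integral>\<^sup>+x. minus_sum x \<partial>\<nu>) + ennreal (d * measure \<nu> UNIV)"
    using emeasure_eq_measure_radon[OF \<nu>, of UNIV] finite_radon_space[OF \<nu>] d by (simp add: ennreal_mult)
qed

text \<open>Integrating the weighted potential against \<open>\<nu>\<close> and summing over the components may be interchanged
since the two nonnegative parts have finite integrals.  This identifies the two sides of
\<open>variational_inequality\<close> as integrals of \<open>W\<close>.\<close>

lemma eint_W:
  assumes \<nu>: "finite_radon \<nu>" and null: "emeasure \<nu> (- A i) = 0"
    and W_plus: "(\<integral>\<^sup>+x. W_plus x \<partial>\<nu>) < \<infinity>" and W_minus: "(\<integral>\<^sup>+x. W_minus x \<partial>\<nu>) < \<infinity>"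
  shows "\<bar>cross i \<nu>\<bar> \<noteq> \<infinity>" "\<bar>eint \<nu> (f i)\<bar> \<noteq> \<infinity>" "eint \<nu> W = cross i \<nu> + eint \<nu> (f i)"
    and "\<bar>eint \<nu> (\<lambda>x. enn2ereal (W_plus x) - enn2ereal (W_minus x))\<bar> \<noteq> \<infinity>"
    and "eint \<nu> W = eint \<nu> (\<lambda>x. enn2ereal (W_plus x) - enn2ereal (W_minus x))"
proof -
  note bm = borel_measurable_sets_eq[OF finite_radon_sets[OF \<nu>]]
  obtain p where p: "(\<integral>\<^sup>+x. plus_sum x \<partial>\<nu>) = ennreal p" "0 \<le> p" using W_plus integral_W_plus_minus(1)[OF \<nu>] by (cases "\<integral>\<^sup>+x. plus_sum x \<partial>\<nu>") auto
  obtain v where v: "(\<integral>\<^sup>+x. F x \<partial>\<nu>) = ennreal v" "0 \<le> v" using W_plus integral_W_plus_minus(1)[OF \<nu>] by (cases "\<integral>\<^sup>+x. F x \<partial>\<nu>") auto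
  obtain q where q: "(\<integral>\<^sup>+x. minus_sum x \<partial>\<nu>) = ennreal q" "0 \<le> q" using W_minus integral_W_plus_minus(2)[OF \<nu>] by (cases "\<integral>\<^sup>+x. minus_sum x \<partial>\<nu>") auto
  have cr: "cross i \<nu> = ereal (p - q)"
  proof -
    have "cross i \<nu> = enn2ereal (\<integral>\<^sup>+x. plus_sum x \<partial>\<nu>) - enn2ereal (\<integral>\<^sup>+x. minus_sum x \<partial>\<nu>)"
      unfolding cross_def integral_plus_minus_sum[OF \<nu>]
      by (rule eint_eq_diff) (use q in \<open>auto simp: AE_count_space cross_term[OF \<nu>] integral_plus_minus_sum[OF \<nu>, symmetric]\<close>)
    then show ?thesis using p q by simp
  qed
  have fi: "eint \<nu> (f i) = ereal (v - d * measure \<nu> UNIV)"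
    using eint_shifted[OF \<nu> lsc_borel[OF F] d f_eq] v by simp
  have AE: "AE x in \<nu>. x \<in> A i"
    using closed_A[OF i] null finite_radon_sets[OF \<nu>] finite_radon_space[OF \<nu>]
    by (intro AE_I[of _ _ "- A i"]) auto
  have "eint \<nu> (\<lambda>x. enn2ereal (W_plus x) - enn2ereal (W_minus x)) = enn2ereal (\<integral>\<^sup>+x. W_plus x \<partial>\<nu>) - enn2ereal (\<integral>\<^sup>+x. W_minus x \<partial>\<nu>)"
    by (intro eint_eq_diff bm lsc_borel lsc_W_plus lsc_W_minus W_minus) auto
  also have "\<dots> = ereal (p + v - (q + d * measure \<nu> UNIV))"
    unfolding integral_W_plus_minus[OF \<nu>] p(1) v(1) q(1) using p v q d
    by (simp add: ennreal_plus[symmetric] del: ennreal_plus)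
  finally have e: "eint \<nu> (\<lambda>x. enn2ereal (W_plus x) - enn2ereal (W_minus x)) = ereal (p + v - (q + d * measure \<nu> UNIV))" .
  show eq: "eint \<nu> W = eint \<nu> (\<lambda>x. enn2ereal (W_plus x) - enn2ereal (W_minus x))"
    by (rule eint_cong_AE) (use AE W_eq in auto)
  show "\<bar>cross i \<nu>\<bar> \<noteq> \<infinity>" "\<bar>eint \<nu> (f i)\<bar> \<noteq> \<infinity>" "\<bar>eint \<nu> (\<lambda>x. enn2ereal (W_plus x) - enn2ereal (W_minus x))\<bar> \<noteq> \<infinity>"
    by (simp_all add: cr fi e)
  show "eint \<nu> W = cross i \<nu> + eint \<nu> (f i)" unfolding eq e cr fi by simp
qed

lemma lam_null: "emeasure (lam i) (- A i) = 0"
  using lam_radon_on[OF i] msupport_subset_iff[OF _ closed_A[OF i]] by (auto simp: radon_on_def)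

text \<open>In each summand of \<open>cross i (lam i)\<close> one of the two nonnegative parts is the integral of a constant,
so both parts are bounded by the absolute value of the summand plus this constant.  The former are
summable because the energy of \<open>lam\<close> is finite, the latter because the total masses are summable.\<close>

lemma lam_W_plus_minus_finite: "(\<integral>\<^sup>+x. W_plus x \<partial>lam i) < \<infinity>" "(\<integral>\<^sup>+x. W_minus x \<partial>lam i) < \<infinity>"
proof -
  note \<nu> = finite_lam[OF i]
  let ?t = "\<lambda>j. idx_sign Iplus i * idx_sign Iplus j * mutual_energy \<kappa> (lam i) (lam j)"
  have t: "(\<integral>\<^sup>+j. e2ennreal (?t j) \<partial>count_space I) < \<infinity>" "(\<integral>\<^sup>+j. e2ennreal (- ?t j) \<partial>count_space I) < \<infinity>"
    using eint_finiteD(1,2)[of ?t "count_space I"] cross_lam[OF i] by (auto simp: cross_def)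
  have cm: "(\<integral>\<^sup>+x. ennreal (c * mass j) \<partial>lam i) = ennreal (c * mass i * mass j)" if "j \<in> I" for j
    using emeasure_lam[OF i] finite_radon_space[OF \<nu>] shift_nonneg mass_nonneg
    by (simp add: ennreal_mult[symmetric] mult_ac)
  have real: "ennreal r \<le> ennreal (r - b) + ennreal b" if "0 \<le> b" for r b :: real
    using that by (cases "b \<le> r") (auto simp: ennreal_neg ennreal_leI simp flip: ennreal_plus)
  have pt: "x \<le> e2ennreal (enn2ereal x - enn2ereal y) + ennreal b \<and> y \<le> e2ennreal (- (enn2ereal x - enn2ereal y)) + ennreal b"
    if "x = ennreal b \<or> y = ennreal b" "0 \<le> b" for x y b
    using that real by (cases x; cases y) (auto simp: e2ennreal_neg)
  have bd: "(\<integral>\<^sup>+x. plus_term j x \<partial>lam i) \<le> e2ennreal (?t j) + ennreal (c * mass i * mass j)"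
     "(\<integral>\<^sup>+x. minus_term j x \<partial>lam i) \<le> e2ennreal (- ?t j) + ennreal (c * mass i * mass j)" if j: "j \<in> I" for j
  proof -
    have "(\<integral>\<^sup>+x. plus_term j x \<partial>lam i) = ennreal (c * mass i * mass j) \<or> (\<integral>\<^sup>+x. minus_term j x \<partial>lam i) = ennreal (c * mass i * mass j)"
      using cm[OF j] by (cases "same j") (simp_all add: plus_term_def minus_term_def)
    note * = pt[OF this, folded cross_term[OF \<nu> j]]
    have "0 \<le> c * mass i * mass j" using shift_nonneg mass_nonneg by simp
    from *[OF this] show "(\<integral>\<^sup>+x. plus_term j x \<partial>lam i) \<le> e2ennreal (?t j) + ennreal (c * mass i * mass j)"
      "(\<integral>\<^sup>+x. minus_term j x \<partial>lam i) \<le> e2ennreal (- ?t j) + ennreal (c * mass i * mass j)" by blast+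
  qed
  have s: "(\<integral>\<^sup>+j. ennreal (c * mass i * mass j) \<partial>count_space I) < \<infinity>"
    using sum_const_mass[of "c * mass i"] shift_nonneg mass_nonneg by simp
  have PPf: "(\<integral>\<^sup>+x. plus_sum x \<partial>lam i) < \<infinity>"
  proof -
    have "(\<integral>\<^sup>+x. plus_sum x \<partial>lam i) \<le> (\<integral>\<^sup>+j. e2ennreal (?t j) + ennreal (c * mass i * mass j) \<partial>count_space I)"
      unfolding integral_plus_minus_sum[OF \<nu>] by (rule nn_integral_mono) (use bd in auto)
    also have "\<dots> = (\<integral>\<^sup>+j. e2ennreal (?t j) \<partial>count_space I) + (\<integral>\<^sup>+j. ennreal (c * mass i * mass j) \<partial>count_space I)"
      by (rule nn_integral_add) auto
    also have "\<dots> < \<infinity>" using t s by simp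
    finally show ?thesis .
  qed
  have QQf: "(\<integral>\<^sup>+x. minus_sum x \<partial>lam i) < \<infinity>"
  proof -
    have "(\<integral>\<^sup>+x. minus_sum x \<partial>lam i) \<le> (\<integral>\<^sup>+j. e2ennreal (- ?t j) + ennreal (c * mass i * mass j) \<partial>count_space I)"
      unfolding integral_plus_minus_sum[OF \<nu>] by (rule nn_integral_mono) (use bd in auto)
    also have "\<dots> = (\<integral>\<^sup>+j. e2ennreal (- ?t j) \<partial>count_space I) + (\<integral>\<^sup>+j. ennreal (c * mass i * mass j) \<partial>count_space I)"
      by (rule nn_integral_add) auto
    also have "\<dots> < \<infinity>" using t s by simp
    finally show ?thesis .
  qed
  have "(\<integral>\<^sup>+x. F x \<partial>lam i) < \<infinity>"
    using field_lam[OF i] eint_shifted[OF \<nu> lsc_borel[OF F] d f_eq] by (cases "\<integral>\<^sup>+x. F x \<partial>lam i") auto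
  then show "(\<integral>\<^sup>+x. W_plus x \<partial>lam i) < \<infinity>" "(\<integral>\<^sup>+x. W_minus x \<partial>lam i) < \<infinity>"
    using PPf QQf by (simp_all add: integral_W_plus_minus[OF \<nu>])
qed

end

section \<open>Comparison of the weighted potential with its level\<close>

context potential_setup begin

text \<open>Agrees with \<open>W\<close> on \<open>A i\<close>, and is a difference of two lower semicontinuous functions, hence a Borel
function, on the whole space.\<close>

definition W_borel :: "'a \<Rightarrow> ereal" where "W_borel x = enn2ereal (W_plus x) - enn2ereal (W_minus x)"
definition W_real :: "'a \<Rightarrow> real" where "W_real x = real_of_ereal (W_borel x)"
definition g_ext :: "'a \<Rightarrow> real" where "g_ext x = indicator (A i) x *\<^sub>R g i x"
definition level :: real where "level = real_of_ereal (eint (lam i) W)"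

lemma W_borel_measurable: "W_borel \<in> borel_measurable borel"
  unfolding W_borel_def[abs_def] using lsc_borel[OF lsc_W_plus] lsc_borel[OF lsc_W_minus] by measurable

lemma g_ext_borel: "g_ext \<in> borel_measurable borel"
  unfolding g_ext_def[abs_def]
  using closed_A[OF i] cont_g[OF i] by (intro borel_measurable_continuous_on_indicator) auto

lemma g_ext_nonneg: "0 \<le> g_ext x"
  using pos_g[OF i, of x] by (auto simp: g_ext_def indicator_def intro: less_imp_le)

lemma g_ext_integral:
  assumes \<nu>: "finite_radon \<nu>" and b: "(\<integral>\<^sup>+x\<in>A i. ennreal (g i x) \<partial>\<nu>) = ennreal b" "0 \<le> b"
  shows "integrable \<nu> g_ext" "(\<integral>x. g_ext x \<partial>\<nu>) = b"
proof -
  have m: "g_ext \<in> borel_measurable \<nu>" by (rule borel_measurable_sets_eq[OF finite_radon_sets[OF \<nu>] g_ext_borel])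
  have "(\<integral>\<^sup>+x. ennreal (g_ext x) \<partial>\<nu>) = (\<integral>\<^sup>+x\<in>A i. ennreal (g i x) \<partial>\<nu>)"
    by (intro nn_integral_cong) (auto simp: g_ext_def indicator_def)
  then have e: "(\<integral>\<^sup>+x. ennreal (g_ext x) \<partial>\<nu>) = ennreal b" using b by simp
  then show "integrable \<nu> g_ext" using m g_ext_nonneg by (intro integrableI_nonneg) auto
  show "(\<integral>x. g_ext x \<partial>\<nu>) = b"
    using e b g_ext_nonneg by (subst integral_eq_nn_integral[OF m]) auto
qed

lemma W_real_integral:
  assumes \<nu>: "finite_radon \<nu>" and null: "emeasure \<nu> (- A i) = 0"
    and W_plus: "(\<integral>\<^sup>+x. W_plus x \<partial>\<nu>) < \<infinity>" and W_minus: "(\<integral>\<^sup>+x. W_minus x \<partial>\<nu>) < \<infinity>"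
  shows "integrable \<nu> W_real" "eint \<nu> W = ereal (\<integral>x. W_real x \<partial>\<nu>)" "AE x in \<nu>. x \<in> A i \<and> W x = ereal (W_real x)"
proof -
  note eW = eint_W[OF \<nu> null W_plus W_minus]
  have m: "W_borel \<in> borel_measurable \<nu>" by (rule borel_measurable_sets_eq[OF finite_radon_sets[OF \<nu>] W_borel_measurable])
  have fin: "\<bar>eint \<nu> W_borel\<bar> \<noteq> \<infinity>" using eW(4) by (simp add: W_borel_def[abs_def])
  have ae: "AE x in \<nu>. W_borel x = ereal (W_real x)" using eint_finiteD(3)[OF m fin] by (simp add: W_real_def)
  show int: "integrable \<nu> W_real" using eint_finiteD(4)[OF m fin] by (simp add: W_real_def[abs_def])
  have "eint \<nu> W_borel = ereal (\<integral>x. W_real x \<partial>\<nu>)" by (rule eint_integrable[OF int ae])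
  then show "eint \<nu> W = ereal (\<integral>x. W_real x \<partial>\<nu>)" using eW(5) by (simp add: W_borel_def[abs_def])
  have "AE x in \<nu>. x \<in> A i"
    using closed_A[OF i] null finite_radon_sets[OF \<nu>] finite_radon_space[OF \<nu>]
    by (intro AE_I[of _ _ "- A i"]) auto
  then show "AE x in \<nu>. x \<in> A i \<and> W x = ereal (W_real x)"
    using ae by eventually_elim (auto simp: W_eq W_borel_def)
qed

lemma level_eq: "eint (lam i) W = ereal level"
  using W_real_integral(2)[OF finite_lam[OF i] lam_null lam_W_plus_minus_finite] by (simp add: level_def)

lemma variational_W:
  assumes \<nu>: "finite_radon \<nu>" and null: "emeasure \<nu> (- A i) = 0"
    and mass: "(\<integral>\<^sup>+x\<in>A i. ennreal (g i x) \<partial>\<nu>) = ennreal (a i)"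
    and en: "\<bar>mutual_energy \<kappa> \<nu> \<nu>\<bar> \<noteq> \<infinity>"
    and W_plus: "(\<integral>\<^sup>+x. W_plus x \<partial>\<nu>) < \<infinity>" and W_minus: "(\<integral>\<^sup>+x. W_minus x \<partial>\<nu>) < \<infinity>"
  shows "ereal level \<le> eint \<nu> W"
proof -
  have supp: "msupport \<nu> \<subseteq> A i"
    using null msupport_subset_iff[OF finite_radon_radon[OF \<nu>] closed_A[OF i]] by simp
  have "cross i (lam i) + eint (lam i) (f i) \<le> cross i \<nu> + eint \<nu> (f i)"
    by (rule variational_inequality[OF i \<nu> supp mass en eint_W(1,2)[OF \<nu> null W_plus W_minus]])
  then show ?thesis
    using eint_W(3)[OF \<nu> null W_plus W_minus] eint_W(3)[OF finite_lam[OF i] lam_null lam_W_plus_minus_finite] level_eq by simp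
qed

definition sublevel :: "'a set" where "sublevel = {x \<in> A i. ereal (a i) * W x < ereal level * ereal (g i x)}"

text \<open>On the compact support of \<open>\<nu>\<close> the subtracted part of \<open>W\<close> is bounded, and since \<open>W\<close> lies below a
multiple of \<open>g i\<close> there, the other part is bounded as well.  So \<open>\<nu>\<close>, scaled so that the integral of
\<open>g i\<close> becomes \<open>a i\<close>, is a competitor for the variational inequality, which it violates.\<close>

lemma no_energy_on_sublevel:
  assumes rad: "radon_measure \<nu>" and pos: "0 < emeasure \<nu> UNIV"
    and cpt: "compact (msupport \<nu>)" and sub: "msupport \<nu> \<subseteq> sublevel"
    and en: "\<bar>mutual_energy \<kappa> \<nu> \<nu>\<bar> \<noteq> \<infinity>"
  shows False
proof -
  let ?K = "msupport \<nu>"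
  have sets: "sets \<nu> = sets borel" using rad by (simp add: radon_measure_def)
  have sp: "space \<nu> = UNIV" using sets_eq_imp_space_eq[OF sets] by simp
  have K0: "emeasure \<nu> (- ?K) = 0" by (rule emeasure_compl_msupport[OF rad])
  have Km: "?K \<in> sets borel" using cpt by (rule borel_compact_t2)
  have "emeasure \<nu> UNIV = emeasure \<nu> ?K + emeasure \<nu> (- ?K)"
    using plus_emeasure[of ?K \<nu> "- ?K"] Km sets by simp
  then have UK: "emeasure \<nu> UNIV = emeasure \<nu> ?K" using K0 by simp
  have "emeasure \<nu> ?K < \<infinity>" using rad cpt unfolding radon_measure_def by blast
  then have \<nu>: "finite_radon \<nu>" using rad UK by (simp add: finite_radon_def)
  have KA: "?K \<subseteq> A i" using sub by (auto simp: sublevel_def)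
  have AEK: "AE x in \<nu>. x \<in> ?K"
    using K0 Km sets sp by (intro AE_I[of _ _ "- ?K"]) auto
  obtain B where B: "0 \<le> B" "\<And>x. x \<in> ?K \<Longrightarrow> g i x \<le> B"
  proof -
    have "compact (g i ` ?K)" by (rule compact_continuous_image[OF continuous_on_subset[OF cont_g[OF i] KA] cpt])
    then have "bdd_above (g i ` ?K)" by (intro bounded_imp_bdd_above compact_imp_bounded)
    then obtain B where "\<forall>x\<in>?K. g i x \<le> B" by (auto simp: bdd_above_def)
    then show ?thesis by (intro that[of "max 0 B"]) (auto simp: max.coboundedI2)
  qed
  let ?b = "\<integral>\<^sup>+x\<in>A i. ennreal (g i x) \<partial>\<nu>"
  have "?b \<le> (\<integral>\<^sup>+x. ennreal B \<partial>\<nu>)"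
    by (rule nn_integral_mono_AE) (use AEK B KA in \<open>auto elim!: eventually_mono simp: indicator_def intro!: ennreal_leI\<close>)
  also have "\<dots> < \<infinity>" using finite_radon_emeasure_less_top[OF \<nu>] by (simp add: ennreal_mult_less_top)
  finally have bfin: "?b < \<infinity>" .
  have "?b \<noteq> 0"
  proof
    assume "?b = 0"
    then have "AE x in \<nu>. ennreal (g i x) * indicator (A i) x = 0"
      by (subst (asm) nn_integral_0_iff_AE) (auto intro: borel_measurable_sets_eq[OF sets g_borel[OF i]])
    with AEK have "AE x in \<nu>. False"
    proof eventually_elim
      case (elim x)
      then show ?case using pos_g[OF i, of x] KA by (auto simp: ennreal_eq_0_iff)
    qed
    then show False using pos sp by (simp add: AE_iff_null_sets[symmetric] ae_filter_eq_bot_iff)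
  qed
  then obtain b where b: "?b = ennreal b" "0 < b" using bfin by (cases ?b) (auto simp: ennreal_eq_0_iff not_le)
  define s where "s = a i / b"
  have s: "0 < s" using b pos_a[OF i] by (simp add: s_def)
  define \<nu>' where "\<nu>' = lincomb s \<nu> 0 \<nu>"
  have \<nu>': "finite_radon \<nu>'" unfolding \<nu>'_def by (rule finite_radon_lincomb[OF \<nu> \<nu>])
  have em: "emeasure \<nu>' B = ennreal s * emeasure \<nu> B" if "B \<in> sets borel" for B
    unfolding \<nu>'_def using emeasure_lincomb[OF sets sets that] by simp
  have Kn: "emeasure \<nu>' (- ?K) = 0" using em[of "- ?K"] Km K0 by auto
  have AEK': "AE x in \<nu>'. x \<in> ?K"
    using Kn Km finite_radon_sets[OF \<nu>'] finite_radon_space[OF \<nu>'] by (intro AE_I[of _ _ "- ?K"]) auto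
  have null: "emeasure \<nu>' (- A i) = 0"
  proof -
    have "emeasure \<nu>' (- A i) \<le> emeasure \<nu>' (- ?K)"
      using KA Km finite_radon_sets[OF \<nu>'] by (intro emeasure_mono) auto
    then show ?thesis using Kn by simp
  qed
  have mass: "(\<integral>\<^sup>+x\<in>A i. ennreal (g i x) \<partial>\<nu>') = ennreal (a i)"
  proof -
    have "(\<integral>\<^sup>+x\<in>A i. ennreal (g i x) \<partial>\<nu>') = ennreal s * ennreal b"
      unfolding \<nu>'_def using nn_integral_lincomb[OF sets sets g_borel[OF i], of s 0] b(1) by simp
    also have "\<dots> = ennreal (a i)" using s b by (simp add: s_def ennreal_mult[symmetric])
    finally show ?thesis .
  qed
  have en': "\<bar>mutual_energy \<kappa> \<nu>' \<nu>'\<bar> \<noteq> \<infinity>"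
  proof -
    have "energy \<nu> \<nu> < \<infinity>" using en energy_finite_iff[OF \<nu> \<nu>] by simp
    then have "energy \<nu>' \<nu> < \<infinity>"
      unfolding \<nu>'_def energy_lincomb[OF \<nu> \<nu> \<nu>] by (simp add: ennreal_mult_less_top)
    then have "energy \<nu> \<nu>' < \<infinity>" using energy_sym[OF \<nu> \<nu>'] by simp
    moreover have "energy \<nu>' \<nu>' = ennreal s * energy \<nu> \<nu>' + ennreal 0 * energy \<nu> \<nu>'"
      unfolding \<nu>'_def by (rule energy_lincomb[OF \<nu> \<nu>]) (rule finite_radon_lincomb[OF \<nu> \<nu>])
    ultimately show ?thesis
      using energy_finite_iff[OF \<nu>' \<nu>'] by (simp add: ennreal_mult_less_top)
  qed
  obtain h T where hT: "T < top" "\<And>x. x \<in> ?K \<Longrightarrow> h x + minus_sum x = T"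
    by (rule minus_sum_complement[OF cpt KA]) blast
  obtain T' where T': "T = ennreal T'" "0 \<le> T'" using hT(1) by (cases T) auto
  have QK: "W_minus x \<le> ennreal (T' + d)" if x: "x \<in> ?K" for x
  proof -
    have "minus_sum x \<le> h x + minus_sum x" by simp
    then have "minus_sum x \<le> ennreal T'" using hT(2)[OF x] T' by simp
    then show ?thesis using T' d by (simp add: W_minus_def add_mono)
  qed
  define B1 where "B1 = \<bar>level\<bar> * B / a i + T' + d"
  have PK: "W_plus x \<le> ennreal B1" if x: "x \<in> ?K" for x
  proof -
    have xA: "x \<in> A i" using x KA by auto
    obtain q where q: "W_minus x = ennreal q" "0 \<le> q" "q \<le> T' + d"
      using QK[OF x] T' d by (cases "W_minus x") (auto simp: ennreal_le_iff top_unique simp del: ennreal_plus)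
    have lt: "ereal (a i) * W x < ereal level * ereal (g i x)" using sub x by (auto simp: sublevel_def)
    obtain p where p: "W_plus x = ennreal p" "0 \<le> p"
      using lt q pos_a[OF i] by (cases "W_plus x") (auto simp: W_eq[OF xA])
    have "a i * (p - q) < level * g i x" using lt p q by (simp add: W_eq[OF xA])
    also have "\<dots> \<le> \<bar>level\<bar> * B" using B(2)[OF x] pos_g[OF i xA] by (intro mult_mono) auto
    finally have "p - q < \<bar>level\<bar> * B / a i" using pos_a[OF i] by (simp add: pos_less_divide_eq mult.commute)
    then have "p \<le> B1" using q(3) by (simp add: B1_def)
    then show ?thesis using p by (simp add: ennreal_leI)
  qed
  have fin_const: "(\<integral>\<^sup>+x. ennreal r \<partial>\<nu>') < \<infinity>" for r
    using finite_radon_emeasure_less_top[OF \<nu>'] by (simp add: ennreal_mult_less_top)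
  have Pf: "(\<integral>\<^sup>+x. W_plus x \<partial>\<nu>') < \<infinity>"
    by (rule le_less_trans[OF nn_integral_mono_AE fin_const[of B1]]) (use AEK' PK in \<open>auto elim!: eventually_mono\<close>)
  have Qf: "(\<integral>\<^sup>+x. W_minus x \<partial>\<nu>') < \<infinity>"
    by (rule le_less_trans[OF nn_integral_mono_AE fin_const[of "T' + d"]]) (use AEK' QK in \<open>auto elim!: eventually_mono simp del: ennreal_plus\<close>)
  note Wi = W_real_integral[OF \<nu>' null Pf Qf] and gi = g_ext_integral[OF \<nu>' mass less_imp_le[OF pos_a[OF i]]]
  have "ereal level \<le> eint \<nu>' W" by (rule variational_W[OF \<nu>' null mass en' Pf Qf])
  then have ge: "level \<le> (\<integral>x. W_real x \<partial>\<nu>')" using Wi(2) by simp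
  have "AE x in \<nu>'. a i * W_real x < level * g_ext x"
    using AEK' Wi(3)
  proof eventually_elim
    case (elim x)
    then have "ereal (a i) * ereal (W_real x) < ereal level * ereal (g i x)" using sub by (auto simp: sublevel_def)
    then show ?case using elim by (simp add: g_ext_def)
  qed
  moreover have "emeasure \<nu>' (space \<nu>') \<noteq> 0"
    using em[of UNIV] pos s finite_radon_space[OF \<nu>'] by (auto simp: ennreal_eq_0_iff)
  ultimately have "(\<integral>x. a i * W_real x \<partial>\<nu>') < (\<integral>x. level * g_ext x \<partial>\<nu>')"
    using Wi(1) gi(1) by (intro finite_measure.integral_less_AE_space[OF finite_radon_finite_measure[OF \<nu>']]) auto
  then have "a i * (\<integral>x. W_real x \<partial>\<nu>') < level * a i" using gi by simp
  then show False using ge pos_a[OF i] by (simp add: mult.commute)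
qed

text \<open>If the sublevel set had positive measure, so would a compact subset of it, and the restriction of
\<open>lam i\<close> to that subset would be excluded by \<open>no_energy_on_sublevel\<close>: its energy is finite, being at
most that of \<open>lam i\<close> for the nonnegative kernel \<open>k\<close>.  So \<open>a i * W - level * g i\<close> is nonnegative almost
everywhere; its integral is \<open>a i * level - level * a i = 0\<close>.\<close>

lemma AE_equality: "AE x in lam i. a i * W_real x = level * g_ext x"
proof -
  note \<nu> = finite_lam[OF i]
  note Wi = W_real_integral[OF \<nu> lam_null lam_W_plus_minus_finite] and gi = g_ext_integral[OF \<nu> lam_mass[OF i] less_imp_le[OF pos_a[OF i]]]
  have sets: "sets (lam i) = sets borel" by (rule finite_radon_sets[OF \<nu>])
  have low_eq: "sublevel = A i \<inter> {x \<in> space borel. ereal (a i) * W_borel x < ereal level * ereal (g_ext x)}"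
    by (auto simp: sublevel_def W_eq W_borel_def g_ext_def)
  have "{x \<in> space borel. ereal (a i) * W_borel x < ereal level * ereal (g_ext x)} \<in> sets borel"
    using W_borel_measurable g_ext_borel by measurable
  then have lowm: "sublevel \<in> sets borel" using closed_A[OF i] unfolding low_eq by (intro sets.Int) auto
  have "emeasure (lam i) sublevel = 0"
  proof (rule ccontr)
    assume "emeasure (lam i) sublevel \<noteq> 0"
    then have "0 < emeasure (lam i) sublevel" by (simp add: zero_less_iff_neq_zero)
    then obtain K where K: "compact K" "K \<subseteq> sublevel" "0 < emeasure (lam i) K"
      by (rule radon_compact_approx[OF finite_radon_radon[OF \<nu>] lowm])
    define \<nu>' where "\<nu>' = density (lam i) (indicator K)"
    have Km: "K \<in> sets (lam i)" using borel_compact_t2[OF K(1)] sets by simp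
    have em: "emeasure \<nu>' B = emeasure (lam i) (K \<inter> B)" if "B \<in> sets borel" for B
      unfolding \<nu>'_def using that Km sets by (intro emeasure_restricted) auto
    have \<nu>': "finite_radon \<nu>'" unfolding \<nu>'_def by (rule finite_radon_restrict[OF \<nu> K(1)])
    have "emeasure \<nu>' (- K) = 0" using em[of "- K"] borel_compact_t2[OF K(1)] by auto
    then have sK: "msupport \<nu>' \<subseteq> K"
      using msupport_subset_iff[OF finite_radon_radon[OF \<nu>'] compact_imp_closed[OF K(1)]] by simp
    have cpt: "compact (msupport \<nu>')"
      using closed_Int_compact[OF closed_msupport[of \<nu>'] K(1)] sK by (simp add: Int_absorb2)
    have le: "(\<integral>\<^sup>+x. u x \<partial>\<nu>') \<le> (\<integral>\<^sup>+x. u x \<partial>lam i)" if u: "u \<in> borel_measurable borel" for u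
    proof -
      have "(\<integral>\<^sup>+x. u x \<partial>\<nu>') = (\<integral>\<^sup>+x. indicator K x * u x \<partial>lam i)"
        unfolding \<nu>'_def using Km by (intro nn_integral_density borel_measurable_sets_eq[OF sets u]) auto
      also have "\<dots> \<le> (\<integral>\<^sup>+x. u x \<partial>lam i)" by (intro nn_integral_mono) (auto simp: indicator_def)
      finally show ?thesis .
    qed
    have "energy \<nu>' \<nu>' \<le> energy (lam i) (lam i)"
    proof -
      have "energy \<nu>' \<nu>' \<le> (\<integral>\<^sup>+x. \<integral>\<^sup>+y. k (x, y) \<partial>lam i \<partial>\<nu>')"
        unfolding energy_def by (intro nn_integral_mono le k_section_borel)
      also have "\<dots> \<le> energy (lam i) (lam i)"
        unfolding energy_def by (intro le lsc_borel lsc_pot \<nu>)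
      finally show ?thesis .
    qed
    moreover have "energy (lam i) (lam i) < \<infinity>"
      using energy_finite_iff[OF \<nu> \<nu>] mutual_lam[OF i i] by simp
    ultimately have "\<bar>mutual_energy \<kappa> \<nu>' \<nu>'\<bar> \<noteq> \<infinity>" using energy_finite_iff[OF \<nu>' \<nu>'] by auto
    moreover have "0 < emeasure \<nu>' UNIV" using em[of UNIV] K(3) by simp
    ultimately show False
      using no_energy_on_sublevel[OF finite_radon_radon[OF \<nu>'] _ cpt subset_trans[OF sK K(2)]] by simp
  qed
  then have "AE x in lam i. x \<notin> sublevel"
    using lowm sets by (intro AE_not_in) (auto simp: null_sets_def)
  then have ge: "AE x in lam i. 0 \<le> a i * W_real x - level * g_ext x"
    using Wi(3) by eventually_elim (auto simp: sublevel_def g_ext_def)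
  have "(\<integral>x. a i * W_real x - level * g_ext x \<partial>lam i) = a i * level - level * a i"
    using Wi gi level_eq by simp
  then have "(\<integral>x. a i * W_real x - level * g_ext x \<partial>lam i) = 0" by simp
  then have "AE x in lam i. a i * W_real x - level * g_ext x = 0"
    using ge Wi(1) gi(1) by (subst (asm) integral_nonneg_eq_0_iff_AE) auto
  then show ?thesis by eventually_elim simp
qed

text \<open>By lower semicontinuity of \<open>W\<close> and continuity of \<open>g i\<close> the opposite strict inequality would persist,
relative to \<open>A i\<close>, on a neighbourhood of \<open>x0\<close>.  By \<open>AE_equality\<close> this neighbourhood is null for
\<open>lam i\<close>, which no neighbourhood of a point of the support is.\<close>

lemma upper_bound_on_support:
  assumes x0: "x0 \<in> msupport (lam i)"
  shows "ereal (a i) * W x0 \<le> ereal level * ereal (g i x0)"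
proof (rule ccontr)
  note \<nu> = finite_lam[OF i]
  assume "\<not> ?thesis"
  then have lt: "ereal level * ereal (g i x0) < ereal (a i) * W x0" by simp
  have xA: "x0 \<in> A i" using x0 lam_radon_on[OF i] by (auto simp: radon_on_def)
  have "ereal (level * g i x0 / a i) < W x0"
    using lt pos_a[OF i] by (cases "W x0") (auto simp: pos_divide_less_eq mult.commute)
  then obtain t where t: "level * g i x0 / a i < t" "ereal t < W x0"
    using ereal_dense2[of "ereal (level * g i x0 / a i)" "W x0"] by auto
  obtain U where U: "open U" "x0 \<in> U" "\<And>x. x \<in> U \<Longrightarrow> x \<in> A i \<Longrightarrow> ereal t < W x"
    by (rule W_lsc[OF xA t(2)]) blast
  have "continuous_on (A i) (\<lambda>x. level * g i x / a i)" using cont_g[OF i] pos_a[OF i] by (intro continuous_intros) auto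
  then obtain V where V: "open V" "x0 \<in> V" "\<And>x. x \<in> A i \<Longrightarrow> x \<in> V \<Longrightarrow> level * g i x / a i < t"
    using t(1) xA unfolding continuous_on_topological by (metis lessThan_iff open_lessThan)
  have "AE x in lam i. x \<notin> U \<inter> V"
    using W_real_integral(3)[OF \<nu> lam_null lam_W_plus_minus_finite] AE_equality
  proof eventually_elim
    case (elim x)
    show ?case
    proof
      assume x: "x \<in> U \<inter> V"
      then have "t < W_real x" using U(3)[of x] elim by auto
      moreover have "level * g i x / a i < t" using V(3) x elim by auto
      moreover have "W_real x = level * g i x / a i" using elim pos_a[OF i] by (simp add: g_ext_def field_simps)
      ultimately show False by simp
    qed
  qed
  then have "emeasure (lam i) (U \<inter> V) = 0"
    using AE_iff_null_sets[of "U \<inter> V" "lam i"] U V finite_radon_sets[OF \<nu>] by (auto simp: null_sets_def)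
  moreover have "0 < emeasure (lam i) (U \<inter> V)" using x0 U V by (auto simp: msupport_def)
  ultimately show False by simp
qed

text \<open>The exceptional set lies in the sublevel set, so it carries no measure that competes in the infimum
defining the capacity; the infimum is \<open>\<infinity>\<close>.\<close>

lemma equality_nearly_everywhere:
  "nearly_everywhere \<kappa> (msupport (lam i)) (\<lambda>x. ereal (a i) * W x = ereal level * ereal (g i x))"
proof -
  let ?N = "{x \<in> msupport (lam i). ereal (a i) * W x \<noteq> ereal level * ereal (g i x)}"
  have "?N \<subseteq> sublevel"
    using upper_bound_on_support lam_radon_on[OF i] by (force simp: sublevel_def radon_on_def)
  then have "{\<nu> \<in> finite_energy_pos \<kappa>. emeasure \<nu> UNIV = 1 \<and> compact (msupport \<nu>) \<and> msupport \<nu> \<subseteq> ?N} = {}"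
    using no_energy_on_sublevel by (fastforce simp: finite_energy_pos_def)
  then show ?thesis
    unfolding nearly_everywhere_def capacity_def by (simp only: image_empty Inf_empty) (simp add: top_ereal_def)
qed

end

section \<open>The equilibrium condition\<close>

lemma mass_le_divide_INF:
  fixes M :: "'b::t2_space measure"
  assumes M: "M \<in> radon_on E" and E: "closed E" "E \<noteq> {}"
    and mass: "(\<integral>\<^sup>+x\<in>E. ennreal (g x) \<partial>M) = ennreal b" and b: "0 < b"
  shows "emeasure M UNIV \<le> ennreal b / (INF x\<in>E. ennreal (g x))"
proof -
  let ?n = "INF x\<in>E. ennreal (g x)"
  have sets: "sets M = sets borel" using M by (simp add: radon_on_def radon_measure_def)
  have null: "emeasure M (- E) = 0" using M msupport_subset_iff[OF _ E(1)] by (auto simp: radon_on_def)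
  have "emeasure M UNIV = emeasure M E + emeasure M (- E)"
    using plus_emeasure[of E M "- E"] E sets by simp
  then have U: "emeasure M UNIV = emeasure M E" using null by simp
  show ?thesis
  proof (cases "?n = 0")
    case True then show ?thesis using b by simp
  next
    case False
    obtain x where "x \<in> E" using E by blast
    then have "?n \<le> ennreal (g x)" by (rule INF_lower)
    then have "?n < top" by (rule le_less_trans) simp
    then obtain r where r: "?n = ennreal r" "0 < r" using False by (cases ?n) (auto simp: ennreal_eq_0_iff not_le)
    have "ennreal r * emeasure M E = (\<integral>\<^sup>+x\<in>E. ennreal r \<partial>M)"
      using E sets by (subst nn_integral_cmult_indicator) auto
    also have "\<dots> \<le> (\<integral>\<^sup>+x\<in>E. ennreal (g x) \<partial>M)"
      using r(1) by (intro nn_integral_mono) (auto simp: indicator_def intro: INF_lower simp flip: r(1))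
    finally have le: "ennreal r * emeasure M E \<le> ennreal b" using mass by simp
    have "emeasure M E = emeasure M E * ennreal r / ennreal r"
      using r(2) by (intro mult_divide_eq_ennreal[symmetric]) auto
    also have "\<dots> = ennreal r * emeasure M E / ennreal r" by (simp add: mult.commute)
    also have "\<dots> \<le> ennreal b / ennreal r" by (rule divide_right_mono_ennreal[OF le])
    finally show ?thesis using U r by simp
  qed
qed

theorem theorem7p2:
  fixes \<kappa> :: "'a::t2_space \<times> 'a \<Rightarrow> ereal"
    and Iplus Iminus :: "nat set"
    and A :: "nat \<Rightarrow> 'a set"
    and a :: "nat \<Rightarrow> real"
    and g :: "nat \<Rightarrow> 'a \<Rightarrow> real"
    and f :: "nat \<Rightarrow> 'a \<Rightarrow> ereal"
  assumes X: "locally_compact_space (euclidean :: 'a topology)"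
    and kernel: "kernel \<kappa>" "positive_definite \<kappa>"
    and condenser: "condenser Iplus Iminus A"
    and a: "\<forall>i\<in>Iplus \<union> Iminus. 0 < a i"
    and g: "\<forall>i\<in>Iplus \<union> Iminus. continuous_on (A i) (g i) \<and> (\<forall>x\<in>A i. 0 < g i x)"
    and continuous: "continuous_on ((\<Union>i\<in>Iplus. A i) \<times> (\<Union>j\<in>Iminus. A j)) \<kappa>"
    and sup_plus: "\<forall>K. compact K \<longrightarrow> K \<subseteq> (\<Union>i\<in>Iplus. A i) \<longrightarrow>
      (SUP (x, y)\<in>K \<times> (\<Union>j\<in>Iminus. A j). \<kappa> (x, y)) < \<infinity>"
    and sup_minus: "\<forall>K. compact K \<longrightarrow> K \<subseteq> (\<Union>j\<in>Iminus. A j) \<longrightarrow>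
      (SUP (x, y)\<in>K \<times> (\<Union>i\<in>Iplus. A i). \<kappa> (x, y)) < \<infinity>"
    and f: "\<forall>i\<in>Iplus \<union> Iminus. f i \<in> Phi"
    and summable: "(\<integral>\<^sup>+i. ennreal (a i) / (INF x\<in>A i. ennreal (g i x)) \<partial>count_space (Iplus \<union> Iminus)) < \<infinity>"
  shows "\<forall>lam\<in>equilibrium_measures \<kappa> Iplus Iminus A a g f. \<forall>i\<in>Iplus \<union> Iminus.
    (let W = weighted_potential \<kappa> Iplus Iminus f lam i; c = eint (lam i) W in
      \<bar>c\<bar> \<noteq> \<infinity> \<and>
      (\<forall>x\<in>msupport (lam i). ereal (a i) * W x \<le> c * ereal (g i x)) \<and>
      nearly_everywhere \<kappa> (msupport (lam i)) (\<lambda>x. ereal (a i) * W x = c * ereal (g i x)))"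
proof (intro ballI)
  fix lam i
  assume lam: "lam \<in> equilibrium_measures \<kappa> Iplus Iminus A a g f" and i: "i \<in> Iplus \<union> Iminus"
  let ?I = "Iplus \<union> Iminus"
  have sym: "\<kappa> (x, y) = \<kappa> (y, x)" for x y using kernel(2) by (simp add: positive_definite_def)
  obtain c k where c: "0 \<le> c" and k: "lsc k" and k_eq: "\<And>z. \<kappa> z = enn2ereal (k z) - ereal c"
    using Phi_shift[of \<kappa>] kernel(1) unfolding kernel_def by blast
  obtain d F where d: "0 \<le> d" and F: "lsc F" and F_eq: "\<And>x. f i x = enn2ereal (F x) - ereal d"
    using Phi_shift[of "f i"] f i by blast
  have A: "closed (A j)" "A j \<noteq> {}" if "j \<in> ?I" for j using condenser that by (auto simp: condenser_def)
  have adm: "lam j \<in> radon_on (A j)" "(\<integral>\<^sup>+x\<in>A j. ennreal (g j x) \<partial>lam j) = ennreal (a j)" if "j \<in> ?I" for j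
    using lam that
    by (auto simp: equilibrium_measures_def admissible_def vector_finite_energy_def vector_measures_def)
  have mass: "emeasure (lam j) UNIV \<le> ennreal (a j) / (INF x\<in>A j. ennreal (g j x))" if "j \<in> ?I" for j
    using mass_le_divide_INF[OF adm(1)[OF that] A[OF that] adm(2)[OF that]] a that by blast
  have mass_sum: "(\<integral>\<^sup>+j. emeasure (lam j) UNIV \<partial>count_space ?I) < \<infinity>"
    by (rule le_less_trans[OF nn_integral_mono summable]) (use mass in auto)
  have finite_lam: "finite_radon (lam j)" if j: "j \<in> ?I" for j
  proof -
    have "AE j in count_space ?I. emeasure (lam j) UNIV \<noteq> \<infinity>"
      using mass_sum by (intro nn_integral_PInf_AE) auto
    then have "emeasure (lam j) UNIV < \<infinity>" using j by (simp add: AE_count_space less_top)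
    then show ?thesis using adm(1)[OF j] by (simp add: radon_on_def finite_radon_def)
  qed
  have opp: "i \<in> Iplus \<and> j \<in> Iminus \<or> i \<in> Iminus \<and> j \<in> Iplus"
    if "j \<in> ?I" "(i \<in> Iplus) \<noteq> (j \<in> Iplus)" for j using that i by blast
  have "continuous_on ((\<Union>j\<in>Iminus. A j) \<times> (\<Union>i\<in>Iplus. A i)) (\<kappa> \<circ> prod.swap)"
    unfolding prod.swap_def
    by (intro continuous_on_compose continuous_on_subset[OF continuous] continuous_intros) auto
  moreover have "\<kappa> \<circ> prod.swap = \<kappa>" using sym by (auto simp: fun_eq_iff)
  ultimately have cont': "continuous_on ((\<Union>j\<in>Iminus. A j) \<times> (\<Union>i\<in>Iplus. A i)) \<kappa>" by simp
  have bound: "\<exists>C\<ge>0. \<forall>j\<in>J. \<forall>x\<in>D. \<forall>y\<in>A j. \<kappa> (x, y) \<le> ereal C"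
    if sup: "(SUP (x, y)\<in>D \<times> (\<Union>j\<in>J. A j). \<kappa> (x, y)) < \<infinity>" for D J
  proof -
    obtain C where C: "(SUP (x, y)\<in>D \<times> (\<Union>j\<in>J. A j). \<kappa> (x, y)) \<le> ereal C"
      using sup by (cases "SUP (x, y)\<in>D \<times> (\<Union>j\<in>J. A j). \<kappa> (x, y)") auto
    have "\<kappa> (x, y) \<le> ereal (max 0 C)" if "j \<in> J" "x \<in> D" "y \<in> A j" for j x y
    proof -
      have "\<kappa> (x, y) \<le> (SUP (x, y)\<in>D \<times> (\<Union>j\<in>J. A j). \<kappa> (x, y))"
        using that by (intro SUP_upper2[of "(x, y)"]) auto
      also note C
      also have "ereal C \<le> ereal (max 0 C)" by simp
      finally show ?thesis .
    qed
    then show ?thesis by (intro exI[of _ "max 0 C"]) auto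
  qed
  interpret potential_setup \<kappa> k c Iplus Iminus A a g f lam i F d
  proof unfold_locales
    show "continuous_on (A i \<times> A j) \<kappa>" if "j \<in> ?I" "(i \<in> Iplus) \<noteq> (j \<in> Iplus)" for j
      using opp[OF that]
    proof
      assume "i \<in> Iplus \<and> j \<in> Iminus"
      then show ?thesis by (intro continuous_on_subset[OF continuous]) auto
    next
      assume "i \<in> Iminus \<and> j \<in> Iplus"
      then show ?thesis by (intro continuous_on_subset[OF cont']) auto
    qed
    show "\<exists>C\<ge>0. \<forall>j\<in>?I. (i \<in> Iplus) \<noteq> (j \<in> Iplus) \<longrightarrow> (\<forall>x\<in>D. \<forall>y\<in>A j. \<kappa> (x, y) \<le> ereal C)"
      if D: "compact D" "D \<subseteq> A i" for D
    proof (cases "i \<in> Iplus")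
      case True
      then have "D \<subseteq> (\<Union>i\<in>Iplus. A i)" using D by blast
      with sup_plus D have "(SUP (x, y)\<in>D \<times> (\<Union>j\<in>Iminus. A j). \<kappa> (x, y)) < \<infinity>" by blast
      from bound[OF this] show ?thesis using True by blast
    next
      case False
      then have "D \<subseteq> (\<Union>j\<in>Iminus. A j)" using D i by blast
      with sup_minus D have "(SUP (x, y)\<in>D \<times> (\<Union>i\<in>Iplus. A i). \<kappa> (x, y)) < \<infinity>" by blast
      from bound[OF this] show ?thesis using False by blast
    qed
    show "\<exists>V K. open V \<and> x \<in> V \<and> compact K \<and> V \<subseteq> K" for x :: 'a
    proof -
      have "\<exists>U K. openin euclidean U \<and> compactin euclidean K \<and> x \<in> U \<and> U \<subseteq> K"
        using X unfolding locally_compact_space_def by simp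
      then obtain U K where "open U" "compact K" "x \<in> U" "U \<subseteq> K" by auto
      then show ?thesis by blast
    qed
  qed (use lam finite_lam A f g a i c k k_eq sym d F F_eq mass_sum in auto)
  have "eint (lam i) (weighted_potential \<kappa> Iplus Iminus f lam i) = ereal level" by (rule level_eq)
  then show "let W = weighted_potential \<kappa> Iplus Iminus f lam i; c = eint (lam i) W in
      \<bar>c\<bar> \<noteq> \<infinity> \<and>
      (\<forall>x\<in>msupport (lam i). ereal (a i) * W x \<le> c * ereal (g i x)) \<and>
      nearly_everywhere \<kappa> (msupport (lam i)) (\<lambda>x. ereal (a i) * W x = c * ereal (g i x))"
    using upper_bound_on_support equality_nearly_everywhere by (simp add: Let_def)
qed

end
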